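(* Let $E\subset\mathbb R^2$ be a trapezoid with height $h>0$ and bases (parallel sides) of lengths $\varepsilon_1,\varepsilon_2>0$, and suppose $h\ge\max\{\varepsilon_1,\varepsilon_2\}$. Then there exists a constant $C$ independent of $h,\varepsilon_1,\varepsilon_2$ such that $$\|v\|_{L^\infty(E)}\le C\,\|v\|_{L^\infty(\partial E)}\qquad\forall v\in V_E.$$
   Context: $V_E$ is the enhanced virtual element space of order one on $E$: $V_E=\{v\in H^1(E):v_{|\partial E}\in B_{\partial E},\ \Delta v\in\mathbb P_1(E),\ \int_E(v-\Pi^\nabla_Ev)q_1=0\ \forall q_1\in\mathbb P_1(E)\}$, where $B_{\partial E}$ is the space of continuous functions on $\partial E$ affine on each edge of $E$, and $\Pi^\nabla_E:H^1(E)\to\mathbb P_1(E)$ is defined by $(\nabla(v-\Pi^\nabla_Ev),\nabla q)_{L^2(E)}=0$ for all $q\in\mathbb P_1(E)$ and $\int_{\partial E}(v-\Pi^\nabla_Ev)=0$. *)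

theory Defs
  imports "HOL-Analysis.Analysis" "HOL-Probability.Essential_Supremum"
begin

section \<open>Smooth functions and gradients\<close>

definition grad :: "(real^2 \<Rightarrow> real) \<Rightarrow> real^2 \<Rightarrow> real^2" where
  "grad f x = (\<chi> i. frechet_derivative f (at x) (axis i 1))"

primrec Ck :: "nat \<Rightarrow> (real^2 \<Rightarrow> real) \<Rightarrow> bool" where
  "Ck 0 f \<longleftrightarrow> continuous_on UNIV f"
| "Ck (Suc k) f \<longleftrightarrow> (\<forall>x. f differentiable at x) \<and> (\<forall>i. Ck k (\<lambda>x. grad f x $ i))"

definition smooth :: "(real^2 \<Rightarrow> real) \<Rightarrow> bool" where
  "smooth f \<longleftrightarrow> (\<forall>k. Ck k f)"

definition test_function :: "(real^2) set \<Rightarrow> (real^2 \<Rightarrow> real) \<Rightarrow> bool" where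
  "test_function E \<phi> \<longleftrightarrow>
     smooth \<phi> \<and> compact (closure {x. \<phi> x \<noteq> 0}) \<and> closure {x. \<phi> x \<noteq> 0} \<subseteq> E"

section \<open>The Sobolev space of order one\<close>

text \<open>
  Functions on \<open>E\<close> are total functions on the plane; their values outside \<open>E\<close> are
  irrelevant.  They are representatives: nothing below distinguishes functions which agree
  almost everywhere on \<open>E\<close>.
\<close>

definition square_integrable :: "'a measure \<Rightarrow> ('a \<Rightarrow> 'b::euclidean_space) \<Rightarrow> bool" where
  "square_integrable M f \<longleftrightarrow> f \<in> borel_measurable M \<and> integrable M (\<lambda>x. (norm (f x))\<^sup>2)"

definition has_weak_gradient ::
    "(real^2) set \<Rightarrow> (real^2 \<Rightarrow> real) \<Rightarrow> (real^2 \<Rightarrow> real^2) \<Rightarrow> bool" where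
  "has_weak_gradient E v G \<longleftrightarrow>
     square_integrable (lebesgue_on E) v \<and> square_integrable (lebesgue_on E) G \<and>
     (\<forall>\<phi> i. test_function E \<phi> \<longrightarrow>
        (LINT x|lebesgue_on E. v x * grad \<phi> x $ i) = - (LINT x|lebesgue_on E. G x $ i * \<phi> x))"

definition H1 :: "(real^2) set \<Rightarrow> (real^2 \<Rightarrow> real) set" where
  "H1 E = {v. \<exists>G. has_weak_gradient E v G}"

definition P1 :: "(real^2 \<Rightarrow> real) set" where
  "P1 = {p. \<exists>c a. p = (\<lambda>x. c + a \<bullet> x)}"

text \<open>The distributional Laplacian, that is, the distributional divergence of the weak gradient.\<close>

definition has_weak_laplacian ::
    "(real^2) set \<Rightarrow> (real^2 \<Rightarrow> real) \<Rightarrow> (real^2 \<Rightarrow> real) \<Rightarrow> bool" where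
  "has_weak_laplacian E v p \<longleftrightarrow> (\<exists>G. has_weak_gradient E v G \<and>
     (\<forall>\<phi>. test_function E \<phi> \<longrightarrow>
        (LINT x|lebesgue_on E. G x \<bullet> grad \<phi> x) = - (LINT x|lebesgue_on E. p x * \<phi> x)))"

definition Linf_norm :: "'a measure \<Rightarrow> ('a \<Rightarrow> real) \<Rightarrow> ereal" where
  "Linf_norm M f = esssup M (\<lambda>x. ereal \<bar>f x\<bar>)"

section \<open>Convex polygons, their boundary measure, and traces\<close>

text \<open>A convex polygon is given by its vertices, listed in cyclic order.\<close>

definition polygon :: "(real^2) list \<Rightarrow> (real^2) set" where
  "polygon vs = interior (convex hull (set vs))"

definition edges :: "(real^2) list \<Rightarrow> ((real^2) \<times> (real^2)) list" where
  "edges vs = zip vs (rotate1 vs)"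

text \<open>Arc length on the boundary.\<close>

definition boundary_measure :: "(real^2) list \<Rightarrow> (real^2) measure" where
  "boundary_measure vs = measure_of UNIV (sets borel)
     (\<lambda>A. \<Sum>(p, q)\<leftarrow>edges vs. ennreal (dist p q) * emeasure lborel {t \<in> {0..1}. linepath p q t \<in> A})"

lemma space_boundary_measure [simp]: "space (boundary_measure vs) = UNIV"
  by (simp add: boundary_measure_def)

lemma sets_boundary_measure [simp]: "sets (boundary_measure vs) = sets borel"
  unfolding boundary_measure_def using sets.sigma_sets_eq[of "borel :: (real^2) measure"] by simp

lemma emeasure_boundary_measure:
  assumes "A \<in> sets borel"
  shows "emeasure (boundary_measure vs) A =
    (\<Sum>(p, q)\<leftarrow>edges vs. ennreal (dist p q) * emeasure lborel {t \<in> {0..1}. linepath p q t \<in> A})"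
proof -
  let ?m = "\<lambda>e A. ennreal (dist (fst e) (snd e)) *
    emeasure lborel {t \<in> {0..1}. linepath (fst e) (snd e) t \<in> A}"
  let ?\<mu> = "\<lambda>A. \<Sum>e\<leftarrow>edges vs. ?m e A"
  have meas: "{t \<in> {0..1}. linepath p q t \<in> A} \<in> sets lborel"
    if "A \<in> sets borel" for A and p q :: "real^2"
  proof -
    have "linepath p q \<in> borel_measurable borel"
      by (intro borel_measurable_continuous_onI continuous_intros)
    then have "linepath p q -` A \<inter> space borel \<in> sets borel"
      using that by (rule measurable_sets)
    then have "{0..1} \<inter> (linepath p q -` A \<inter> space borel) \<in> sets borel"
      by (intro sets.Int) auto
    moreover have "{0..1} \<inter> (linepath p q -` A \<inter> space borel) = {t \<in> {0..1}. linepath p q t \<in> A}"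
      by auto
    ultimately show ?thesis by simp
  qed
  have one: "(\<Sum>i. ?m e (F i)) = ?m e (\<Union>i. F i)"
    if "range F \<subseteq> sets borel" "disjoint_family F" for e and F :: "nat \<Rightarrow> (real^2) set"
  proof -
    let ?T = "\<lambda>i. {t \<in> {0..1}. linepath (fst e) (snd e) t \<in> F i}"
    have "(\<Sum>i. emeasure lborel (?T i)) = emeasure lborel (\<Union>i. ?T i)"
    proof (rule suminf_emeasure)
      show "range ?T \<subseteq> sets lborel"
        using that(1) by (intro image_subsetI meas) auto
      show "disjoint_family ?T"
        using that(2) by (auto simp: disjoint_family_on_def)
    qed
    also have "(\<Union>i. ?T i) = {t \<in> {0..1}. linepath (fst e) (snd e) t \<in> (\<Union>i. F i)}"
      by auto
    finally show ?thesis by simp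
  qed
  have sums: "(\<Sum>i. \<Sum>e\<leftarrow>es. ?m e (F i)) = (\<Sum>e\<leftarrow>es. ?m e (\<Union>i. F i))"
    if "range F \<subseteq> sets borel" "disjoint_family F"
    for es and F :: "nat \<Rightarrow> (real^2) set"
    using one[OF that] by (induction es) (simp_all add: suminf_add[symmetric])
  have "emeasure (measure_of UNIV (sets borel) ?\<mu>) A = ?\<mu> A"
  proof (rule emeasure_measure_of_sigma)
    show "sigma_algebra UNIV (sets (borel :: (real^2) measure))"
      using sets.sigma_algebra_axioms[of "borel :: (real^2) measure"] by simp
    show "positive (sets borel) ?\<mu>"
      by (simp add: positive_def)
    show "countably_additive (sets borel) ?\<mu>"
      using sums by (auto simp: countably_additive_def)
  qed (use assms in simp_all)
  then show ?thesis by (simp add: boundary_measure_def case_prod_unfold)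
qed

text \<open>
  The trace operator is the continuous extension of the restriction map from the functions
  smooth up to the boundary; as a relation, it is the closure of the graph of that map with
  respect to \<open>H\<^sup>1(E)\<close> and \<open>L\<^sup>2(\<partial>E)\<close>.
\<close>

definition has_trace :: "(real^2) list \<Rightarrow> (real^2 \<Rightarrow> real) \<Rightarrow> (real^2 \<Rightarrow> real) \<Rightarrow> bool" where
  "has_trace vs v \<beta> \<longleftrightarrow> square_integrable (boundary_measure vs) \<beta> \<and>
     (\<exists>G \<phi>. has_weak_gradient (polygon vs) v G \<and> (\<forall>n. smooth (\<phi> n)) \<and>
       (\<lambda>n. \<integral>\<^sup>+x. ennreal ((\<phi> n x - v x)\<^sup>2) \<partial>lebesgue_on (polygon vs)) \<longlonglongrightarrow> 0 \<and>
       (\<lambda>n. \<integral>\<^sup>+x. ennreal ((norm (grad (\<phi> n) x - G x))\<^sup>2) \<partial>lebesgue_on (polygon vs)) \<longlonglongrightarrow> 0 \<and>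
       (\<lambda>n. \<integral>\<^sup>+x. ennreal ((\<phi> n x - \<beta> x)\<^sup>2) \<partial>boundary_measure vs) \<longlonglongrightarrow> 0)"

section \<open>The enhanced virtual element space of order one\<close>

definition boundary_space :: "(real^2) list \<Rightarrow> (real^2 \<Rightarrow> real) set" where
  "boundary_space vs = {\<beta>. continuous_on (frontier (polygon vs)) \<beta> \<and>
     (\<forall>(p, q) \<in> set (edges vs). \<forall>t \<in> {0..1}. \<beta> (linepath p q t) = (1 - t) * \<beta> p + t * \<beta> q)}"

definition is_nabla_projection :: "(real^2) list \<Rightarrow> (real^2 \<Rightarrow> real) \<Rightarrow> (real^2 \<Rightarrow> real) \<Rightarrow> bool" where
  "is_nabla_projection vs v p \<longleftrightarrow> p \<in> P1 \<and>
     (\<exists>G. has_weak_gradient (polygon vs) v G \<and>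
       (\<forall>q \<in> P1. (LINT x|lebesgue_on (polygon vs). (G x - grad p x) \<bullet> grad q x) = 0)) \<and>
     (\<exists>\<beta>. has_trace vs v \<beta> \<and> (LINT x|boundary_measure vs. \<beta> x - p x) = 0)"

definition VE_space :: "(real^2) list \<Rightarrow> (real^2 \<Rightarrow> real) set" where
  "VE_space vs = {v \<in> H1 (polygon vs).
     (\<exists>\<beta> \<in> boundary_space vs. has_trace vs v \<beta>) \<and>
     (\<exists>p \<in> P1. has_weak_laplacian (polygon vs) v p) \<and>
     (\<exists>p. is_nabla_projection vs v p \<and>
       (\<forall>q \<in> P1. (LINT x|lebesgue_on (polygon vs). (v x - p x) * q x) = 0))}"

section \<open>Trapezoids\<close>

text \<open>
  The vertices \<open>a, b, c, d\<close> are in cyclic order, the bases are \<open>ab\<close> and \<open>dc\<close>, pointing in the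
  common direction \<open>u\<close>, and \<open>n\<close> is the normal along which the height is measured.
  Parallelograms are not excluded.
\<close>

definition is_trapezoid ::
    "real^2 \<Rightarrow> real^2 \<Rightarrow> real^2 \<Rightarrow> real^2 \<Rightarrow> real \<Rightarrow> real \<Rightarrow> real \<Rightarrow> bool" where
  "is_trapezoid a b c d h \<epsilon>1 \<epsilon>2 \<longleftrightarrow> h > 0 \<and> \<epsilon>1 > 0 \<and> \<epsilon>2 > 0 \<and>
     (\<exists>u n. norm u = 1 \<and> norm n = 1 \<and> u \<bullet> n = 0 \<and>
       b - a = \<epsilon>1 *\<^sub>R u \<and> c - d = \<epsilon>2 *\<^sub>R u \<and> (d - a) \<bullet> n = h)"

end

(* The function v satisfies Delta v = p for an affine p. In the trapezoid E, which lies in a strip of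
   width W, comparison with a quadratic barrier gives |v| <= M + sup |p| W^2 / 2, where M bounds the
   boundary values, so everything reduces to sup |p| W^2 <= C M. Let z = theta(v) be the part of v
   exceeding M, which vanishes on the boundary. Testing with z and using the enhancement constraint
   in the form int p v = int p (Pi v), where |Pi v| <= 9 M, bounds the energy of z by
   11 M sup |p| |E|, hence int z^2 by a multiple of W^2 M sup |p| |E|. Conversely, for bump
   functions phi in the wider half of E the identity int p phi = int v Delta phi bounds the
   coefficients of p by a multiple of W^(-2) (|E|^(-1/2) ||z|| + M). Together this yields
   sup |p| W^2 <= C M. Only v - z, which is bounded by 2 M, and z enter, so no harmonic
   extension of the boundary values is needed. *)
theory Submission
  imports Defs
begin

section \<open>Smooth functions\<close>

text \<open>The two estimates form a circle: \<open>p\<close> is controlled through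
  \<open>z\<close>, and \<open>z\<close> through \<open>p\<close>. Testing with \<open>z\<close>
  alone bounds its L2 norm linearly in sup |p|, with a constant that need not be small, so nothing
  could be absorbed. The enhancement constraint replaces \<open>z\<close> in the integral of
  \<open>p z\<close> by functions bounded by a multiple of M. The norm of \<open>z\<close> then
  grows only like the square root of M sup |p|, and Young's inequality closes the circle.

  The constants must not see the shear of the trapezoid. Hence W is the distance between two
  parallel level lines of \<open>al\<close>, which is at most the longer base, and the height
  condition enters only through 1/h \<le> 1/W in \<open>test_lap_bound\<close>.

  The analytic obstacle is that the weak equation admits only compactly supported test functions,
  whereas \<open>z\<close> is a limit of smooth functions whose boundary values merely tend to 0.
  Multiplying by cutoffs bridges this gap, and Hardy's inequality pays for their gradients. Traces
  must also be shown unique, since the one that normalises the projection need not be the given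
  one.\<close>

lemma grad_eqI:
  assumes "(f has_derivative (\<lambda>h. V \<bullet> h)) (at x)"
  shows "grad f x = V"
proof -
  have "frechet_derivative f (at x) = (\<lambda>h. V \<bullet> h)"
    using frechet_derivative_at[OF assms] by simp
  then show ?thesis
    by (simp add: grad_def vec_eq_iff inner_axis)
qed

lemma has_derivative_grad:
  assumes "f differentiable at x"
  shows "(f has_derivative (\<lambda>h. grad f x \<bullet> h)) (at x)"
proof -
  let ?D = "frechet_derivative f (at x)"
  have D: "(f has_derivative ?D) (at x)"
    using assms frechet_derivative_works by blast
  then have l: "linear ?D" by (rule has_derivative_linear)
  have "?D h = grad f x \<bullet> h" for h
  proof -
    have "?D h = ?D (\<Sum>i\<in>UNIV. h $ i *\<^sub>R axis i 1)"
      by (simp add: basis_expansion scalar_mult_eq_scaleR[symmetric])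
    also have "\<dots> = (\<Sum>i\<in>UNIV. h $ i * ?D (axis i 1))"
      by (simp add: linear_sum[OF l] linear_scale[OF l])
    also have "\<dots> = grad f x \<bullet> h"
      by (simp add: grad_def inner_vec_def mult.commute)
    finally show ?thesis .
  qed
  then have "?D = (\<lambda>h. grad f x \<bullet> h)" by auto
  with D show ?thesis by simp
qed

lemma Ck_grad: "Ck (Suc k) f \<Longrightarrow> (f has_derivative (\<lambda>h. grad f x \<bullet> h)) (at x)"
  by (simp add: has_derivative_grad)

text \<open>The induction step for the closure properties below: once a candidate \<open>V\<close>
  is known to represent the total derivative, no partial derivative has to be computed.\<close>

lemma Ck_SucI:
  assumes "\<And>x. (f has_derivative (\<lambda>h. V x \<bullet> h)) (at x)" "\<And>i. Ck k (\<lambda>x. V x $ i)"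
  shows "Ck (Suc k) f"
proof -
  have "grad f = V" using grad_eqI[OF assms(1)] by auto
  then show ?thesis using assms by (auto simp: differentiable_def)
qed

lemma Ck_continuous: "Ck k f \<Longrightarrow> continuous_on UNIV f"
  by (cases k) (auto intro!: continuous_at_imp_continuous_on differentiable_imp_continuous_within)

lemma Ck_Suc_imp: "Ck (Suc k) f \<Longrightarrow> Ck k f"
proof (induction k arbitrary: f)
  case 0
  then show ?case using Ck_continuous by (metis Ck.simps(1))
next
  case (Suc k)
  then show ?case by (metis Ck.simps(2))
qed

lemma Ck_const [simp]: "Ck k (\<lambda>x. c)"
proof (induction k arbitrary: c)
  case (Suc k)
  then show ?case by (intro Ck_SucI[where V = "\<lambda>x. 0"]) auto
qed simp

lemma Ck_add: "Ck k f \<Longrightarrow> Ck k g \<Longrightarrow> Ck k (\<lambda>x. f x + g x)"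
proof (induction k arbitrary: f g)
  case (Suc k)
  have "((\<lambda>x. f x + g x) has_derivative (\<lambda>h. (grad f x + grad g x) \<bullet> h)) (at x)" for x
    by (intro has_derivative_eq_rhs[OF has_derivative_add[OF Ck_grad[OF Suc.prems(1)] Ck_grad[OF Suc.prems(2)]]])
      (auto simp: inner_add_left)
  then show ?case
    by (rule Ck_SucI) (use Suc in \<open>auto\<close>)
qed (auto intro: continuous_intros)

lemma Ck_mult: "Ck k f \<Longrightarrow> Ck k g \<Longrightarrow> Ck k (\<lambda>x. f x * g x)"
proof (induction k arbitrary: f g)
  case (Suc k)
  have "((\<lambda>x. f x * g x) has_derivative (\<lambda>h. (f x *\<^sub>R grad g x + g x *\<^sub>R grad f x) \<bullet> h)) (at x)" for x
    by (intro has_derivative_eq_rhs[OF has_derivative_mult[OF Ck_grad[OF Suc.prems(1)] Ck_grad[OF Suc.prems(2)]]])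
      (auto simp: inner_add_left mult.commute)
  then show ?case
    by (rule Ck_SucI) (use Suc Ck_Suc_imp in \<open>auto intro!: Ck_add\<close>)
qed (auto intro: continuous_intros)

lemma has_derivative_affine: "((\<lambda>x. c + m \<bullet> x) has_derivative (\<lambda>h. m \<bullet> h)) (at (x::real^2))"
  by (auto intro!: derivative_eq_intros)

lemma Ck_affine: "Ck k (\<lambda>x. c + m \<bullet> x)"
proof (cases k)
  case 0
  then show ?thesis by (auto intro!: continuous_intros)
next
  case (Suc l)
  then show ?thesis by (auto intro!: Ck_SucI[where V = "\<lambda>x. m"] has_derivative_affine simp del: Ck.simps)
qed

section \<open>Smooth functions of one variable and their compositions\<close>

primrec Ck1 :: "nat \<Rightarrow> (real \<Rightarrow> real) \<Rightarrow> bool" where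
  "Ck1 0 f \<longleftrightarrow> continuous_on UNIV f"
| "Ck1 (Suc k) f \<longleftrightarrow> (\<exists>f'. (\<forall>t. (f has_real_derivative f' t) (at t)) \<and> Ck1 k f')"

definition smooth1 :: "(real \<Rightarrow> real) \<Rightarrow> bool" where
  "smooth1 f \<longleftrightarrow> (\<forall>k. Ck1 k f)"

lemma Ck1_continuous: "Ck1 k f \<Longrightarrow> continuous_on UNIV f"
  by (cases k) (auto intro!: continuous_at_imp_continuous_on intro: DERIV_isCont)

lemma Ck1_Suc_imp: "Ck1 (Suc k) f \<Longrightarrow> Ck1 k f"
proof (induction k arbitrary: f)
  case 0
  then show ?case using Ck1_continuous by (metis Ck1.simps(1))
next
  case (Suc k)
  then show ?case by (metis Ck1.simps(2))
qed

lemma Ck1_const [simp]: "Ck1 k (\<lambda>x. c)"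
proof (induction k arbitrary: c)
  case (Suc k)
  then show ?case by (auto intro!: exI[of _ "\<lambda>t. 0"])
qed simp

lemma Ck1_add: "Ck1 k f \<Longrightarrow> Ck1 k g \<Longrightarrow> Ck1 k (\<lambda>x. f x + g x)"
proof (induction k arbitrary: f g)
  case (Suc k)
  then obtain f' g' where "\<And>t. (f has_real_derivative f' t) (at t)" "Ck1 k f'"
     "\<And>t. (g has_real_derivative g' t) (at t)" "Ck1 k g'" by auto
  with Suc.IH show ?case
    by (auto intro!: exI[of _ "\<lambda>t. f' t + g' t"] derivative_intros)
qed (auto intro: continuous_intros)

lemma Ck1_mult: "Ck1 k f \<Longrightarrow> Ck1 k g \<Longrightarrow> Ck1 k (\<lambda>x. f x * g x)"
proof (induction k arbitrary: f g)
  case (Suc k)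
  then obtain f' g' where d: "\<And>t. (f has_real_derivative f' t) (at t)" "Ck1 k f'"
     "\<And>t. (g has_real_derivative g' t) (at t)" "Ck1 k g'" by auto
  have "Ck1 k f" "Ck1 k g" using Suc.prems Ck1_Suc_imp by auto
  with Suc.IH d show ?case
    by (auto intro!: exI[of _ "\<lambda>t. f' t * g t + f t * g' t"] derivative_eq_intros Ck1_add)
qed (auto intro: continuous_intros)

lemma Ck1_affine: "Ck1 k (\<lambda>t. c + m * t)"
proof (cases k)
  case 0
  then show ?thesis by (auto intro!: continuous_intros)
next
  case (Suc l)
  have "((\<lambda>t. c + m * t) has_real_derivative m) (at t)" for t
    by (auto intro!: derivative_eq_intros)
  then show ?thesis using Suc by (auto intro!: exI[of _ "\<lambda>t. m"])
qed

lemma Ck1_comp_affine: "Ck1 k f \<Longrightarrow> Ck1 k (\<lambda>t. f (c + m * t))"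
proof (induction k arbitrary: f)
  case 0
  then show ?case by (auto intro!: continuous_on_compose2[of UNIV f] continuous_intros)
next
  case (Suc k)
  then obtain f' where f': "\<And>t. (f has_real_derivative f' t) (at t)" "Ck1 k f'" by auto
  have "((\<lambda>t. f (c + m * t)) has_real_derivative m * f' (c + m * t)) (at t)" for t
    proof -
    have "((\<lambda>t. c + m * t) has_real_derivative m) (at t)"
      by (auto intro!: derivative_eq_intros)
    from DERIV_chain2[OF f'(1) this] show ?thesis by (simp add: mult.commute)
  qed
  with Suc.IH[OF f'(2)] show ?case
    by (auto intro!: exI[of _ "\<lambda>t. m * f' (c + m * t)"] Ck1_mult)
qed

lemma smooth1_const: "smooth1 (\<lambda>x. c)"
  and smooth1_add: "smooth1 f \<Longrightarrow> smooth1 g \<Longrightarrow> smooth1 (\<lambda>t. f t + g t)"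
  and smooth1_mult: "smooth1 f \<Longrightarrow> smooth1 g \<Longrightarrow> smooth1 (\<lambda>t. f t * g t)"
  and smooth1_affine: "smooth1 (\<lambda>t. c + m * t)"
  and smooth1_comp_affine: "smooth1 f \<Longrightarrow> smooth1 (\<lambda>t. f (c + m * t))"
  by (simp_all add: smooth1_def Ck1_add Ck1_mult Ck1_affine Ck1_comp_affine)

lemma smooth1_deriv:
  assumes "smooth1 f"
  shows "(f has_real_derivative deriv f t) (at t)" "smooth1 (deriv f)"
proof -
  have *: "\<exists>f'. (\<forall>t. (f has_real_derivative f' t) (at t)) \<and> Ck1 k f'" for k
    using assms by (metis smooth1_def Ck1.simps(2))
  have **: "f' = deriv f" if "\<forall>t. (f has_real_derivative f' t) (at t)" for f'
    using that by (auto intro!: ext DERIV_imp_deriv[symmetric])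
  show "(f has_real_derivative deriv f t) (at t)"
    using *[of 0] ** by auto
  show "smooth1 (deriv f)"
    using * ** by (fastforce simp: smooth1_def)
qed

lemma smooth1_continuous: "smooth1 f \<Longrightarrow> continuous_on S f"
  using Ck1_continuous smooth1_def continuous_on_subset by (metis subset_UNIV)

lemma Ck_comp: "Ck1 k f \<Longrightarrow> Ck k g \<Longrightarrow> Ck k (\<lambda>x. f (g x))"
proof (induction k arbitrary: f)
  case 0
  then show ?case by (auto intro!: continuous_on_compose2[of UNIV f])
next
  case (Suc k)
  then obtain f' where f': "\<And>t. (f has_real_derivative f' t) (at t)" "Ck1 k f'" by auto
  have "((\<lambda>x. f (g x)) has_derivative (\<lambda>h. (f' (g x) *\<^sub>R grad g x) \<bullet> h)) (at x)" for x
    by (rule has_derivative_eq_rhs[OF DERIV_compose_FDERIV[OF f'(1) Ck_grad[OF Suc.prems(2)]]])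
      (auto simp: mult.commute)
  then show ?case
    by (rule Ck_SucI) (use Suc f' Ck_Suc_imp in \<open>auto intro!: Ck_mult\<close>)
qed

lemma smooth_const: "smooth (\<lambda>x. c)"
  and smooth_add: "smooth f \<Longrightarrow> smooth g \<Longrightarrow> smooth (\<lambda>x. f x + g x)"
  and smooth_mult: "smooth f \<Longrightarrow> smooth g \<Longrightarrow> smooth (\<lambda>x. f x * g x)"
  and smooth_affine: "smooth (\<lambda>x. c + m \<bullet> x)"
  and smooth_comp: "smooth1 \<eta> \<Longrightarrow> smooth g \<Longrightarrow> smooth (\<lambda>x. \<eta> (g x))"
  by (simp_all add: smooth_def smooth1_def Ck_add Ck_mult Ck_affine Ck_comp)

lemma smooth_minus: "smooth f \<Longrightarrow> smooth (\<lambda>x. - f x)"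
  using smooth_mult[OF smooth_const[of "-1"]] by simp

lemma smooth_diff: "smooth f \<Longrightarrow> smooth g \<Longrightarrow> smooth (\<lambda>x. f x - g x)"
  using smooth_add[OF _ smooth_minus] by simp

lemma smooth_has_derivative: "smooth f \<Longrightarrow> (f has_derivative (\<lambda>h. grad f x \<bullet> h)) (at x)"
  unfolding smooth_def by (rule Ck_grad) auto

lemma smooth_grad: "smooth f \<Longrightarrow> smooth (\<lambda>x. grad f x $ i)"
  unfolding smooth_def by (metis Ck.simps(2))

lemma smooth_continuous: "smooth f \<Longrightarrow> continuous_on S f"
  using Ck_continuous smooth_def continuous_on_subset by (metis subset_UNIV)

lemma smooth_continuous_grad: "smooth f \<Longrightarrow> continuous_on S (grad f)"
  using smooth_continuous[OF smooth_grad]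
  by (subst continuous_on_componentwise) (auto simp: Basis_vec_def inner_axis)

lemma grad_affine: "grad (\<lambda>x. c + m \<bullet> x) x = m"
  by (intro grad_eqI has_derivative_affine)

lemma grad_add:
  assumes "smooth f" "smooth g"
  shows "grad (\<lambda>x. f x + g x) x = grad f x + grad g x"
  by (intro grad_eqI has_derivative_eq_rhs[OF has_derivative_add[OF smooth_has_derivative[OF assms(1)] smooth_has_derivative[OF assms(2)]]])
    (auto simp: inner_add_left)

lemma grad_diff:
  assumes "smooth f" "smooth g"
  shows "grad (\<lambda>x. f x - g x) x = grad f x - grad g x"
  by (intro grad_eqI has_derivative_eq_rhs[OF has_derivative_diff[OF smooth_has_derivative[OF assms(1)] smooth_has_derivative[OF assms(2)]]])
    (auto simp: inner_diff_left)

lemma grad_mult: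
  assumes "smooth f" "smooth g"
  shows "grad (\<lambda>x. f x * g x) x = f x *\<^sub>R grad g x + g x *\<^sub>R grad f x"
  by (intro grad_eqI has_derivative_eq_rhs[OF has_derivative_mult[OF smooth_has_derivative[OF assms(1)] smooth_has_derivative[OF assms(2)]]])
    (auto simp: inner_add_left mult.commute)

lemma grad_comp:
  assumes "(\<eta> has_real_derivative d) (at (g x))" "smooth g"
  shows "grad (\<lambda>x. \<eta> (g x)) x = d *\<^sub>R grad g x"
  by (intro grad_eqI has_derivative_eq_rhs[OF DERIV_compose_FDERIV[OF assms(1) smooth_has_derivative[OF assms(2)]]])
    (auto simp: mult.commute)

section \<open>The flat exponential function and a smooth positive part\<close>

definition flat_exp :: "nat \<Rightarrow> real \<Rightarrow> real" where
  "flat_exp k t = (if t > 0 then (1 / t) ^ k * exp (- (1 / t)) else 0)"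

lemma flat_exp_tendsto: "(flat_exp k \<longlongrightarrow> 0) (at_right 0)"
proof -
  have "((\<lambda>t. inverse t ^ k / exp (inverse t)) \<longlongrightarrow> (0::real)) (at_right 0)"
    using filterlim_compose[OF tendsto_power_div_exp_0 filterlim_inverse_at_top_right] .
  then show ?thesis
  proof (rule Lim_transform_eventually)
    show "\<forall>\<^sub>F t in at_right 0. inverse t ^ k / exp (inverse t) = flat_exp k t"
      using eventually_at_right_less[of 0]
      by eventually_elim (simp add: flat_exp_def exp_minus field_simps)
  qed
qed

text \<open>The powers of 1/t are carried along to make the family closed under differentiation, so
  that smoothness follows by an induction inside the family. At 0 the right difference quotient is
  the member with exponent \<open>k + 1\<close>, which tends to 0.\<close>

lemma flat_exp_deriv:
  "(flat_exp k has_real_derivative flat_exp (k + 2) t - real k * flat_exp (k + 1) t) (at t)"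
proof -
  consider "t > 0" | "t < 0" | "t = 0" by linarith
  then show ?thesis
  proof cases
    case 1
    have "((\<lambda>t. (1 / t) ^ k * exp (- (1 / t))) has_real_derivative
        flat_exp (k + 2) t - real k * flat_exp (k + 1) t) (at t)"
    proof -
      have d: "((\<lambda>t. 1 / t) has_real_derivative - (1 / t)\<^sup>2) (at t)"
        using 1 by (auto intro!: derivative_eq_intros simp: power2_eq_square)
      have "((\<lambda>t. exp (- (1 / t))) has_real_derivative exp (- (1 / t)) * (1 / t)\<^sup>2) (at t)"
        using DERIV_chain2[OF DERIV_exp DERIV_minus[OF d]] by simp
      from DERIV_mult[OF DERIV_power[OF d, of k] this] show ?thesis
        by (rule DERIV_cong) (use 1 in \<open>cases k; simp add: flat_exp_def algebra_simps power2_eq_square\<close>)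
    qed
    then show ?thesis
      by (rule has_field_derivative_transform_within_open[where S = "{0<..}"])
        (use 1 in \<open>auto simp: flat_exp_def\<close>)
  next
    case 2
    have "((\<lambda>t. 0) has_real_derivative 0) (at t)" by simp
    then have "(flat_exp k has_real_derivative 0) (at t)"
      by (rule has_field_derivative_transform_within_open[where S = "{..<0}"])
        (use 2 in \<open>auto simp: flat_exp_def\<close>)
    then show ?thesis using 2 by (simp add: flat_exp_def)
  next
    case 3
    have "((\<lambda>h. (flat_exp k h - flat_exp k 0) / (h - 0)) \<longlongrightarrow> 0) (at 0)"
    proof (rule filterlim_split_at)
      have "((\<lambda>h. 0) \<longlongrightarrow> (0::real)) (at_left 0)" by simp
      then show "((\<lambda>h. (flat_exp k h - flat_exp k 0) / (h - 0)) \<longlongrightarrow> 0) (at_left 0)"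
        by (rule Lim_transform_eventually)
          (auto simp: eventually_at_filter flat_exp_def intro!: always_eventually)
      show "((\<lambda>h. (flat_exp k h - flat_exp k 0) / (h - 0)) \<longlongrightarrow> 0) (at_right 0)"
        by (rule Lim_transform_eventually[OF flat_exp_tendsto[of "Suc k"]])
          (use eventually_at_right_less[of 0] in \<open>auto elim!: eventually_mono simp: flat_exp_def\<close>)
    qed
    then show ?thesis using 3 by (simp add: has_field_derivative_iff flat_exp_def)
  qed
qed

lemma Ck1_flat_exp: "Ck1 n (flat_exp k)"
proof (induction n arbitrary: k)
  case 0
  show ?case
    using DERIV_isCont[OF flat_exp_deriv[of k]] by (simp add: continuous_at_imp_continuous_on)
next
  case (Suc n)
  have "Ck1 n (\<lambda>t. flat_exp (k + 2) t + (- real k) * flat_exp (k + 1) t)"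
    by (intro Ck1_add Ck1_mult Suc Ck1_const)
  then show ?case using flat_exp_deriv[of k]
    by (auto intro!: exI[of _ "\<lambda>t. flat_exp (k + 2) t + (- real k) * flat_exp (k + 1) t"])
qed

lemma smooth1_flat_exp: "smooth1 (flat_exp k)"
  by (simp add: smooth1_def Ck1_flat_exp)

lemma flat_exp_nonneg: "0 \<le> flat_exp k t"
  by (simp add: flat_exp_def)

lemma flat_exp_0_le_1: "flat_exp 0 t \<le> 1"
  by (simp add: flat_exp_def)

text \<open>A smooth convex substitute for the positive part: \<open>t - 1 \<le> ramp t \<le> max t 0\<close>.\<close>

definition ramp :: "real \<Rightarrow> real" where
  "ramp t = t * flat_exp 0 t"

text \<open>The derivative of \<open>ramp\<close>: in \<open>t * flat_exp 2 t + flat_exp 0 t\<close>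
  the factor \<open>t\<close> lowers the exponent 2 to 1. In this form nonnegativity is
  immediate.\<close>

definition ramp' :: "real \<Rightarrow> real" where
  "ramp' t = flat_exp 0 t + flat_exp 1 t"

lemma smooth1_ramp: "smooth1 ramp"
  using smooth1_mult[OF smooth1_affine[of 0 1] smooth1_flat_exp] unfolding ramp_def[abs_def] by simp

lemma ramp_deriv: "(ramp has_real_derivative ramp' t) (at t)"
proof -
  have "(ramp has_real_derivative t * flat_exp 2 t + flat_exp 0 t) (at t)"
    unfolding ramp_def[abs_def]
    by (rule derivative_eq_intros flat_exp_deriv refl)+ (simp add: numeral_2_eq_2)
  moreover have "t * flat_exp 2 t + flat_exp 0 t = ramp' t"
    by (simp add: ramp'_def flat_exp_def power2_eq_square)
  ultimately show ?thesis by simp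
qed

lemma ramp'_nonneg: "0 \<le> ramp' t"
  by (simp add: ramp'_def flat_exp_nonneg)

text \<open>This is \<open>1 + r \<le> exp r\<close> at r = 1/t.\<close>

lemma ramp'_le_1: "ramp' t \<le> 1"
proof (cases "t > 0")
  case True
  have "exp (- (1 / t)) * (1 + 1 / t) \<le> exp (- (1 / t)) * exp (1 / t)"
    by (intro mult_left_mono exp_ge_add_one_self) auto
  also have "\<dots> = 1" by (simp add: exp_minus)
  finally show ?thesis using True by (simp add: ramp'_def flat_exp_def algebra_simps)
qed (simp add: ramp'_def flat_exp_def)

lemma continuous_ramp': "continuous_on S ramp'"
  unfolding ramp'_def[abs_def]
  by (intro continuous_on_add smooth1_continuous smooth1_flat_exp)

lemma ramp_bounds: "t - 1 \<le> ramp t" "ramp t \<le> t \<or> ramp t = 0" "0 \<le> ramp t"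
proof -
  have "t * (1 - 1 / t) \<le> t * exp (- (1 / t))" if "t > 0"
    using that exp_ge_add_one_self[of "-(1/t)"] by (intro mult_left_mono) auto
  then show "t - 1 \<le> ramp t"
    by (auto simp: ramp_def flat_exp_def algebra_simps)
  show "ramp t \<le> t \<or> ramp t = 0"
    using flat_exp_0_le_1[of t] mult_left_mono[OF flat_exp_0_le_1[of t], of t]
    by (auto simp: ramp_def flat_exp_def)
  show "0 \<le> ramp t" by (auto simp: ramp_def flat_exp_def)
qed

lemma ramp_eq_0: "ramp t = 0 \<longleftrightarrow> t \<le> 0"
  by (auto simp: ramp_def flat_exp_def)

section \<open>Square integrable functions\<close>

lemma square_integrable_measurable: "square_integrable M f \<Longrightarrow> f \<in> borel_measurable M"
  by (simp add: square_integrable_def)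

lemma square_integrable_integrable: "square_integrable M f \<Longrightarrow> integrable M (\<lambda>x. (norm (f x))\<^sup>2)"
  by (simp add: square_integrable_def)

lemma square_integrable_bound:
  assumes "square_integrable M g" "f \<in> borel_measurable M" "AE x in M. norm (f x) \<le> c * norm (g x)"
  shows "square_integrable M f"
  unfolding square_integrable_def
proof
  show "integrable M (\<lambda>x. (norm (f x))\<^sup>2)"
  proof (rule Bochner_Integration.integrable_bound)
    show "integrable M (\<lambda>x. c\<^sup>2 * (norm (g x))\<^sup>2)"
      using assms(1) by (simp add: square_integrable_def)
    show "AE x in M. norm ((norm (f x))\<^sup>2) \<le> norm (c\<^sup>2 * (norm (g x))\<^sup>2)"
      using assms(3) by eventually_elim (auto simp: power_mult_distrib[symmetric] intro: power_mono)
  qed (use assms(2) in measurable)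
qed fact

lemma square_integrable_inner:
  assumes "square_integrable M f" "square_integrable M g"
  shows "integrable M (\<lambda>x. f x \<bullet> g x)"
proof (rule Bochner_Integration.integrable_bound)
  show "integrable M (\<lambda>x. (norm (f x))\<^sup>2 + (norm (g x))\<^sup>2)"
    using assms by (simp add: square_integrable_def)
  show "(\<lambda>x. f x \<bullet> g x) \<in> borel_measurable M"
    using assms[THEN square_integrable_measurable] by measurable
  have "\<bar>a \<bullet> b\<bar> \<le> (norm a)\<^sup>2 + (norm b)\<^sup>2" for a b :: 'b
    using Cauchy_Schwarz_ineq2[of a b] sum_squares_bound[of "norm a" "norm b"]
      mult_nonneg_nonneg[of "norm a" "norm b"] by linarith
  then show "AE x in M. norm (f x \<bullet> g x) \<le> norm ((norm (f x))\<^sup>2 + (norm (g x))\<^sup>2)"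
    by (intro AE_I2) simp
qed

lemma square_integrable_mult:
  fixes f g :: "'a \<Rightarrow> real"
  shows "square_integrable M f \<Longrightarrow> square_integrable M g \<Longrightarrow> integrable M (\<lambda>x. f x * g x)"
  using square_integrable_inner[of M f g] by simp

lemma norm_sum_sq: "(norm (a + b))\<^sup>2 = (norm a)\<^sup>2 + 2 * (a \<bullet> b) + (norm b)\<^sup>2" for a b :: "'a::real_inner"
  unfolding power2_norm_eq_inner by (simp add: inner_add_left inner_add_right inner_commute)

lemma square_integrable_add:
  assumes "square_integrable M f" "square_integrable M g"
  shows "square_integrable M (\<lambda>x. f x + g x)"
  unfolding square_integrable_def
proof
  show "integrable M (\<lambda>x. (norm (f x + g x))\<^sup>2)"
    using square_integrable_inner[OF assms] assms
    by (simp add: square_integrable_def norm_sum_sq)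
qed (use assms[THEN square_integrable_measurable] in measurable)

lemma square_integrable_scaleR:
  assumes "square_integrable M g" "c \<in> borel_measurable M" "\<And>x. x \<in> space M \<Longrightarrow> \<bar>c x\<bar> \<le> C"
  shows "square_integrable M (\<lambda>x. c x *\<^sub>R g x)"
  by (rule square_integrable_bound[OF assms(1), of _ C])
    (use assms square_integrable_measurable[OF assms(1)] in \<open>auto intro!: AE_I2 mult_right_mono\<close>)

lemma square_integrable_diff:
  assumes "square_integrable M f" "square_integrable M g"
  shows "square_integrable M (\<lambda>x. f x - g x)"
  using square_integrable_add[OF assms(1) square_integrable_scaleR[OF assms(2), of "\<lambda>_. -1" 1]] by simp

section \<open>The L2 norm and L2 convergence\<close>

definition L2_norm :: "'a measure \<Rightarrow> ('a \<Rightarrow> 'b::euclidean_space) \<Rightarrow> real" where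
  "L2_norm M f = sqrt (LINT x|M. (norm (f x))\<^sup>2)"

lemma L2_norm_nonneg: "0 \<le> L2_norm M f"
  by (simp add: L2_norm_def)

lemma L2_norm_sq: "(L2_norm M f)\<^sup>2 = (LINT x|M. (norm (f x))\<^sup>2)"
  by (simp add: L2_norm_def)

lemma L2_Cauchy_Schwarz:
  assumes "square_integrable M f" "square_integrable M g"
  shows "\<bar>LINT x|M. f x \<bullet> g x\<bar> \<le> L2_norm M f * L2_norm M g"
proof -
  let ?A = "LINT x|M. (norm (f x))\<^sup>2" and ?B = "LINT x|M. (norm (g x))\<^sup>2" and ?I = "LINT x|M. f x \<bullet> g x"
  note int = square_integrable_integrable[OF assms(1)] square_integrable_integrable[OF assms(2)]
    square_integrable_inner[OF assms]
  have *: "0 \<le> t\<^sup>2 * ?A + 2 * t * ?I + ?B" for t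
  proof -
    have "0 \<le> (LINT x|M. (norm (t *\<^sub>R f x + g x))\<^sup>2)" by simp
    also have "\<dots> = (LINT x|M. t\<^sup>2 * (norm (f x))\<^sup>2 + 2 * t * (f x \<bullet> g x) + (norm (g x))\<^sup>2)"
      by (intro Bochner_Integration.integral_cong refl)
        (simp add: norm_sum_sq power_mult_distrib)
    also have "\<dots> = t\<^sup>2 * ?A + 2 * t * ?I + ?B" using int by simp
    finally show ?thesis .
  qed
  have "?I\<^sup>2 \<le> ?A * ?B"
  proof (cases "?A = 0")
    case True
    have "?I = 0"
    proof (rule ccontr)
      assume "?I \<noteq> 0"
      \<comment> \<open>For \<open>?A = 0\<close> the polynomial is affine in \<open>t\<close>, and
        here it takes the value -1.\<close>
      with *[of "- (?B + 1) / (2 * ?I)"] True show False by (simp add: field_simps)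
    qed
    then show ?thesis using True by simp
  next
    case False
    then have "?A > 0" by (simp add: less_le)
    \<comment> \<open>The minimiser of the quadratic polynomial.\<close>
    with *[of "- ?I / ?A"] show ?thesis by (simp add: field_simps power2_eq_square)
  qed
  then have "sqrt (?I\<^sup>2) \<le> sqrt (?A * ?B)" by (rule real_sqrt_le_mono)
  then show ?thesis by (simp add: L2_norm_def real_sqrt_mult)
qed

text \<open>Square integrability is part of the notion: a non-integrable function has integral 0 by
  convention, so the limit alone would say nothing.\<close>

definition L2_conv :: "'a measure \<Rightarrow> (nat \<Rightarrow> 'a \<Rightarrow> 'b::euclidean_space) \<Rightarrow> ('a \<Rightarrow> 'b) \<Rightarrow> bool" where
  "L2_conv M f g \<longleftrightarrow> (\<forall>n. square_integrable M (f n)) \<and> square_integrable M g \<and>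
     (\<lambda>n. L2_norm M (\<lambda>x. f n x - g x)) \<longlonglongrightarrow> 0"

lemma L2_convD:
  assumes "L2_conv M f g"
  shows "square_integrable M (f n)" "square_integrable M g" "(\<lambda>n. L2_norm M (\<lambda>x. f n x - g x)) \<longlonglongrightarrow> 0"
  using assms by (auto simp: L2_conv_def)

lemma L2_conv_iff_integral:
  "L2_conv M f g \<longleftrightarrow> (\<forall>n. square_integrable M (f n)) \<and> square_integrable M g \<and>
     (\<lambda>n. LINT x|M. (norm (f n x - g x))\<^sup>2) \<longlonglongrightarrow> 0"
proof -
  have "(\<lambda>n. L2_norm M (\<lambda>x. f n x - g x)) \<longlonglongrightarrow> 0 \<longleftrightarrow> (\<lambda>n. LINT x|M. (norm (f n x - g x))\<^sup>2) \<longlonglongrightarrow> 0"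
  proof
    assume "(\<lambda>n. L2_norm M (\<lambda>x. f n x - g x)) \<longlonglongrightarrow> 0"
    from tendsto_power[OF this, of 2] show "(\<lambda>n. LINT x|M. (norm (f n x - g x))\<^sup>2) \<longlonglongrightarrow> 0"
      by (simp add: L2_norm_sq)
  next
    assume "(\<lambda>n. LINT x|M. (norm (f n x - g x))\<^sup>2) \<longlonglongrightarrow> 0"
    from tendsto_real_sqrt[OF this] show "(\<lambda>n. L2_norm M (\<lambda>x. f n x - g x)) \<longlonglongrightarrow> 0"
      by (simp add: L2_norm_def)
  qed
  then show ?thesis by (simp add: L2_conv_def)
qed

text \<open>The entry point from \<open>has_trace\<close>, which is formulated with extended
  nonnegative integrals.\<close>

lemma L2_convI_nn:
  assumes "\<And>n. square_integrable M (f n)" "square_integrable M g"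
    and "(\<lambda>n. \<integral>\<^sup>+x. ennreal ((norm (f n x - g x))\<^sup>2) \<partial>M) \<longlonglongrightarrow> 0"
  shows "L2_conv M f g"
proof -
  have "(\<integral>\<^sup>+x. ennreal ((norm (f n x - g x))\<^sup>2) \<partial>M) = ennreal (LINT x|M. (norm (f n x - g x))\<^sup>2)" for n
    using square_integrable_integrable[OF square_integrable_diff[OF assms(1,2)]]
    by (intro nn_integral_eq_integral) auto
  with assms show ?thesis
    by (auto simp: L2_conv_iff_integral ennreal_0[symmetric] simp del: ennreal_0)
qed

text \<open>Pointwise Lipschitz operations preserve L2 convergence. This covers truncations,
  multiplication by bounded functions and the component in a fixed direction.\<close>

lemma L2_conv_bound:
  assumes "L2_conv M f g" "\<And>n. F n \<in> borel_measurable M" "square_integrable M H"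
    and "\<And>n. AE x in M. norm (F n x - H x) \<le> c * norm (f n x - g x)"
  shows "L2_conv M F H"
proof -
  have D: "square_integrable M (\<lambda>x. f n x - g x)" for n
    using assms(1) L2_convD square_integrable_diff by blast
  have D': "square_integrable M (\<lambda>x. F n x - H x)" for n
    by (rule square_integrable_bound[OF D _ assms(4)])
      (use assms(2) square_integrable_measurable[OF assms(3)] in measurable)
  have F: "square_integrable M (F n)" for n
    using square_integrable_add[OF D' assms(3)] by simp
  have "(\<lambda>n. LINT x|M. (norm (F n x - H x))\<^sup>2) \<longlonglongrightarrow> 0"
  proof (rule tendsto_sandwich[OF always_eventually always_eventually tendsto_const])
    show "\<forall>n. (LINT x|M. (norm (F n x - H x))\<^sup>2) \<le> c\<^sup>2 * (LINT x|M. (norm (f n x - g x))\<^sup>2)"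
    proof
      fix n
      have "(LINT x|M. (norm (F n x - H x))\<^sup>2) \<le> (LINT x|M. c\<^sup>2 * (norm (f n x - g x))\<^sup>2)"
      proof (intro integral_mono_AE)
        show "AE x in M. (norm (F n x - H x))\<^sup>2 \<le> c\<^sup>2 * (norm (f n x - g x))\<^sup>2"
          using assms(4)[of n] by eventually_elim (simp add: power_mult_distrib[symmetric] power_mono)
      qed (use square_integrable_integrable[OF D] square_integrable_integrable[OF D'] in simp_all)
      then show "(LINT x|M. (norm (F n x - H x))\<^sup>2) \<le> c\<^sup>2 * (LINT x|M. (norm (f n x - g x))\<^sup>2)" by simp
    qed
    show "(\<lambda>n. c\<^sup>2 * (LINT x|M. (norm (f n x - g x))\<^sup>2)) \<longlonglongrightarrow> 0"
      using assms(1) by (auto simp: L2_conv_iff_integral intro!: tendsto_mult_right_zero)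
  qed simp
  then show ?thesis using F assms(3) by (simp add: L2_conv_iff_integral)
qed

lemma L2_conv_const: "square_integrable M g \<Longrightarrow> L2_conv M (\<lambda>n. g) g"
  by (simp add: L2_conv_iff_integral)

lemma L2_conv_add:
  assumes "L2_conv M f g" "L2_conv M f' g'"
  shows "L2_conv M (\<lambda>n x. f n x + f' n x) (\<lambda>x. g x + g' x)"
proof -
  have D: "square_integrable M (\<lambda>x. f n x - g x)" "square_integrable M (\<lambda>x. f' n x - g' x)" for n
    using assms L2_convD square_integrable_diff by blast+
  have S: "square_integrable M (\<lambda>x. (f n x - g x) + (f' n x - g' x))" for n
    by (intro square_integrable_add D)
  have "(\<lambda>n. LINT x|M. (norm (f n x + f' n x - (g x + g' x)))\<^sup>2) \<longlonglongrightarrow> 0"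
  proof (rule tendsto_sandwich[OF always_eventually always_eventually tendsto_const])
    show "\<forall>n. (LINT x|M. (norm (f n x + f' n x - (g x + g' x)))\<^sup>2) \<le>
        2 * (LINT x|M. (norm (f n x - g x))\<^sup>2) + 2 * (LINT x|M. (norm (f' n x - g' x))\<^sup>2)"
    proof
      fix n
      have *: "(norm (a + b))\<^sup>2 \<le> 2 * (norm a)\<^sup>2 + 2 * (norm b)\<^sup>2" for a b :: 'b
        using power_mono[OF norm_triangle_ineq[of a b], of 2] sum_squares_bound[of "norm a" "norm b"]
        by (simp add: power2_sum)
      have "(LINT x|M. (norm ((f n x - g x) + (f' n x - g' x)))\<^sup>2)
        \<le> (LINT x|M. 2 * (norm (f n x - g x))\<^sup>2 + 2 * (norm (f' n x - g' x))\<^sup>2)"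
        using S D by (intro integral_mono *) (auto simp: square_integrable_def)
      then show "(LINT x|M. (norm (f n x + f' n x - (g x + g' x)))\<^sup>2) \<le>
        2 * (LINT x|M. (norm (f n x - g x))\<^sup>2) + 2 * (LINT x|M. (norm (f' n x - g' x))\<^sup>2)"
        using D[THEN square_integrable_integrable] by (simp add: algebra_simps)
    qed
    have "(\<lambda>n. 2 * (LINT x|M. (norm (f n x - g x))\<^sup>2) + 2 * (LINT x|M. (norm (f' n x - g' x))\<^sup>2)) \<longlonglongrightarrow> 2 * 0 + 2 * 0"
      using assms by (intro tendsto_intros) (auto simp: L2_conv_iff_integral)
    then show "(\<lambda>n. 2 * (LINT x|M. (norm (f n x - g x))\<^sup>2) + 2 * (LINT x|M. (norm (f' n x - g' x))\<^sup>2)) \<longlonglongrightarrow> 0" by simp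
  qed simp
  then show ?thesis using assms by (simp add: L2_conv_iff_integral square_integrable_add)
qed

lemma L2_conv_scaleR:
  assumes "L2_conv M f g" "c \<in> borel_measurable M" "\<And>x. x \<in> space M \<Longrightarrow> \<bar>c x\<bar> \<le> C"
  shows "L2_conv M (\<lambda>n x. c x *\<^sub>R f n x) (\<lambda>x. c x *\<^sub>R g x)"
proof (rule L2_conv_bound[OF assms(1), where c = C])
  show "(\<lambda>x. c x *\<^sub>R f n x) \<in> borel_measurable M" for n
    using assms(2) square_integrable_measurable[OF L2_convD(1)[OF assms(1)]] by measurable
  show "square_integrable M (\<lambda>x. c x *\<^sub>R g x)"
    by (rule square_integrable_scaleR[OF L2_convD(2)[OF assms(1)] assms(2,3)])
  show "AE x in M. norm (c x *\<^sub>R f n x - c x *\<^sub>R g x) \<le> C * norm (f n x - g x)" for n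
    using assms(3) by (auto simp: scaleR_diff_right[symmetric] intro!: AE_I2 mult_right_mono)
qed

lemma L2_conv_diff:
  assumes "L2_conv M f g" "L2_conv M f' g'"
  shows "L2_conv M (\<lambda>n x. f n x - f' n x) (\<lambda>x. g x - g' x)"
  using L2_conv_add[OF assms(1) L2_conv_scaleR[OF assms(2), of "\<lambda>_. -1" 1]] by simp

lemma L2_conv_inner:
  assumes "L2_conv M f g" "L2_conv M f' g'"
  shows "(\<lambda>n. LINT x|M. f n x \<bullet> f' n x) \<longlonglongrightarrow> (LINT x|M. g x \<bullet> g' x)"
proof -
  note s = L2_convD(1,2)[OF assms(1)] L2_convD(1,2)[OF assms(2)]
  note d = square_integrable_diff[OF s(1) s(2)] square_integrable_diff[OF s(3) s(4)]
  \<comment> \<open>Expansion about the limits: each of the last three integrals contains a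
    difference that tends to 0 in L2, so Cauchy-Schwarz disposes of it.\<close>
  have eq: "(LINT x|M. f n x \<bullet> f' n x) = (LINT x|M. g x \<bullet> g' x) + (LINT x|M. (f n x - g x) \<bullet> (f' n x - g' x))
      + (LINT x|M. (f n x - g x) \<bullet> g' x) + (LINT x|M. g x \<bullet> (f' n x - g' x))" for n
    using s d square_integrable_inner[OF s(1)[of n] s(3)[of n]] square_integrable_inner[OF s(1)[of n] s(4)]
       square_integrable_inner[OF s(2) s(3)[of n]] square_integrable_inner[OF s(2) s(4)]
    by (simp add: inner_diff_left inner_diff_right)
  have z: "(\<lambda>n. LINT x|M. a n x \<bullet> b n x) \<longlonglongrightarrow> 0"
    if "\<And>n. square_integrable M (a n)" "\<And>n. square_integrable M (b n)"
      "(\<lambda>n. L2_norm M (a n) * L2_norm M (b n)) \<longlonglongrightarrow> 0" for a b :: "nat \<Rightarrow> 'a \<Rightarrow> 'b"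
    by (rule Lim_null_comparison[OF always_eventually that(3)]) (use L2_Cauchy_Schwarz[OF that(1,2)] in simp)
  have "(\<lambda>n. (LINT x|M. g x \<bullet> g' x) + (LINT x|M. (f n x - g x) \<bullet> (f' n x - g' x))
      + (LINT x|M. (f n x - g x) \<bullet> g' x) + (LINT x|M. g x \<bullet> (f' n x - g' x))) \<longlonglongrightarrow> (LINT x|M. g x \<bullet> g' x) + 0 + 0 + 0"
    using L2_convD(3)[OF assms(1)] L2_convD(3)[OF assms(2)] s d
    by (intro tendsto_add tendsto_const z) (auto intro: tendsto_mult_zero tendsto_mult_left_zero tendsto_mult_right_zero)
  then show ?thesis by (simp add: eq)
qed

lemma L2_conv_mult:
  fixes f f' :: "nat \<Rightarrow> 'a \<Rightarrow> real"
  assumes "L2_conv M f g" "L2_conv M f' g'"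
  shows "(\<lambda>n. LINT x|M. f n x * f' n x) \<longlonglongrightarrow> (LINT x|M. g x * g' x)"
  using L2_conv_inner[OF assms] by simp

text \<open>For coefficients that converge only pointwise, such as the cutoffs, their weights and
  the derivatives of truncations; there no Lipschitz bound is available.\<close>

lemma L2_conv_dominated:
  assumes "square_integrable M G" "\<And>n. c n \<in> borel_measurable M" "c' \<in> borel_measurable M"
    and "\<And>n x. x \<in> space M \<Longrightarrow> \<bar>c n x\<bar> \<le> C" "\<And>x. x \<in> space M \<Longrightarrow> \<bar>c' x\<bar> \<le> C"
    and "AE x in M. (\<lambda>n. c n x) \<longlonglongrightarrow> c' x"
  shows "L2_conv M (\<lambda>n x. c n x *\<^sub>R G x) (\<lambda>x. c' x *\<^sub>R G x)"
proof -
  note G = square_integrable_measurable[OF assms(1)]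
  have "(\<lambda>n. LINT x|M. (norm (c n x *\<^sub>R G x - c' x *\<^sub>R G x))\<^sup>2) \<longlonglongrightarrow> (LINT x|M. 0)"
  proof (rule integral_dominated_convergence)
    show "integrable M (\<lambda>x. (2 * C)\<^sup>2 * (norm (G x))\<^sup>2)"
      using square_integrable_integrable[OF assms(1)] by simp
    show "AE x in M. (\<lambda>n. (norm (c n x *\<^sub>R G x - c' x *\<^sub>R G x))\<^sup>2) \<longlonglongrightarrow> 0"
      using assms(6)
    proof eventually_elim
      case (elim x)
      have "(\<lambda>n. (norm (c n x *\<^sub>R G x - c' x *\<^sub>R G x))\<^sup>2) \<longlonglongrightarrow> (norm (c' x *\<^sub>R G x - c' x *\<^sub>R G x))\<^sup>2"
        by (intro tendsto_intros elim)
      then show ?case by simp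
    qed
    show "AE x in M. norm ((norm (c n x *\<^sub>R G x - c' x *\<^sub>R G x))\<^sup>2) \<le> (2 * C)\<^sup>2 * (norm (G x))\<^sup>2" for n
    proof (rule AE_I2)
      fix x assume x: "x \<in> space M"
      have "norm (c n x *\<^sub>R G x - c' x *\<^sub>R G x) = \<bar>c n x - c' x\<bar> * norm (G x)"
        by (simp add: scaleR_diff_left[symmetric])
      also have "\<dots> \<le> 2 * C * norm (G x)"
        using assms(4)[OF x, of n] assms(5)[OF x] by (intro mult_right_mono) auto
      finally show "norm ((norm (c n x *\<^sub>R G x - c' x *\<^sub>R G x))\<^sup>2) \<le> (2 * C)\<^sup>2 * (norm (G x))\<^sup>2"
        using power_mono[of _ "2 * C * norm (G x)" 2] by (simp add: power_mult_distrib)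
    qed
  qed (use assms(2,3) G in measurable)
  then show ?thesis
    by (simp add: L2_conv_iff_integral square_integrable_scaleR[OF assms(1,2,4)] square_integrable_scaleR[OF assms(1,3,5)])
qed

lemma L2_conv_subseq:
  assumes "L2_conv M f g" "strict_mono r"
  shows "L2_conv M (\<lambda>n. f (r n)) g"
  using assms LIMSEQ_subseq_LIMSEQ[OF L2_convD(3)[OF assms(1)] assms(2)]
  by (simp add: L2_conv_def o_def)

lemma L2_conv_AE_subseq:
  fixes g :: "'a \<Rightarrow> real"
  assumes "L2_conv M f g"
  obtains r :: "nat \<Rightarrow> nat" where "strict_mono r" "AE x in M. (\<lambda>n. f (r n) x) \<longlonglongrightarrow> g x"
proof -
  have "\<exists>r::nat\<Rightarrow>nat. strict_mono r \<and> (AE x in M. (\<lambda>n. (norm (f (r n) x - g x))\<^sup>2) \<longlonglongrightarrow> 0)"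
  proof (rule tendsto_L1_AE_subseq)
    show "integrable M (\<lambda>x. (norm (f n x - g x))\<^sup>2)" for n
      using L2_convD[OF assms] by (intro square_integrable_integrable square_integrable_diff) 
    show "(\<lambda>n. LINT x|M. norm ((norm (f n x - g x))\<^sup>2)) \<longlonglongrightarrow> 0"
      using assms by (simp add: L2_conv_iff_integral)
  qed
  then obtain r where r: "strict_mono r" "AE x in M. (\<lambda>n. (norm (f (r n) x - g x))\<^sup>2) \<longlonglongrightarrow> 0" by blast
  from r(2) have "AE x in M. (\<lambda>n. f (r n) x) \<longlonglongrightarrow> g x"
  proof eventually_elim
    case (elim x)
    from tendsto_real_sqrt[OF this] have "(\<lambda>n. \<bar>f (r n) x - g x\<bar>) \<longlonglongrightarrow> 0" by simp
    then show ?case by (simp add: tendsto_rabs_zero_iff LIM_zero_iff)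
  qed
  with r(1) that show thesis by blast
qed

section \<open>Affine change of variables in the plane\<close>

text \<open>Lebesgue measure is determined by its values on boxes. The preimage of a box under
  \<open>g\<close> is its image under \<open>g'\<close>, whose measure is scaled by the determinant
  of \<open>g'\<close>, the reciprocal of that of \<open>g\<close>.\<close>

lemma lborel_linear_image:
  fixes g g' :: "real^'n::{finite,wellorder} \<Rightarrow> real^'n::_"
  assumes g: "linear g" and g': "linear g'" and inv: "\<And>x. g' (g x) = x" "\<And>x. g (g' x) = x"
  shows "lborel = density (distr lborel borel g) (\<lambda>_. ennreal \<bar>det (matrix g)\<bar>)"
proof (rule lborel_eqI)
  fix l r :: "(real, 'n) vec"
  assume le: "\<And>b. b \<in> Basis \<Longrightarrow> l \<bullet> b \<le> r \<bullet> b"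
  have [measurable]: "g \<in> borel_measurable borel"
    using g by (intro borel_measurable_continuous_onI linear_continuous_on) (simp add: linear_linear)
  have vim: "g -` box l r = g' ` box l r"
    using inv by (auto simp: image_iff) metis
  have "g' ` box l r \<in> lmeasurable"
    by (rule measurable_linear_image[OF g']) auto
  then have "emeasure lborel (g -` box l r) = ennreal (measure lebesgue (g' ` box l r))"
    using measurable_sets[of g borel borel "box l r"] vim emeasure_eq_measure2[of "g' ` box l r" lebesgue]
    by (simp add: emeasure_completion)
  also have "\<dots> = ennreal (\<bar>det (matrix g')\<bar> * (\<Prod>b\<in>Basis. (r - l) \<bullet> b))"
    using le by (simp add: measure_linear_image[OF g'] measure_lborel_box_eq)
  finally have *: "emeasure lborel (g -` box l r) = ennreal (\<bar>det (matrix g')\<bar> * (\<Prod>b\<in>Basis. (r - l) \<bullet> b))" .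
  have "matrix g ** matrix g' = matrix (g \<circ> g')"
    using matrix_compose[OF g' g] by simp
  also have "\<dots> = mat 1" using inv by (simp add: o_def matrix_id_mat_1[unfolded id_def])
  finally have "det (matrix g) * det (matrix g') = 1"
    by (metis det_I det_mul)
  then have "\<bar>det (matrix g)\<bar> * \<bar>det (matrix g')\<bar> = 1"
    by (metis abs_mult abs_one)
  then show "emeasure (density (distr lborel borel g) (\<lambda>_. ennreal \<bar>det (matrix g)\<bar>)) (box l r)
      = (\<Prod>b\<in>Basis. (r - l) \<bullet> b)"
    by (simp add: emeasure_density nn_integral_cmult emeasure_distr * ennreal_mult'[symmetric] mult.assoc[symmetric])
qed auto

lemma borel_measurable_vector2: "(\<lambda>z::real\<times>real. vector [fst z, snd z] :: real^2) \<in> borel_measurable borel"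
proof (rule borel_measurable_continuous_onI)
  have *: "(\<lambda>z::real\<times>real. vector [fst z, snd z] :: real^2) = (\<lambda>z. fst z *\<^sub>R axis 1 1 + snd z *\<^sub>R axis 2 1)"
    by (auto simp: vec_eq_iff forall_2 axis_def)
  show "continuous_on UNIV (\<lambda>z::real\<times>real. vector [fst z, snd z] :: real^2)"
    unfolding * by (intro continuous_intros)
qed

text \<open>Domains live in \<open>real^2\<close>, while Fubini's theorem speaks of pairs; this
  identifies the two measures.\<close>

lemma lborel_real2_prod:
  "distr lborel borel (\<lambda>z::real\<times>real. vector [fst z, snd z] :: real^2) = lborel"
proof (rule lborel_eqI[symmetric])
  let ?J = "\<lambda>z::real\<times>real. vector [fst z, snd z] :: real^2"
  fix l r :: "real^2"
  assume le: "\<And>b. b \<in> Basis \<Longrightarrow> l \<bullet> b \<le> r \<bullet> b"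
  have Bas: "(Basis :: (real^2) set) = {axis 1 1, axis 2 1}"
    by (auto simp: Basis_vec_def UNIV_2)
  have ne: "axis 1 (1::real) \<noteq> (axis 2 1 :: real^2)" by (simp add: axis_eq_axis)
  have [measurable]: "?J \<in> borel_measurable borel"
    by (rule borel_measurable_vector2)
  have "?J -` box l r = box (l$1, l$2) (r$1, r$2)"
    by (auto simp: mem_box_cart forall_2 mem_box Basis_prod_def)
  moreover have "l$1 \<le> r$1" "l$2 \<le> r$2" using le[of "axis _ 1"] by (auto simp: inner_axis)
  moreover have "emeasure lborel (box (l$1, l$2) (r$1, r$2)) = ennreal ((r$1 - l$1) * (r$2 - l$2))"
    if "l$1 \<le> r$1" "l$2 \<le> r$2"
    using that by (subst emeasure_lborel_box_eq)
      (auto simp: Basis_prod_def prod.insert_if mult.commute)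
  ultimately have "emeasure lborel (?J -` box l r) = ennreal ((r$1 - l$1) * (r$2 - l$2))"
    by simp
  then show "emeasure (distr lborel borel ?J) (box l r) = (\<Prod>b\<in>Basis. (r - l) \<bullet> b)"
    using ne by (simp add: emeasure_distr Bas inner_axis)
qed auto

lemma lborel_real2_affine:
  fixes a p q :: "real^2"
  assumes D: "p$1 * q$2 - p$2 * q$1 \<noteq> 0"
  shows "lborel = density (distr lborel borel (\<lambda>z::real\<times>real. a + fst z *\<^sub>R p + snd z *\<^sub>R q))
    (\<lambda>_. ennreal \<bar>p$1 * q$2 - p$2 * q$1\<bar>)"
proof -
  let ?D = "p$1 * q$2 - p$2 * q$1"
  let ?J = "\<lambda>z::real\<times>real. vector [fst z, snd z] :: real^2"
  define g where "g = (\<lambda>w::real^2. w$1 *\<^sub>R p + w$2 *\<^sub>R q)"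
  \<comment> \<open>Cramer's rule.\<close>
  define g' where "g' = (\<lambda>w::real^2. vector [(w$1 * q$2 - w$2 * q$1) / ?D, (p$1 * w$2 - p$2 * w$1) / ?D] :: real^2)"
  have lg: "linear g" unfolding g_def by (intro linearI) (auto simp: algebra_simps)
  have lg': "linear g'"
    unfolding g'_def by (intro linearI) (auto simp: vec_eq_iff forall_2 add_divide_distrib[symmetric] algebra_simps)
  have i1: "g' (g x) = x" for x
  proof -
    have "((x$1 * p$1 + x$2 * q$1) * q$2 - (x$1 * p$2 + x$2 * q$2) * q$1) = x$1 * ?D"
      "(p$1 * (x$1 * p$2 + x$2 * q$2) - p$2 * (x$1 * p$1 + x$2 * q$1)) = x$2 * ?D"
      by (simp_all add: algebra_simps)
    then show ?thesis using D by (simp add: g_def g'_def vec_eq_iff forall_2)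
  qed
  have i2: "g (g' x) = x" for x
  proof -
    have "(x$1 * q$2 - x$2 * q$1) * p$1 + (p$1 * x$2 - p$2 * x$1) * q$1 = x$1 * ?D"
      "(x$1 * q$2 - x$2 * q$1) * p$2 + (p$1 * x$2 - p$2 * x$1) * q$2 = x$2 * ?D"
      by (simp_all add: algebra_simps)
    then show ?thesis using D by (simp add: g_def g'_def vec_eq_iff forall_2 add_divide_distrib[symmetric])
  qed
  have det: "det (matrix g) = ?D"
    by (simp add: det_2 matrix_def g_def axis_def)
  have [measurable]: "g \<in> borel_measurable borel"
    using lg by (intro borel_measurable_continuous_onI linear_continuous_on) (simp add: linear_linear)
  have [measurable]: "?J \<in> borel_measurable borel"
    by (rule borel_measurable_vector2)
  have "lborel = distr lborel borel ((+) a)"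
    by (simp add: lborel_distr_plus)
  also have "\<dots> = distr (density (distr lborel borel g) (\<lambda>_. ennreal \<bar>?D\<bar>)) borel ((+) a)"
    using lborel_linear_image[OF lg lg' i1 i2] det by simp
  also have "distr lborel borel g = distr (distr lborel borel ?J) borel g"
    by (simp only: lborel_real2_prod)
  also have "\<dots> = distr lborel borel (\<lambda>z. g (?J z))"
    by (subst distr_distr) (auto simp: o_def)
  also have "distr (density (distr lborel borel (\<lambda>z. g (?J z))) (\<lambda>_. ennreal \<bar>?D\<bar>)) borel ((+) a)
    = density (distr (distr lborel borel (\<lambda>z. g (?J z))) borel ((+) a)) (\<lambda>_. ennreal \<bar>?D\<bar>)"
    by (rule density_distr[symmetric]) auto
  also have "distr (distr lborel borel (\<lambda>z. g (?J z))) borel ((+) a) = distr lborel borel (\<lambda>z. a + g (?J z))"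
    by (subst distr_distr) (auto simp: o_def)
  finally show ?thesis by (simp add: g_def add.assoc)
qed

lemma
  fixes a p q :: "real^2" and f :: "real^2 \<Rightarrow> real"
  assumes D: "p$1 * q$2 - p$2 * q$1 \<noteq> 0" and [measurable]: "f \<in> borel_measurable borel"
  shows integral_real2_affine: "(LINT x|lborel. f x) =
      \<bar>p$1 * q$2 - p$2 * q$1\<bar> * (LINT z|lborel. f (a + fst z *\<^sub>R p + snd z *\<^sub>R q))" (is ?th1)
    and integrable_real2_affine: "integrable lborel f \<longleftrightarrow>
      integrable lborel (\<lambda>z. f (a + fst z *\<^sub>R p + snd z *\<^sub>R q))" (is ?th2)
proof -
  let ?D = "p$1 * q$2 - p$2 * q$1" and ?g = "\<lambda>z::real\<times>real. a + fst z *\<^sub>R p + snd z *\<^sub>R q"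
  have [measurable]: "?g \<in> borel_measurable borel"
    by (intro borel_measurable_continuous_onI continuous_intros)
  note eq = lborel_real2_affine[OF D, of a]
  have "(LINT x|lborel. f x) = (LINT x|density (distr lborel borel ?g) (\<lambda>_. ennreal \<bar>?D\<bar>). f x)"
    using eq by simp
  also have "\<dots> = \<bar>?D\<bar> * (LINT x|distr lborel borel ?g. f x)"
    by (subst integral_density) auto
  also have "(LINT x|distr lborel borel ?g. f x) = (LINT z|lborel. f (?g z))"
    by (rule integral_distr) auto
  finally show ?th1 .
  have "integrable lborel f \<longleftrightarrow> integrable (density (distr lborel borel ?g) (\<lambda>_. ennreal \<bar>?D\<bar>)) f"
    using eq by simp
  also have "\<dots> \<longleftrightarrow> integrable (distr lborel borel ?g) f"
    using D by (subst integrable_density) auto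
  also have "\<dots> \<longleftrightarrow> integrable lborel (\<lambda>z. f (?g z))"
    by (rule integrable_distr_eq) auto
  finally show ?th2 .
qed

lemma integral_prod_lborel:
  fixes A B :: "real \<Rightarrow> real"
  assumes "integrable lborel A" "integrable lborel B"
  shows "(LINT z|lborel. A (fst z) * B (snd z)) = (LINT y|lborel. A y) * (LINT x|lborel. B x)"
    and "integrable lborel (\<lambda>z. A (fst z) * B (snd z))"
proof -
  have int: "integrable (lborel \<Otimes>\<^sub>M lborel) (\<lambda>z. A (fst z) * B (snd z))"
  proof (rule lborel_pair.Fubini_integrable)
    show "(\<lambda>z. A (fst z) * B (snd z)) \<in> borel_measurable (lborel \<Otimes>\<^sub>M lborel)"
      using assms[THEN borel_measurable_integrable] by measurable
    show "integrable lborel (\<lambda>x. LINT y|lborel. norm (A (fst (x, y)) * B (snd (x, y))))"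
      using assms by (simp add: abs_mult)
    show "AE x in lborel. integrable lborel (\<lambda>y. A (fst (x, y)) * B (snd (x, y)))"
      using assms by simp
  qed
  then show "integrable lborel (\<lambda>z. A (fst z) * B (snd z))" by (simp add: lborel_prod)
  show "(LINT z|lborel. A (fst z) * B (snd z)) = (LINT y|lborel. A y) * (LINT x|lborel. B x)"
    using lborel_pair.integral_fst'[OF int] by (simp add: lborel_prod)
qed

section \<open>Geometry of a trapezoid\<close>

text \<open>
  The vertex \<open>a\<close> is the origin of the coordinates: \<open>u\<close> is the direction of the bases, \<open>n\<close> is normal
  to them, and the leg at \<open>a\<close> is \<open>h n + s u\<close>.  The shear \<open>s\<close> is arbitrary, so all
  constants must be uniform in it.  A point is \<open>pt y x\<close>, with \<open>y = ga\<close> running from \<open>0\<close> to \<open>1\<close> along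
  the leg and \<open>x = al\<close> running from \<open>0\<close> to the width \<open>wd y\<close> along the bases.
\<close>

locale trapezoid =
  fixes a u n :: "real^2" and h s e1 e2 :: real
  assumes norm_u: "norm u = 1" and norm_n: "norm n = 1" and u_n: "u \<bullet> n = 0"
    and h_pos: "h > 0" and e1_pos: "e1 > 0" and e2_pos: "e2 > 0"
begin

definition leg :: "real^2" where "leg = h *\<^sub>R n + s *\<^sub>R u"
definition pt :: "real \<Rightarrow> real \<Rightarrow> real^2" where "pt y x = a + y *\<^sub>R leg + x *\<^sub>R u"
text \<open>\<open>m_al\<close> and \<open>m_ga\<close> form the basis dual to \<open>u\<close> and
  \<open>leg\<close>; they are the gradients of the coordinates \<open>al\<close> and
  \<open>ga\<close>.\<close>

definition m_al :: "real^2" where "m_al = u - (s / h) *\<^sub>R n"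
definition m_ga :: "real^2" where "m_ga = (1 / h) *\<^sub>R n"
definition al :: "real^2 \<Rightarrow> real" where "al p = - (m_al \<bullet> a) + m_al \<bullet> p"
definition ga :: "real^2 \<Rightarrow> real" where "ga p = - (m_ga \<bullet> a) + m_ga \<bullet> p"
definition wd :: "real \<Rightarrow> real" where "wd y = (1 - y) * e1 + y * e2"
definition em :: real where "em = max e1 e2"
definition vb :: "real^2" where "vb = pt 0 e1"
definition vc :: "real^2" where "vc = pt 1 e2"
definition vd :: "real^2" where "vd = pt 1 0"
definition verts :: "(real^2) list" where "verts = [a, vb, vc, vd]"
text \<open>Closed and open trapezoid in coordinates. \<open>K_eq_hull\<close> and
  \<open>polygon_eq\<close> identify them with the convex hull of the vertices and the given
  polygon.\<close>

definition K :: "(real^2) set" where "K = {p. 0 \<le> ga p \<and> ga p \<le> 1 \<and> 0 \<le> al p \<and> al p \<le> wd (ga p)}"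
definition E :: "(real^2) set" where "E = {p. 0 < ga p \<and> ga p < 1 \<and> 0 < al p \<and> al p < wd (ga p)}"
abbreviation ME :: "(real^2) measure" where "ME \<equiv> lebesgue_on E"

lemma inner_frame: "u \<bullet> u = 1" "n \<bullet> n = 1" "u \<bullet> n = 0" "n \<bullet> u = 0"
  using norm_u norm_n u_n by (auto simp: norm_eq_1 inner_commute)

lemma em_pos: "em > 0" using e1_pos by (auto simp: em_def)
lemma wd_pos: "0 \<le> y \<Longrightarrow> y \<le> 1 \<Longrightarrow> wd y > 0"
  using e1_pos e2_pos by (cases "y = 0") (auto simp: wd_def intro: add_nonneg_pos)
lemma wd_le_em: "0 \<le> y \<Longrightarrow> y \<le> 1 \<Longrightarrow> wd y \<le> em"
  unfolding wd_def em_def by (rule convex_bound_le) auto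

lemma al_pt [simp]: "al (pt y x) = x" and ga_pt [simp]: "ga (pt y x) = y"
  using h_pos by (auto simp: al_def ga_def pt_def m_al_def m_ga_def leg_def inner_frame algebra_simps inner_add_left inner_add_right inner_diff_left)

text \<open>Lagrange's identity: the square of the determinant is the Gram determinant of an
  orthonormal pair.\<close>

lemma frame_det: "\<bar>n$1 * u$2 - n$2 * u$1\<bar> = 1"
proof -
  have "u$1 * u$1 + u$2 * u$2 = 1" "n$1 * n$1 + n$2 * n$2 = 1" "u$1 * n$1 + u$2 * n$2 = 0"
    using inner_frame by (simp_all add: inner_vec_def sum_2)
  then have "(n$1 * u$2 - n$2 * u$1)^2 = 1" by algebra
  then show ?thesis by (auto simp: power2_eq_1_iff)
qed

text \<open>The difference of the two sides is orthogonal to both \<open>n\<close> and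
  \<open>u\<close>, whose determinant is not 0.\<close>

lemma frame_expansion: "x = (x \<bullet> n) *\<^sub>R n + (x \<bullet> u) *\<^sub>R u"
proof -
  let ?w = "x - (x \<bullet> n) *\<^sub>R n - (x \<bullet> u) *\<^sub>R u"
  have "?w \<bullet> n = 0" "?w \<bullet> u = 0" by (auto simp: inner_diff_left inner_frame)
  then have 1: "?w$1 * n$1 + ?w$2 * n$2 = 0" "?w$1 * u$1 + ?w$2 * u$2 = 0"
    by (simp_all only: inner_vec_def sum_2 inner_real_def)
  have ne: "n$1 * u$2 - n$2 * u$1 \<noteq> 0" using frame_det by auto
  from 1 have "?w$1 * (n$1 * u$2 - n$2 * u$1) = 0" "?w$2 * (n$1 * u$2 - n$2 * u$1) = 0" by algebra+
  with ne have "?w = 0" by (simp only: vec_eq_iff forall_2 mult_eq_0_iff zero_index) blast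
  then show ?thesis by (simp add: algebra_simps)
qed

lemma pt_coords: "pt (ga p) (al p) = p"
proof -
  have "p - a = ((p - a) \<bullet> n) *\<^sub>R n + ((p - a) \<bullet> u) *\<^sub>R u" by (rule frame_expansion)
  moreover have "pt (ga p) (al p) - a = ((p - a) \<bullet> n) *\<^sub>R n + ((p - a) \<bullet> u) *\<^sub>R u"
    using h_pos by (simp add: pt_def leg_def ga_def al_def m_al_def m_ga_def inner_diff_left inner_diff_right
        inner_commute algebra_simps diff_divide_distrib)
  ultimately show ?thesis by simp
qed

lemma continuous_al: "continuous_on S al" and continuous_ga: "continuous_on S ga"
  unfolding al_def[abs_def] ga_def[abs_def] by (auto intro!: continuous_intros)

lemma continuous_wd: "continuous_on S wd"
  unfolding wd_def[abs_def] by (auto intro!: continuous_intros)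

lemma wd_ga: "wd (ga p) - al p = (e1 + (e2 - e1) * - (m_ga \<bullet> a) + m_al \<bullet> a) + ((e2 - e1) *\<^sub>R m_ga - m_al) \<bullet> p"
  by (simp add: wd_def al_def ga_def algebra_simps inner_diff_left inner_add_left)

text \<open>Convexity and the interior of \<open>K\<close> are read off from this form, the interior
  by making each inequality strict.\<close>

lemma K_halfspaces: "K = {p. m_ga \<bullet> p \<ge> m_ga \<bullet> a} \<inter> {p. m_ga \<bullet> p \<le> 1 + m_ga \<bullet> a} \<inter> {p. m_al \<bullet> p \<ge> m_al \<bullet> a} \<inter>
     {p. (m_al - (e2 - e1) *\<^sub>R m_ga) \<bullet> p \<le> e1 + (e2 - e1) * - (m_ga \<bullet> a) + m_al \<bullet> a}"
proof -
  have "al p \<le> wd (ga p) \<longleftrightarrow> (m_al - (e2 - e1) *\<^sub>R m_ga) \<bullet> p \<le> e1 + (e2 - e1) * - (m_ga \<bullet> a) + m_al \<bullet> a" for p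
    using wd_ga[of p] by (auto simp: inner_diff_left)
  then show ?thesis by (auto simp: K_def ga_def al_def)
qed

lemma m_nonzero: "m_ga \<noteq> 0" "m_al \<noteq> 0" "m_al - (e2 - e1) *\<^sub>R m_ga \<noteq> 0"
proof -
  have "m_ga \<bullet> n = 1 / h" "m_al \<bullet> u = 1" "(m_al - (e2 - e1) *\<^sub>R m_ga) \<bullet> u = 1"
    by (auto simp: m_ga_def m_al_def inner_diff_left inner_frame)
  then show "m_ga \<noteq> 0" "m_al \<noteq> 0" "m_al - (e2 - e1) *\<^sub>R m_ga \<noteq> 0" using h_pos by auto
qed

lemma interior_K: "interior K = E"
proof -
  have "interior K = {p. m_ga \<bullet> p > m_ga \<bullet> a} \<inter> {p. m_ga \<bullet> p < 1 + m_ga \<bullet> a} \<inter> {p. m_al \<bullet> p > m_al \<bullet> a} \<inter>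
     {p. (m_al - (e2 - e1) *\<^sub>R m_ga) \<bullet> p < e1 + (e2 - e1) * - (m_ga \<bullet> a) + m_al \<bullet> a}"
    unfolding K_halfspaces by (simp only: interior_Int interior_halfspace_le[OF m_nonzero(1)] interior_halfspace_le[OF m_nonzero(3)]
        interior_halfspace_ge[OF m_nonzero(1)] interior_halfspace_ge[OF m_nonzero(2)])
  also have "\<dots> = E"
  proof -
    have "al p < wd (ga p) \<longleftrightarrow> (m_al - (e2 - e1) *\<^sub>R m_ga) \<bullet> p < e1 + (e2 - e1) * - (m_ga \<bullet> a) + m_al \<bullet> a" for p
      using wd_ga[of p] by (auto simp: inner_diff_left)
    then show ?thesis by (auto simp: E_def ga_def al_def)
  qed
  finally show ?thesis .
qed

lemma pt_mem_K: "0 \<le> y \<Longrightarrow> y \<le> 1 \<Longrightarrow> 0 \<le> t \<Longrightarrow> t \<le> 1 \<Longrightarrow> pt y (t * wd y) \<in> K"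
  using wd_pos[of y] by (auto simp: K_def mult_left_le_one_le)

lemma convex_K: "convex K"
  unfolding K_halfspaces by (intro convex_Int convex_halfspace_le convex_halfspace_ge)

lemma K_eq_hull: "convex hull (set verts) = K"
proof
  have "set verts \<subseteq> K"
    using e1_pos e2_pos by (auto simp: verts_def vb_def vc_def vd_def K_def wd_def)
      (use al_pt[of 0 0] ga_pt[of 0 0] e1_pos in \<open>auto simp: pt_def\<close>)
  then show "convex hull (set verts) \<subseteq> K" using convex_K by (rule hull_minimal)
  show "K \<subseteq> convex hull (set verts)"
  proof
    fix p assume p: "p \<in> K"
    \<comment> \<open>\<open>t\<close> is the relative position on the section at height
      \<open>y\<close>. The points at the same relative position \<open>t\<close> on the two bases
      are then mixed with weights \<open>1 - y\<close> and \<open>y\<close>.\<close>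
    define y t where "y = ga p" and "t = al p / wd (ga p)"
    have y: "0 \<le> y" "y \<le> 1" and w: "wd y > 0" using p wd_pos by (auto simp: K_def y_def)
    have t: "0 \<le> t" "t \<le> 1" "al p = t * wd y" using p w by (auto simp: K_def y_def t_def field_simps)
    have ab: "(1 - t) *\<^sub>R a + t *\<^sub>R vb \<in> convex hull (set verts)" "(1 - t) *\<^sub>R vd + t *\<^sub>R vc \<in> convex hull (set verts)"
      using t by (intro convexD[OF convex_convex_hull]; simp add: hull_inc verts_def)+
    have "(1 - y) *\<^sub>R ((1 - t) *\<^sub>R a + t *\<^sub>R vb) + y *\<^sub>R ((1 - t) *\<^sub>R vd + t *\<^sub>R vc) \<in> convex hull (set verts)"
      by (rule convexD[OF convex_convex_hull ab]) (use y in auto)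
    also have "(1 - y) *\<^sub>R ((1 - t) *\<^sub>R a + t *\<^sub>R vb) + y *\<^sub>R ((1 - t) *\<^sub>R vd + t *\<^sub>R vc) = pt y (t * wd y)"
      by (simp add: vb_def vc_def vd_def pt_def wd_def algebra_simps)
    also have "\<dots> = p" using pt_coords[of p] t by (simp add: y_def)
    finally show "p \<in> convex hull (set verts)" .
  qed
qed

lemma polygon_eq: "polygon verts = E"
  by (simp add: polygon_def K_eq_hull interior_K)

lemma compact_K: "compact K"
  using K_eq_hull by (metis compact_convex_hull finite_imp_compact finite_set)

lemma open_E: "open E" using interior_K open_interior by metis
lemma E_subset_K: "E \<subseteq> K" by (auto simp: E_def K_def)
lemma E_meas [measurable, simp]: "E \<in> sets borel" using open_E by auto
lemma E_lebesgue [simp]: "E \<in> sets lebesgue" using open_E by auto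
lemma space_ME [simp]: "space ME = E" by (simp add: space_restrict_space)

lemma emeasure_E_finite: "emeasure lebesgue E < \<infinity>"
proof -
  have K: "K \<in> lmeasurable" using compact_K by (rule lmeasurable_compact)
  then have "emeasure lebesgue E \<le> emeasure lebesgue K"
    by (intro emeasure_mono E_subset_K) (auto simp: fmeasurableD)
  also have "\<dots> < \<infinity>" using K by (auto simp: fmeasurable_def)
  finally show ?thesis .
qed

lemma finite_ME: "finite_measure ME"
  using emeasure_E_finite by (intro finite_measureI) (auto simp: emeasure_restrict_space)

lemma K_measurable: "continuous_on K f \<Longrightarrow> (f :: real^2 \<Rightarrow> 'b::euclidean_space) \<in> borel_measurable ME"
  by (rule continuous_imp_measurable_on_sets_lebesgue) (auto intro: continuous_on_subset[OF _ E_subset_K])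

lemma K_bounded:
  assumes "continuous_on K (f :: real^2 \<Rightarrow> 'b::euclidean_space)"
  obtains C where "\<And>x. x \<in> K \<Longrightarrow> norm (f x) \<le> C" "C \<ge> 0"
proof -
  have "bounded (f ` K)" using compact_continuous_image[OF assms compact_K] by (rule compact_imp_bounded)
  then obtain C where "\<And>x. x \<in> K \<Longrightarrow> norm (f x) \<le> C" by (auto simp: bounded_iff)
  then show thesis using that[of "max C 0"] by fastforce
qed

lemma bounded_square_integrable:
  assumes "(f :: real^2 \<Rightarrow> 'b::euclidean_space) \<in> borel_measurable ME" "\<And>x. x \<in> E \<Longrightarrow> norm (f x) \<le> C"
  shows "square_integrable ME f"
  unfolding square_integrable_def
proof
  interpret finite_measure ME by (rule finite_ME)
  show "integrable ME (\<lambda>x. (norm (f x))\<^sup>2)"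
    by (rule integrable_const_bound[where B = "C\<^sup>2"]) (use assms in \<open>auto intro!: AE_I2 power_mono\<close>)
qed fact

lemma continuous_square_integrable:
  assumes "continuous_on K (f :: real^2 \<Rightarrow> 'b::euclidean_space)"
  shows "square_integrable ME f"
proof -
  obtain C where "\<And>x. x \<in> K \<Longrightarrow> norm (f x) \<le> C" using K_bounded[OF assms] by blast
  then show ?thesis using bounded_square_integrable[OF K_measurable[OF assms]] E_subset_K by blast
qed

lemma square_integrable_integrable_ME:
  "square_integrable ME f \<Longrightarrow> integrable ME (f :: real^2 \<Rightarrow> real)"
  using square_integrable_mult[OF _ continuous_square_integrable[of "\<lambda>_. 1"]] by simp

lemma continuous_integrable:
  "continuous_on K (f :: real^2 \<Rightarrow> real) \<Longrightarrow> integrable ME f"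
  by (intro square_integrable_integrable_ME continuous_square_integrable)

end

section \<open>Divergence theorem and boundary measure\<close>

lemma has_vector_derivative_along:
  fixes \<gamma> :: "real \<Rightarrow> real^2"
  assumes "(f has_derivative (\<lambda>h. V \<bullet> h)) (at (\<gamma> t))" "(\<gamma> has_vector_derivative g') (at t within S)"
  shows "((\<lambda>t. f (\<gamma> t)) has_vector_derivative V \<bullet> g') (at t within S)"
  using has_derivative_compose[OF assms(2)[unfolded has_vector_derivative_def] assms(1)]
  by (simp add: has_vector_derivative_def)

lemma integral_lborel_Ioo:
  fixes g :: "real \<Rightarrow> real"
  assumes "continuous_on {0..1} g"
  shows "(LINT t|lborel. indicator {0<..<1} t * g t) = integral {0..1} g"
proof -
  have "set_integrable lborel {0<..<1} g"
    by (rule set_integrable_subset[OF borel_integrable_atLeastAtMost'[OF assms]]) auto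
  from set_borel_integral_eq_integral(2)[OF this]
  show ?thesis by (simp add: set_lebesgue_integral_def integral_open_interval_real[symmetric])
qed

text \<open>The mean over the edge, not the arc length integral. The lengths of the legs, which grow
  with the shear, therefore do not appear in the divergence theorem.\<close>

definition edge_integral :: "real^2 \<Rightarrow> real^2 \<Rightarrow> (real^2 \<Rightarrow> real) \<Rightarrow> real" where
  "edge_integral p q f = integral {0..1} (\<lambda>t. f (linepath p q t))"

lemma edge_integral_reverse:
  fixes f :: "real^2 \<Rightarrow> real"
  assumes "continuous_on {0..1} (\<lambda>t. f (linepath p q t))"
  shows "edge_integral q p f = edge_integral p q f"
proof -
  let ?g = "\<lambda>t. f (linepath p q t)"
  have "(?g has_integral integral {0..1} ?g) (cbox 0 1)"
    using integrable_continuous_real[OF assms] by (simp add: has_integral_integral[symmetric])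
  from has_integral_affinity[OF this, of "-1" 1]
  have "((\<lambda>t. ?g (1 - t)) has_integral integral {0..1} ?g) ((\<lambda>x. 1 - x) ` {0..1})"
    by (simp add: algebra_simps)
  moreover have "(\<lambda>x. 1 - x) ` {0..1} = {0..1::real}"
    by (auto simp: image_iff intro!: bexI[of _ "1 - _"])
  moreover have "?g (1 - t) = f (linepath q p t)" for t
    by (simp add: linepath_def algebra_simps)
  ultimately show ?thesis by (simp add: edge_integral_def integral_unique)
qed

context trapezoid
begin

lemma E_pt: "pt y x \<in> E \<longleftrightarrow> y \<in> {0<..<1} \<and> x \<in> {0<..<wd y}"
  by (auto simp: E_def)

lemma continuous_pt: "continuous_on S (\<lambda>z. pt (fst z) (snd z * wd (fst z)))"
  unfolding pt_def wd_def by (intro continuous_intros)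

lemma continuous_on_square:
  assumes "continuous_on K (f :: real^2 \<Rightarrow> 'b::real_normed_vector)"
  shows "continuous_on ({0..1} \<times> {0..1}) (\<lambda>z. f (pt (fst z) (snd z * wd (fst z))))"
  by (rule continuous_on_compose2[OF assms continuous_pt]) (auto intro: pt_mem_K)

lemma leg_det: "\<bar>leg$1 * u$2 - leg$2 * u$1\<bar> = h"
proof -
  have "leg$1 * u$2 - leg$2 * u$1 = h * (n$1 * u$2 - n$2 * u$1)"
    by (simp add: leg_def algebra_simps)
  then show ?thesis using frame_det h_pos by (simp add: abs_mult)
qed

text \<open>Leaves the completed measure for \<open>lborel\<close>, where the change of variables
  and Fubini's theorem are at hand.\<close>

lemma integral_ME_lborel:
  assumes "continuous_on E (f :: real^2 \<Rightarrow> real)"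
  shows "(LINT x|ME. f x) = (LINT x|lborel. indicator E x * f x)"
    and "integrable ME f \<longleftrightarrow> integrable lborel (\<lambda>x. indicator E x * f x)"
proof -
  have [measurable]: "(\<lambda>x. indicator E x * f x) \<in> borel_measurable borel"
    using borel_measurable_continuous_on_indicator[OF E_meas assms] by simp
  show "(LINT x|ME. f x) = (LINT x|lborel. indicator E x * f x)"
    by (simp add: integral_restrict_space integral_completion)
  show "integrable ME f \<longleftrightarrow> integrable lborel (\<lambda>x. indicator E x * f x)"
    by (simp add: integrable_restrict_space integrable_completion)
qed

text \<open>The map \<open>pt\<close> has Jacobian \<open>h\<close>, whatever the shear, and the
  substitution \<open>x = t * wd y\<close> stretches every section to the unit interval.\<close>

lemma integral_E:
  fixes f :: "real^2 \<Rightarrow> real"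
  assumes f: "continuous_on K f"
  shows "(LINT x|ME. f x) = h * integral {0..1} (\<lambda>y. integral {0..1} (\<lambda>t. wd y * f (pt y (t * wd y))))"
proof -
  have fE: "continuous_on E f" using f E_subset_K continuous_on_subset by blast
  let ?F = "\<lambda>x. indicator E x * f x"
  let ?g = "\<lambda>y t. f (pt y (t * wd y))"
  have m: "?F \<in> borel_measurable borel"
    using borel_measurable_continuous_on_indicator[OF E_meas fE] by simp
  have nz: "leg$1 * u$2 - leg$2 * u$1 \<noteq> 0" using leg_det h_pos by auto
  have int: "integrable (lborel \<Otimes>\<^sub>M lborel) (\<lambda>z. ?F (pt (fst z) (snd z)))"
    using continuous_integrable[OF f] integral_ME_lborel(2)[OF fE] integrable_real2_affine[OF nz m, of a]
    by (simp add: pt_def lborel_prod)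
  have contg: "continuous_on ({0..1} \<times> {0..1}) (\<lambda>z. wd (fst z) * ?g (fst z) (snd z))"
    unfolding wd_def by (intro continuous_intros continuous_on_square[unfolded wd_def] f)
  have "(LINT x|ME. f x) = h * (LINT z|(lborel \<Otimes>\<^sub>M lborel). ?F (pt (fst z) (snd z)))"
    using integral_ME_lborel(1)[OF fE] integral_real2_affine[OF nz m, of a] leg_det
    by (simp add: pt_def lborel_prod)
  also have "(LINT z|(lborel \<Otimes>\<^sub>M lborel). ?F (pt (fst z) (snd z))) = (LINT y|lborel. LINT x|lborel. ?F (pt y x))"
    using lborel_pair.integral_fst'[OF int] by simp
  also have "(\<lambda>y. LINT x|lborel. ?F (pt y x)) = (\<lambda>y. indicator {0<..<1} y * integral {0..1} (\<lambda>t. wd y * ?g y t))"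
  proof
    fix y
    show "(LINT x|lborel. ?F (pt y x)) = indicator {0<..<1} y * integral {0..1} (\<lambda>t. wd y * ?g y t)"
    proof (cases "y \<in> {0<..<1}")
      case True
      then have w: "wd y > 0" using wd_pos by auto
      have "(LINT x|lborel. ?F (pt y x)) = wd y * (LINT t|lborel. ?F (pt y (0 + wd y * t)))"
        using lborel_integral_real_affine[of "wd y" "\<lambda>x. ?F (pt y x)" 0] w by simp
      also have "(LINT t|lborel. ?F (pt y (0 + wd y * t))) = (LINT t|lborel. indicator {0<..<1} t * ?g y t)"
        using True w by (intro Bochner_Integration.integral_cong refl)
          (auto simp: indicator_def E_pt mult.commute zero_less_mult_iff)
      also have "\<dots> = integral {0..1} (?g y)"
      proof (rule integral_lborel_Ioo)
        show "continuous_on {0..1} (?g y)"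
          by (rule continuous_on_compose2[OF continuous_on_square[OF f], of _ "\<lambda>t. (y, t)", simplified])
            (use True in \<open>auto intro!: continuous_intros\<close>)
      qed
      finally show ?thesis using True by simp
    next
      case False
      then have "(\<lambda>x. ?F (pt y x)) = (\<lambda>x. 0)" by (auto simp: E_pt)
      then show ?thesis using False by simp
    qed
  qed
  also have "(LINT y|lborel. indicator {0<..<1} y * integral {0..1} (\<lambda>t. wd y * ?g y t))
     = integral {0..1} (\<lambda>y. integral {0..1} (\<lambda>t. wd y * ?g y t))"
  proof (rule integral_lborel_Ioo)
    show "continuous_on {0..1} (\<lambda>y. integral {0..1} (\<lambda>t. wd y * ?g y t))"
      using integral_continuous_on_param[of "{0..1}" 0 1 "\<lambda>y t. wd y * ?g y t"] contg
      by (simp add: case_prod_unfold)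
  qed
  finally show ?thesis .
qed

lemma edge_points:
  "linepath a vb t = pt 0 (t * wd 0)" "linepath vd vc t = pt 1 (t * wd 1)"
  "linepath vb vc t = pt t (1 * wd t)" "linepath a vd t = pt t (0 * wd t)"
  by (simp_all add: linepath_def vb_def vc_def vd_def pt_def wd_def algebra_simps)

lemma edge_in_K:
  assumes "t \<in> {0..1}"
  shows "linepath a vb t \<in> K" "linepath vb vc t \<in> K" "linepath vc vd t \<in> K" "linepath vd a t \<in> K"
proof -
  have "linepath vc vd t = linepath vd vc (1 - t)" "linepath vd a t = linepath a vd (1 - t)"
    by (simp_all add: linepath_def)
  then show "linepath a vb t \<in> K" "linepath vb vc t \<in> K" "linepath vc vd t \<in> K" "linepath vd a t \<in> K"
    using assms edge_points pt_mem_K[of 0 t] pt_mem_K[of 1 "1 - t"] pt_mem_K[of t 1] pt_mem_K[of "1 - t" 0] by auto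
qed

text \<open>The fundamental theorem of calculus on the unit square, for the two directions suited to
  the coordinates. Lines of constant \<open>t\<close> fan out unless the bases are equal, so the
  derivative along them has an additional component \<open>t * (e2 - e1)\<close> along
  \<open>u\<close>, which an integration in \<open>t\<close> removes.\<close>

lemma divergence_theorem:
  fixes f :: "real^2 \<Rightarrow> real" and D :: "real^2 \<Rightarrow> real^2"
  assumes der: "\<And>x. x \<in> K \<Longrightarrow> (f has_derivative (\<lambda>h. D x \<bullet> h)) (at x)" and D: "continuous_on K D"
  shows "(LINT x|ME. D x \<bullet> u) = h * (edge_integral vb vc f - edge_integral vd a f)" (is ?th1)
    and "(LINT x|ME. D x \<bullet> leg) =
      h * (e2 * edge_integral vc vd f - e1 * edge_integral a vb f - (e2 - e1) * edge_integral vb vc f)" (is ?th2)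
proof -
  have f: "continuous_on K f"
    using der by (meson continuous_at_imp_continuous_on has_derivative_continuous)
  define G where "G = (\<lambda>y t. f (pt y (t * wd y)))"
  define H where "H = (\<lambda>y t. D (pt y (t * wd y)))"
  have cG: "continuous_on ({0..1} \<times> {0..1}) (\<lambda>z. G (fst z) (snd z))"
    unfolding G_def by (rule continuous_on_square[OF f])
  have cH: "continuous_on ({0..1} \<times> {0..1}) (\<lambda>z. H (fst z) (snd z))"
    unfolding H_def by (rule continuous_on_square[OF D])
  have c1: "continuous_on {0..1} (\<lambda>t. g y t)"
    if "continuous_on ({0..1} \<times> {0..1}) (\<lambda>z. g (fst z) (snd z))" "y \<in> {0..1}" for g :: "real \<Rightarrow> real \<Rightarrow> 'b::real_normed_vector" and y
    by (rule continuous_on_compose2[OF that(1), of _ "\<lambda>t. (y, t)", simplified])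
      (use that in \<open>auto intro!: continuous_intros\<close>)
  have c2: "continuous_on {0..1} (\<lambda>y. g y t)"
    if "continuous_on ({0..1} \<times> {0..1}) (\<lambda>z. g (fst z) (snd z))" "t \<in> {0..1}" for g :: "real \<Rightarrow> real \<Rightarrow> 'b::real_normed_vector" and t
    by (rule continuous_on_compose2[OF that(1), of _ "\<lambda>y. (y, t)", simplified])
      (use that in \<open>auto intro!: continuous_intros\<close>)
  have c3: "continuous_on {0..1} (\<lambda>y. integral {0..1} (g y))"
    if "continuous_on ({0..1} \<times> {0..1}) (\<lambda>z. g (fst z) (snd z))" for g :: "real \<Rightarrow> real \<Rightarrow> real"
    using integral_continuous_on_param[of "{0..1}" 0 1 g] that by (simp add: case_prod_unfold)
  have dt: "(G y has_vector_derivative wd y * (H y t \<bullet> u)) (at t within {0..1})"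
    if "y \<in> {0..1}" "t \<in> {0..1}" for y t
  proof -
    have "((\<lambda>t. pt y (t * wd y)) has_vector_derivative wd y *\<^sub>R u) (at t within {0..1})"
      unfolding pt_def by (auto intro!: derivative_eq_intros)
    from has_vector_derivative_along[OF der this] show ?thesis
      using pt_mem_K that by (simp add: G_def H_def)
  qed
  have dy: "((\<lambda>y. G y t) has_vector_derivative H y t \<bullet> (leg + (t * (e2 - e1)) *\<^sub>R u)) (at y within {0..1})"
    if "y \<in> {0..1}" "t \<in> {0..1}" for y t
  proof -
    have "((\<lambda>y. pt y (t * wd y)) has_vector_derivative leg + (t * (e2 - e1)) *\<^sub>R u) (at y within {0..1})"
      unfolding pt_def wd_def by (auto intro!: derivative_eq_intros)
    from has_vector_derivative_along[OF der this] show ?thesis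
      using pt_mem_K that by (simp add: G_def H_def)
  qed
  have R: "edge_integral vb vc f = integral {0..1} (\<lambda>y. G y 1)"
    and B: "edge_integral a vb f = integral {0..1} (\<lambda>t. G 0 t)"
    by (simp_all add: edge_integral_def edge_points G_def)
  have L: "edge_integral vd a f = integral {0..1} (\<lambda>y. G y 0)"
    using edge_integral_reverse[of f a vd] c2[OF cG, of 0]
    by (simp add: edge_integral_def edge_points G_def)
  have T: "edge_integral vc vd f = integral {0..1} (\<lambda>t. G 1 t)"
    using edge_integral_reverse[of f vd vc] c1[OF cG, of 1]
    by (simp add: edge_integral_def edge_points G_def)
  have iG: "\<And>t. t \<in> {0..1} \<Longrightarrow> (\<lambda>y. G y t) integrable_on {0..1}"
    "\<And>y. y \<in> {0..1} \<Longrightarrow> (\<lambda>t. G y t) integrable_on {0..1}"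
    using c2[OF cG] c1[OF cG] by (auto intro: integrable_continuous_real)

  have "(LINT x|ME. D x \<bullet> u) = h * integral {0..1} (\<lambda>y. integral {0..1} (\<lambda>t. wd y * (H y t \<bullet> u)))"
    unfolding H_def by (rule integral_E) (intro continuous_intros D)
  also have "integral {0..1} (\<lambda>y. integral {0..1} (\<lambda>t. wd y * (H y t \<bullet> u))) = integral {0..1} (\<lambda>y. G y 1 - G y 0)"
  proof (rule integral_cong)
    fix y :: real assume y: "y \<in> {0..1}"
    show "integral {0..1} (\<lambda>t. wd y * (H y t \<bullet> u)) = G y 1 - G y 0"
      by (rule integral_unique, rule fundamental_theorem_of_calculus) (use dt[OF y] in auto)
  qed
  also have "\<dots> = integral {0..1} (\<lambda>y. G y 1) - integral {0..1} (\<lambda>y. G y 0)"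
    by (intro integral_diff iG) auto
  finally show ?th1 by (simp add: R L)

  \<comment> \<open>\<open>?P y t\<close> is the derivative of \<open>wd y * G y t\<close> in
    \<open>y\<close>, and \<open>?Q y t\<close> is \<open>e2 - e1\<close> times the derivative of
    \<open>t * G y t\<close> in \<open>t\<close>. Their difference is the wanted integrand.\<close>
  let ?P = "\<lambda>y t. (e2 - e1) * G y t + wd y * (H y t \<bullet> (leg + (t * (e2 - e1)) *\<^sub>R u))"
  let ?Q = "\<lambda>y t. (e2 - e1) * (G y t + t * (wd y * (H y t \<bullet> u)))"
  have cP: "continuous_on ({0..1} \<times> {0..1}) (\<lambda>z. ?P (fst z) (snd z))"
    unfolding wd_def by (intro continuous_intros cG cH)
  have cQ: "continuous_on ({0..1} \<times> {0..1}) (\<lambda>z. ?Q (fst z) (snd z))"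
    unfolding wd_def by (intro continuous_intros cG cH)
  have "(LINT x|ME. D x \<bullet> leg) = h * integral {0..1} (\<lambda>y. integral {0..1} (\<lambda>t. wd y * (H y t \<bullet> leg)))"
    unfolding H_def by (rule integral_E) (intro continuous_intros D)
  also have "integral {0..1} (\<lambda>y. integral {0..1} (\<lambda>t. wd y * (H y t \<bullet> leg)))
     = integral {0..1} (\<lambda>y. integral {0..1} (?P y) - integral {0..1} (?Q y))"
  proof (rule integral_cong)
    fix y :: real assume y: "y \<in> {0..1}"
    have "integral {0..1} (?P y) - integral {0..1} (?Q y) = integral {0..1} (\<lambda>t. ?P y t - ?Q y t)"
      using c1[OF cP y] c1[OF cQ y] by (intro integral_diff[symmetric] integrable_continuous_real)
    also have "\<dots> = integral {0..1} (\<lambda>t. wd y * (H y t \<bullet> leg))"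
      by (rule integral_cong) (simp add: inner_add_right algebra_simps)
    finally show "integral {0..1} (\<lambda>t. wd y * (H y t \<bullet> leg)) = integral {0..1} (?P y) - integral {0..1} (?Q y)" by simp
  qed
  also have "\<dots> = integral {0..1} (\<lambda>y. integral {0..1} (?P y)) - integral {0..1} (\<lambda>y. integral {0..1} (?Q y))"
    using c3[OF cP] c3[OF cQ] by (intro integral_diff integrable_continuous_real)
  also have "integral {0..1} (\<lambda>y. integral {0..1} (?P y)) = integral {0..1} (\<lambda>t. integral {0..1} (\<lambda>y. ?P y t))"
    using integral_swap_continuous[of 0 0 1 1 ?P] cP by (simp add: case_prod_unfold cbox_Pair_eq)
  also have "\<dots> = integral {0..1} (\<lambda>t. e2 * G 1 t - e1 * G 0 t)"
  proof (rule integral_cong)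
    fix t :: real assume t: "t \<in> {0..1}"
    have "((\<lambda>y. ?P y t) has_integral (wd 1 * G 1 t - wd 0 * G 0 t)) {0..1}"
    proof (rule fundamental_theorem_of_calculus)
      fix y :: real assume y: "y \<in> {0..1}"
      have "(wd has_vector_derivative (e2 - e1)) (at y within {0..1})"
        unfolding wd_def[abs_def] by (auto intro!: derivative_eq_intros)
      from has_vector_derivative_mult[OF this dy[OF y t]]
      show "((\<lambda>y. wd y * G y t) has_vector_derivative ?P y t) (at y within {0..1})"
        by (simp add: algebra_simps)
    qed simp
    then show "integral {0..1} (\<lambda>y. ?P y t) = e2 * G 1 t - e1 * G 0 t"
      by (simp add: integral_unique wd_def)
  qed
  also have "\<dots> = e2 * integral {0..1} (\<lambda>t. G 1 t) - e1 * integral {0..1} (\<lambda>t. G 0 t)"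
    by (subst integral_diff) (auto intro!: integrable_on_mult_right iG)
  also have "integral {0..1} (\<lambda>y. integral {0..1} (?Q y)) = integral {0..1} (\<lambda>y. (e2 - e1) * G y 1)"
  proof (rule integral_cong)
    fix y :: real assume y: "y \<in> {0..1}"
    have "((\<lambda>t. G y t + t * (wd y * (H y t \<bullet> u))) has_integral (1 * G y 1 - 0 * G y 0)) {0..1}"
    proof (rule fundamental_theorem_of_calculus)
      fix t :: real assume t: "t \<in> {0..1}"
      have "((\<lambda>t. t) has_vector_derivative (1::real)) (at t within {0..1})"
        by (auto intro!: derivative_eq_intros)
      from has_vector_derivative_mult[OF this dt[OF y t]]
      show "((\<lambda>t. t * G y t) has_vector_derivative G y t + t * (wd y * (H y t \<bullet> u))) (at t within {0..1})"
        by (simp add: add.commute)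
    qed simp
    then show "integral {0..1} (?Q y) = (e2 - e1) * G y 1"
      by (simp add: integral_unique)
  qed
  finally show ?th2 unfolding R B T by simp
qed

section \<open>Edges and the boundary measure\<close>

definition perimeter_edges :: "((real^2) \<times> (real^2)) set" where
  "perimeter_edges = {(a, vb), (vb, vc), (vc, vd), (vd, a)}"

lemma edges_verts: "edges verts = [(a, vb), (vb, vc), (vc, vd), (vd, a)]"
  by (simp add: edges_def verts_def)

lemma edge_dist_pos: "(p, q) \<in> perimeter_edges \<Longrightarrow> dist p q > 0"
proof -
  have "vb \<noteq> a" "vb \<noteq> vc" "vc \<noteq> vd" "vd \<noteq> a"
  proof -
    have "a = pt 0 0" by (simp add: pt_def)
    then show "vb \<noteq> a" "vb \<noteq> vc" "vc \<noteq> vd" "vd \<noteq> a"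
      unfolding vb_def vc_def vd_def using al_pt ga_pt e1_pos e2_pos by (metis less_irrefl zero_neq_one)+
  qed
  then show "(p, q) \<in> perimeter_edges \<Longrightarrow> dist p q > 0" by (auto simp: perimeter_edges_def)
qed

lemma edge_mem_K: "(p, q) \<in> perimeter_edges \<Longrightarrow> t \<in> {0..1} \<Longrightarrow> linepath p q t \<in> K"
  using edge_in_K by (auto simp: perimeter_edges_def)

abbreviation MI :: "real measure" where "MI \<equiv> restrict_space lborel {0..1}"
abbreviation MB :: "(real^2) measure" where "MB \<equiv> boundary_measure verts"


lemma linepath_measurable [measurable]: "linepath p q \<in> borel_measurable (restrict_space lborel {0..1::real})"
  for p q :: "real^2"
proof -
  have "linepath p q \<in> borel_measurable borel"
    by (intro borel_measurable_continuous_onI continuous_intros)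
  then show ?thesis by (intro measurable_restrict_space1) simp
qed

lemma emeasure_MI_edge:
  fixes A :: "(real^2) set"
  assumes "A \<in> sets borel"
  shows "emeasure MI (linepath p q -` A \<inter> space MI) = emeasure lborel {t \<in> {0..1}. linepath p q t \<in> A}"
proof -
  have "linepath p q -` A \<inter> space MI = {t \<in> {0..1}. linepath p q t \<in> A}"
    by (auto simp: space_restrict_space)
  moreover have "linepath p q -` A \<inter> space MI \<in> sets MI"
    by (rule measurable_sets[OF linepath_measurable assms])
  ultimately show ?thesis by (subst emeasure_restrict_space) (auto simp: space_restrict_space)
qed

text \<open>The boundary measure is the sum of four edge measures and so dominates each of them;
  this carries convergence on the boundary over to every edge.\<close>

lemma nn_integral_edge_le:
  assumes e: "(p, q) \<in> perimeter_edges" and f: "f \<in> borel_measurable borel"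
  shows "ennreal (dist p q) * (\<integral>\<^sup>+t. f (linepath p q t) \<partial>MI) \<le> (\<integral>\<^sup>+x. f x \<partial>MB)"
proof -
  let ?N = "distr (density MI (\<lambda>_. ennreal (dist p q))) borel (linepath p q)"
  have m: "linepath p q \<in> borel_measurable (density MI (\<lambda>_. ennreal (dist p q)))"
    by simp
  have "?N \<le> MB"
  proof (subst le_measure)
    show "\<forall>A\<in>sets ?N. emeasure ?N A \<le> emeasure MB A"
    proof
      fix A assume "A \<in> sets ?N"
      then have A: "A \<in> sets borel" by simp
      have "linepath p q -` A \<inter> space MI \<in> sets MI"
        by (rule measurable_sets[OF linepath_measurable A])
      then have "emeasure ?N A = ennreal (dist p q) * emeasure lborel {t \<in> {0..1}. linepath p q t \<in> A}"
        using A m emeasure_MI_edge[OF A, of p q] by (simp add: emeasure_distr emeasure_density_const)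
      also have "\<dots> \<le> emeasure MB A"
        using e A by (auto simp: emeasure_boundary_measure edges_verts perimeter_edges_def
            intro: add_increasing add_increasing2)
      finally show "emeasure ?N A \<le> emeasure MB A" .
    qed
  qed simp
  then have "(\<integral>\<^sup>+x. f x \<partial>?N) \<le> (\<integral>\<^sup>+x. f x \<partial>MB)"
    by (intro nn_integral_mono_measure) simp_all
  moreover have "(\<integral>\<^sup>+x. f x \<partial>?N) = ennreal (dist p q) * (\<integral>\<^sup>+t. f (linepath p q t) \<partial>MI)"
    using f m by (simp add: nn_integral_distr nn_integral_density nn_integral_cmult)
  ultimately show ?thesis by simp
qed

text \<open>All edges have positive length, so a boundary null set is one that is null on every
  edge. Boundary conditions can then be handled on the parameter interval.\<close>

lemma AE_MB_iff:
  assumes "{x. \<not> P x} \<in> sets borel"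
  shows "(AE x in MB. P x) \<longleftrightarrow> (\<forall>(p, q) \<in> perimeter_edges. AE t in MI. P (linepath p q t))"
proof -
  have "(AE x in MB. P x) \<longleftrightarrow> emeasure MB {x. \<not> P x} = 0"
    using assms by (subst AE_iff_measurable[of "{x. \<not> P x}"]) auto
  also have "\<dots> \<longleftrightarrow> (\<forall>(p, q) \<in> perimeter_edges. emeasure lborel {t \<in> {0..1}. linepath p q t \<in> {x. \<not> P x}} = 0)"
  proof -
    have "ennreal (dist p q) * x = 0 \<longleftrightarrow> x = 0" if "(p, q) \<in> perimeter_edges" for p q x
      using edge_dist_pos[OF that] by (simp add: ennreal_zero_less_mult_iff)
    then show ?thesis
      unfolding emeasure_boundary_measure[OF assms] edges_verts by (simp add: perimeter_edges_def)
  qed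
  also have "\<dots> \<longleftrightarrow> (\<forall>(p, q) \<in> perimeter_edges. AE t in MI. P (linepath p q t))"
  proof -
    have "(AE t in MI. P (linepath p q t)) \<longleftrightarrow> emeasure lborel {t \<in> {0..1}. linepath p q t \<in> {x. \<not> P x}} = 0" for p q
      unfolding emeasure_MI_edge[OF assms, symmetric]
      using measurable_sets[OF linepath_measurable assms, of p q]
      by (intro AE_iff_measurable) (auto simp: space_restrict_space)
    then show ?thesis by simp
  qed
  finally show ?thesis .
qed

lemma finite_MB: "finite_measure MB" and MB_pos: "emeasure MB (space MB) > 0"
proof -
  have "emeasure lborel {t \<in> {0..1::real}. linepath p q t \<in> UNIV} = 1" for p q :: "real^2"
  proof -
    have "{t \<in> {0..1::real}. linepath p q t \<in> UNIV} = {0..1}" by auto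
    then show ?thesis by simp
  qed
  then have *: "emeasure MB UNIV = ennreal (dist a vb) + (ennreal (dist vb vc) + (ennreal (dist vc vd) + ennreal (dist vd a)))"
    by (subst emeasure_boundary_measure) (auto simp: edges_verts)
  show "finite_measure MB" by (rule finite_measureI) (simp add: *)
  show "emeasure MB (space MB) > 0"
    using edge_dist_pos[of a vb] by (simp add: * perimeter_edges_def zero_less_iff_neq_zero)
qed

lemma finite_MI: "finite_measure MI"
  by (rule finite_measureI) (simp add: space_restrict_space emeasure_restrict_space)

lemma edge_integral_eq_MI:
  assumes "continuous_on K (f :: real^2 \<Rightarrow> real)" "(p, q) \<in> perimeter_edges"
  shows "edge_integral p q f = (LINT t|MI. f (linepath p q t))"
proof -
  have "continuous_on {0..1} (\<lambda>t. f (linepath p q t))"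
    by (rule continuous_on_compose2[OF assms(1)]) (use edge_mem_K[OF assms(2)] in \<open>auto intro!: continuous_intros\<close>)
  from set_borel_integral_eq_integral(2)[OF borel_integrable_atLeastAtMost'[OF this]]
  show ?thesis by (simp add: edge_integral_def set_lebesgue_integral_def integral_restrict_space)
qed

end

section \<open>Poincare and Hardy inequalities\<close>

lemma L2_conv_inner_const:
  fixes w :: "'b::euclidean_space"
  assumes "L2_conv M f g"
  shows "L2_conv M (\<lambda>n x. f n x \<bullet> w) (\<lambda>x. g x \<bullet> w)"
proof (rule L2_conv_bound[OF assms, where c = "norm w"])
  note s = L2_convD(1,2)[OF assms]
  show "(\<lambda>x. f n x \<bullet> w) \<in> borel_measurable M" for n
    using square_integrable_measurable[OF s(1)] by measurable
  show "square_integrable M (\<lambda>x. g x \<bullet> w)"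
    by (rule square_integrable_bound[OF s(2), where c = "norm w"])
      (use square_integrable_measurable[OF s(2)] in \<open>auto intro!: AE_I2 simp: mult.commute[of "norm w"] intro: Cauchy_Schwarz_ineq2\<close>)
  show "AE x in M. norm (f n x \<bullet> w - g x \<bullet> w) \<le> norm w * norm (f n x - g x)" for n
    by (auto intro!: AE_I2 simp: inner_diff_left[symmetric] mult.commute[of "norm w"] intro: Cauchy_Schwarz_ineq2)
qed

lemma square_integrable_integrable_real:
  fixes f :: "'a \<Rightarrow> real"
  shows "square_integrable M f \<Longrightarrow> integrable M (\<lambda>x. (f x)\<^sup>2)"
  by (simp only: square_integrable_def real_norm_def power2_abs)

text \<open>Here \<open>r\<close> stands for \<open>side / \<delta>\<close>,
  \<open>flat_exp 2\<close> is the derivative of \<open>flat_exp 0\<close>, and \<open>r + 1\<close>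
  compensates the denominator \<open>side + \<delta>\<close> in Hardy's inequality. With q = 1/(r -
  1) the product is (q + 2 q^2) exp(-q), which is bounded and also tends to 0 with q.\<close>

lemma flat_exp_cutoff_bound:
  assumes "r \<ge> 0"
  shows "0 \<le> flat_exp 2 (r - 1) * (r + 1)" "flat_exp 2 (r - 1) * (r + 1) \<le> 5"
    and "r > 1 \<Longrightarrow> flat_exp 2 (r - 1) * (r + 1) \<le> 1 / (r - 1) + 2 * (1 / (r - 1))\<^sup>2"
proof -
  show "0 \<le> flat_exp 2 (r - 1) * (r + 1)" using assms by (simp add: flat_exp_nonneg)
  have eq: "flat_exp 2 (r - 1) * (r + 1) = (1 / (r - 1) + 2 * (1 / (r - 1))\<^sup>2) * exp (- (1 / (r - 1)))" if "r > 1"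
  proof -
    define t where "t = r - 1"
    have t: "t > 0" "r + 1 = t + 2" "r - 1 = t" using that by (auto simp: t_def)
    then have *: "(1 / t)\<^sup>2 * (t + 2) = 1 / t + 2 * (1 / t)\<^sup>2" by (simp add: field_simps power2_eq_square)
    have "flat_exp 2 t * (t + 2) = ((1 / t)\<^sup>2 * (t + 2)) * exp (- (1 / t))"
      using t(1) by (simp add: flat_exp_def)
    then show ?thesis unfolding t(2,3) * .
  qed
  show "flat_exp 2 (r - 1) * (r + 1) \<le> 1 / (r - 1) + 2 * (1 / (r - 1))\<^sup>2" if "r > 1"
    unfolding eq[OF that] using that by (intro mult_left_le) auto
  show "flat_exp 2 (r - 1) * (r + 1) \<le> 5"
  proof (cases "r > 1")
    case True
    define q where "q = 1 / (r - 1)"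
    have q: "q \<ge> 0" using True by (simp add: q_def)
    have "q + 2 * q\<^sup>2 \<le> 5 * exp q"
      using exp_lower_Taylor_quadratic[OF q] q zero_le_power2[of q] by linarith
    then have "(q + 2 * q\<^sup>2) * exp (- q) \<le> 5" by (simp add: exp_minus field_simps)
    then show ?thesis using eq[OF True] by (simp add: q_def)
  qed (simp add: flat_exp_def)
qed

text \<open>All factors lie between 0 and 1, so each term of the product rule is at most the
  gradient of one factor.\<close>

lemma
  fixes f :: "nat \<Rightarrow> real^2 \<Rightarrow> real"
  assumes sm: "\<And>i. smooth (f i)" and b: "\<And>i x. 0 \<le> f i x" "\<And>i x. f i x \<le> 1"
  shows smooth_prod: "smooth (\<lambda>x. \<Prod>i<k. f i x)"
    and norm_grad_prod: "norm (grad (\<lambda>x. \<Prod>i<k. f i x) x) \<le> (\<Sum>i<k. norm (grad (f i) x))"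
proof -
  show *: "smooth (\<lambda>x. \<Prod>i<k. f i x)" for k
    by (induction k) (auto intro!: smooth_const smooth_mult sm)
  show "norm (grad (\<lambda>x. \<Prod>i<k. f i x) x) \<le> (\<Sum>i<k. norm (grad (f i) x))"
  proof (induction k)
    case 0
    have "grad (\<lambda>x. 1) x = 0" using grad_affine[of 1 0 x] by simp
    then show ?case by simp
  next
    case (Suc k)
    have P: "0 \<le> (\<Prod>i<k. f i x)" "(\<Prod>i<k. f i x) \<le> 1"
      using b by (auto intro: prod_nonneg prod_le_1)
    have "grad (\<lambda>x. \<Prod>i<Suc k. f i x) x = (\<Prod>i<k. f i x) *\<^sub>R grad (f k) x + f k x *\<^sub>R grad (\<lambda>x. \<Prod>i<k. f i x) x"
      using grad_mult[OF * sm] by simp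
    also have "norm \<dots> \<le> (\<Prod>i<k. f i x) * norm (grad (f k) x) + f k x * norm (grad (\<lambda>x. \<Prod>i<k. f i x) x)"
      by (rule norm_triangle_le) (use P b in simp)
    also have "\<dots> \<le> norm (grad (f k) x) + norm (grad (\<lambda>x. \<Prod>i<k. f i x) x)"
      using P b by (intro add_mono mult_left_le_one_le) auto
    finally show ?case using Suc by simp
  qed
qed

context trapezoid
begin

text \<open>A concrete form of \<open>z \<in> H\<^sup>1\<^sub>0(E)\<close> with gradient \<open>Z\<close>.\<close>

definition zero_trace :: "(real^2 \<Rightarrow> real) \<Rightarrow> (real^2 \<Rightarrow> real^2) \<Rightarrow> bool" where
  "zero_trace z Z \<longleftrightarrow> (\<exists>\<zeta>. (\<forall>n. smooth (\<zeta> n)) \<and> L2_conv ME \<zeta> z \<and> L2_conv ME (\<lambda>n. grad (\<zeta> n)) Z \<and>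
     (\<forall>(p, q) \<in> perimeter_edges. (\<lambda>n. edge_integral p q (\<lambda>x. (\<zeta> n x)\<^sup>2)) \<longlonglongrightarrow> 0))"

lemma zero_traceD: "zero_trace z Z \<Longrightarrow> square_integrable ME z" "zero_trace z Z \<Longrightarrow> square_integrable ME Z"
  by (auto simp: zero_trace_def L2_conv_def)

lemma direction_expansion: "w = (w \<bullet> u - s * (w \<bullet> n) / h) *\<^sub>R u + ((w \<bullet> n) / h) *\<^sub>R leg"
proof -
  have "w = (w \<bullet> n) *\<^sub>R n + (w \<bullet> u) *\<^sub>R u" by (rule frame_expansion)
  also have "\<dots> = (w \<bullet> u - s * (w \<bullet> n) / h) *\<^sub>R u + ((w \<bullet> n) / h) *\<^sub>R leg"
    using h_pos by (simp add: leg_def algebra_simps)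
  finally show ?thesis .
qed

lemma edge_integral_weight_bound:
  assumes g: "continuous_on K g" and C: "\<And>x. x \<in> K \<Longrightarrow> \<bar>g x\<bar> \<le> C" and f: "continuous_on K f"
    and e: "(p, q) \<in> perimeter_edges"
  shows "\<bar>edge_integral p q (\<lambda>x. g x * (f x)\<^sup>2)\<bar> \<le> C * edge_integral p q (\<lambda>x. (f x)\<^sup>2)"
proof -
  have c: "continuous_on {0..1} (\<lambda>t. F (linepath p q t))" if "continuous_on K F" for F :: "real^2 \<Rightarrow> real"
    by (rule continuous_on_compose2[OF that]) (use edge_mem_K[OF e] in \<open>auto intro!: continuous_intros\<close>)
  have "norm (edge_integral p q (\<lambda>x. g x * (f x)\<^sup>2)) \<le> integral {0..1} (\<lambda>t. C * (f (linepath p q t))\<^sup>2)"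
    unfolding edge_integral_def
  proof (rule integral_norm_bound_integral)
    show "(\<lambda>t. g (linepath p q t) * (f (linepath p q t))\<^sup>2) integrable_on {0..1}"
      by (intro integrable_continuous_real continuous_intros c f g)
    show "(\<lambda>t. C * (f (linepath p q t))\<^sup>2) integrable_on {0..1}"
      by (intro integrable_continuous_real continuous_intros c f)
    show "norm (g (linepath p q t) * (f (linepath p q t))\<^sup>2) \<le> C * (f (linepath p q t))\<^sup>2" if "t \<in> {0..1}" for t
      using C[OF edge_mem_K[OF e that]] by (simp add: abs_mult mult_right_mono)
  qed
  then show ?thesis by (simp add: edge_integral_def)
qed

text \<open>The common source of the Poincare and Hardy inequalities: the divergence theorem for
  \<open>g \<zeta>\<^sup>2\<close>, whose boundary terms disappear in the limit because
  \<open>g\<close> is bounded on \<open>K\<close>.\<close>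

lemma zero_trace_ibp:
  assumes zt: "zero_trace z Z"
    and g: "\<And>x. x \<in> K \<Longrightarrow> (g has_derivative (\<lambda>h. Dg x \<bullet> h)) (at x)" "continuous_on K Dg"
  shows "(LINT x|ME. (Dg x \<bullet> w) * (z x)\<^sup>2) = - 2 * (LINT x|ME. g x * z x * (Z x \<bullet> w))"
proof -
  obtain \<zeta> where sm: "\<And>n. smooth (\<zeta> n)" and cz: "L2_conv ME \<zeta> z" and cZ: "L2_conv ME (\<lambda>n. grad (\<zeta> n)) Z"
    and ed: "\<And>p q. (p, q) \<in> perimeter_edges \<Longrightarrow> (\<lambda>n. edge_integral p q (\<lambda>x. (\<zeta> n x)\<^sup>2)) \<longlonglongrightarrow> 0"
    using zt unfolding zero_trace_def by fast
  have gc: "continuous_on K g"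
    using g(1) by (meson continuous_at_imp_continuous_on has_derivative_continuous)
  obtain C where C: "\<And>x. x \<in> K \<Longrightarrow> norm (g x) \<le> C" "C \<ge> 0" using K_bounded[OF gc] by blast
  obtain C' where C': "\<And>x. x \<in> K \<Longrightarrow> norm (Dg x \<bullet> w) \<le> C'"
    using K_bounded[OF continuous_on_inner[OF g(2) continuous_on_const]] by blast
  define D where "D = (\<lambda>n x. (\<zeta> n x)\<^sup>2 *\<^sub>R Dg x + (2 * g x * \<zeta> n x) *\<^sub>R grad (\<zeta> n) x)"
  note smc = smooth_continuous[OF sm] smooth_continuous_grad[OF sm]
  have Dc: "continuous_on K (D n)" for n
    unfolding D_def by (intro continuous_intros smc gc g)
  have Dder: "((\<lambda>x. g x * (\<zeta> n x)\<^sup>2) has_derivative (\<lambda>h. D n x \<bullet> h)) (at x)" if "x \<in> K" for n x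
  proof -
    have "((\<lambda>x. (\<zeta> n x)\<^sup>2) has_derivative (\<lambda>h. 2 * \<zeta> n x * (grad (\<zeta> n) x \<bullet> h))) (at x)"
      using has_derivative_power[OF smooth_has_derivative[OF sm], where n = 2] by (simp add: mult.assoc mult.commute mult.left_commute)
    from has_derivative_mult[OF g(1)[OF that] this]
    show ?thesis by (rule has_derivative_eq_rhs) (auto simp: D_def inner_add_left algebra_simps)
  qed
  have e0: "(\<lambda>n. edge_integral p q (\<lambda>x. g x * (\<zeta> n x)\<^sup>2)) \<longlonglongrightarrow> 0" if "(p, q) \<in> perimeter_edges" for p q
  proof (rule Lim_null_comparison[OF always_eventually])
    show "(\<lambda>n. C * edge_integral p q (\<lambda>x. (\<zeta> n x)\<^sup>2)) \<longlonglongrightarrow> 0"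
      using ed[OF that] by (rule tendsto_mult_right_zero)
    show "\<forall>n. norm (edge_integral p q (\<lambda>x. g x * (\<zeta> n x)\<^sup>2)) \<le> C * edge_integral p q (\<lambda>x. (\<zeta> n x)\<^sup>2)"
      using edge_integral_weight_bound[OF gc _ smc(1) that] C by simp
  qed
  have mem: "(a, vb) \<in> perimeter_edges" "(vb, vc) \<in> perimeter_edges" "(vc, vd) \<in> perimeter_edges" "(vd, a) \<in> perimeter_edges"
    by (auto simp: perimeter_edges_def)
  note e0' = e0[OF mem(1)] e0[OF mem(2)] e0[OF mem(3)] e0[OF mem(4)]
  have div: "(LINT x|ME. D k x \<bullet> u) = h * (edge_integral vb vc (\<lambda>x. g x * (\<zeta> k x)\<^sup>2) - edge_integral vd a (\<lambda>x. g x * (\<zeta> k x)\<^sup>2))"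
    "(LINT x|ME. D k x \<bullet> leg) = h * (e2 * edge_integral vc vd (\<lambda>x. g x * (\<zeta> k x)\<^sup>2)
      - e1 * edge_integral a vb (\<lambda>x. g x * (\<zeta> k x)\<^sup>2) - (e2 - e1) * edge_integral vb vc (\<lambda>x. g x * (\<zeta> k x)\<^sup>2))" for k
    by (rule divergence_theorem; rule Dder Dc; assumption?)+
  have "(\<lambda>n. LINT x|ME. D n x \<bullet> u) \<longlonglongrightarrow> h * (0 - 0)"
    unfolding div by (intro tendsto_intros e0')
  moreover have "(\<lambda>n. LINT x|ME. D n x \<bullet> leg) \<longlonglongrightarrow> h * (e2 * 0 - e1 * 0 - (e2 - e1) * 0)"
    unfolding div by (intro tendsto_intros e0')
  \<comment> \<open>The divergence theorem covers the directions \<open>u\<close> and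
    \<open>leg\<close>, which span the plane.\<close>
  moreover have Dw: "(LINT x|ME. D k x \<bullet> w) = (w \<bullet> u - s * (w \<bullet> n) / h) * (LINT x|ME. D k x \<bullet> u) + ((w \<bullet> n) / h) * (LINT x|ME. D k x \<bullet> leg)" for k
  proof -
    define c1 c2 where "c1 = w \<bullet> u - s * (w \<bullet> n) / h" and "c2 = (w \<bullet> n) / h"
    have w: "w = c1 *\<^sub>R u + c2 *\<^sub>R leg" unfolding c1_def c2_def by (rule direction_expansion)
    have "(LINT x|ME. D k x \<bullet> w) = (LINT x|ME. c1 * (D k x \<bullet> u) + c2 * (D k x \<bullet> leg))"
      by (subst w) (simp add: inner_add_right)
    also have "\<dots> = c1 * (LINT x|ME. D k x \<bullet> u) + c2 * (LINT x|ME. D k x \<bullet> leg)"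
      by (simp add: continuous_integrable continuous_on_inner Dc)
    finally show ?thesis by (simp add: c1_def c2_def)
  qed
  ultimately have lim0: "(\<lambda>n. LINT x|ME. D n x \<bullet> w) \<longlonglongrightarrow> 0"
    unfolding Dw by (intro tendsto_add_zero tendsto_mult_right_zero) simp_all
  have 1: "(\<lambda>n. LINT x|ME. \<zeta> n x * ((Dg x \<bullet> w) *\<^sub>R \<zeta> n x)) \<longlonglongrightarrow> (LINT x|ME. z x * ((Dg x \<bullet> w) *\<^sub>R z x))"
    using C' E_subset_K by (intro L2_conv_mult cz L2_conv_scaleR[OF cz, where C = C'] K_measurable continuous_intros g) auto
  have 2: "(\<lambda>n. LINT x|ME. (2 * g x) *\<^sub>R \<zeta> n x * (grad (\<zeta> n) x \<bullet> w)) \<longlonglongrightarrow> (LINT x|ME. (2 * g x) *\<^sub>R z x * (Z x \<bullet> w))"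
    using C E_subset_K by (intro L2_conv_mult L2_conv_inner_const cZ L2_conv_scaleR[OF cz, where C = "2 * C"] K_measurable continuous_intros gc) (auto simp: abs_mult)
  have "(LINT x|ME. D n x \<bullet> w) = (LINT x|ME. \<zeta> n x * ((Dg x \<bullet> w) *\<^sub>R \<zeta> n x)) + (LINT x|ME. (2 * g x) *\<^sub>R \<zeta> n x * (grad (\<zeta> n) x \<bullet> w))" for n
    by (subst Bochner_Integration.integral_add[symmetric])
      (auto intro!: continuous_integrable continuous_intros smc g gc Bochner_Integration.integral_cong simp: D_def inner_add_left algebra_simps power2_eq_square)
  with tendsto_add[OF 1 2] have "(\<lambda>n. LINT x|ME. D n x \<bullet> w) \<longlonglongrightarrow>
     (LINT x|ME. z x * ((Dg x \<bullet> w) *\<^sub>R z x)) + (LINT x|ME. (2 * g x) *\<^sub>R z x * (Z x \<bullet> w))" by simp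
  from LIMSEQ_unique[OF this lim0]
  have "(LINT x|ME. z x * ((Dg x \<bullet> w) *\<^sub>R z x)) = - (LINT x|ME. (2 * g x) *\<^sub>R z x * (Z x \<bullet> w))" by simp
  moreover have "(LINT x|ME. (2 * g x) *\<^sub>R z x * (Z x \<bullet> w)) = 2 * (LINT x|ME. g x * z x * (Z x \<bullet> w))"
    by (subst Bochner_Integration.integral_mult_right_zero[symmetric]) (simp add: mult.assoc)
  ultimately show ?thesis by (simp add: power2_eq_square mult.commute mult.left_commute)
qed

text \<open>
  The distance between the lines \<open>al = 0\<close> and \<open>al = em\<close>, between which \<open>E\<close> lies; for a sheared
  trapezoid it can be much smaller than the bases.
\<close>

definition W :: real where "W = em / norm m_al"

lemma W_pos: "W > 0" using em_pos m_nonzero by (simp add: W_def)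

lemma al_bounds: "x \<in> K \<Longrightarrow> 0 \<le> al x" "x \<in> K \<Longrightarrow> al x \<le> em"
  using wd_le_em by (auto simp: K_def intro: order_trans)

lemma zero_trace_integrable:
  assumes "zero_trace z Z" and g: "continuous_on K g"
  shows "integrable ME (\<lambda>x. g x * (z x)\<^sup>2)" "integrable ME (\<lambda>x. g x * z x * (Z x \<bullet> w))"
proof -
  obtain C where C: "\<And>x. x \<in> K \<Longrightarrow> norm (g x) \<le> C" using K_bounded[OF g] by blast
  note s = zero_traceD[OF assms(1)]
  have gz: "square_integrable ME (\<lambda>x. g x *\<^sub>R z x)"
    using C E_subset_K by (intro square_integrable_scaleR[OF s(1), where C = C] K_measurable g) auto
  have Zw: "square_integrable ME (\<lambda>x. Z x \<bullet> w)"
    using L2_convD(2)[OF L2_conv_inner_const[OF L2_conv_const[OF s(2)]]] .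
  show "integrable ME (\<lambda>x. g x * (z x)\<^sup>2)"
    using square_integrable_mult[OF gz s(1)] by (simp add: power2_eq_square mult.assoc)
  show "integrable ME (\<lambda>x. g x * z x * (Z x \<bullet> w))"
    using square_integrable_mult[OF gz Zw] by simp
qed

text \<open>Integration by parts with \<open>g = al\<close> in the direction \<open>m_al\<close>:
  the derivative is the constant \<open>(norm m_al)\<^sup>2\<close>, while \<open>al\<close> is at
  most \<open>em\<close>. Young's inequality is weighted so that half of the left side is absorbed.
  Only W appears, whence the uniformity in the shear.\<close>

lemma poincare:
  assumes zt: "zero_trace z Z"
  shows "(LINT x|ME. (z x)\<^sup>2) \<le> 4 * W\<^sup>2 * (LINT x|ME. (norm (Z x))\<^sup>2)"
proof -
  let ?m = "norm m_al"
  note s = zero_traceD[OF zt]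
  have iz: "integrable ME (\<lambda>x. (z x)\<^sup>2)" and iZ: "integrable ME (\<lambda>x. (norm (Z x))\<^sup>2)"
    using s by (auto dest: square_integrable_integrable)
  have "?m\<^sup>2 * (LINT x|ME. (z x)\<^sup>2) = (LINT x|ME. - 2 * (al x * z x * (Z x \<bullet> m_al)))"
    using zero_trace_ibp[OF zt, of al "\<lambda>x. m_al" m_al] has_derivative_affine[of "- (m_al \<bullet> a)" m_al]
    by (simp add: al_def[abs_def] power2_norm_eq_inner)
  also have "\<dots> \<le> (LINT x|ME. ?m\<^sup>2 / 2 * (z x)\<^sup>2 + 2 * em\<^sup>2 * (norm (Z x))\<^sup>2)"
  proof (rule integral_mono)
    show "integrable ME (\<lambda>x. - 2 * (al x * z x * (Z x \<bullet> m_al)))"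
      using zero_trace_integrable(2)[OF zt continuous_al] by simp
    fix x assume "x \<in> space ME"
    then have x: "0 \<le> al x" "al x \<le> em" using al_bounds E_subset_K by auto
    have "- 2 * (al x * z x * (Z x \<bullet> m_al)) \<le> 2 * (al x * \<bar>z x\<bar> * \<bar>Z x \<bullet> m_al\<bar>)"
      using x abs_ge_minus_self[of "al x * z x * (Z x \<bullet> m_al)"] by (simp add: abs_mult mult.assoc mult.left_commute)
    also have "\<dots> \<le> 2 * (em * \<bar>z x\<bar> * (norm (Z x) * ?m))"
      using x by (intro mult_left_mono mult_mono Cauchy_Schwarz_ineq2) auto
    also have "\<dots> \<le> ?m\<^sup>2 / 2 * (z x)\<^sup>2 + 2 * em\<^sup>2 * (norm (Z x))\<^sup>2"
      using sum_squares_bound[of "?m * \<bar>z x\<bar> / 2" "em * norm (Z x)"]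
      by (simp add: power_mult_distrib power_divide algebra_simps)
    finally show "- 2 * (al x * z x * (Z x \<bullet> m_al)) \<le> ?m\<^sup>2 / 2 * (z x)\<^sup>2 + 2 * em\<^sup>2 * (norm (Z x))\<^sup>2" .
  qed (use iz iZ in auto)
  also have "\<dots> = ?m\<^sup>2 / 2 * (LINT x|ME. (z x)\<^sup>2) + 2 * em\<^sup>2 * (LINT x|ME. (norm (Z x))\<^sup>2)"
    using iz iZ by simp
  finally have "?m\<^sup>2 * (LINT x|ME. (z x)\<^sup>2) \<le> 4 * em\<^sup>2 * (LINT x|ME. (norm (Z x))\<^sup>2)" by simp
  then show ?thesis using m_nonzero by (simp add: W_def field_simps)
qed

text \<open>The shift \<open>\<delta>\<close> keeps the weight bounded on \<open>K\<close>; the constant does not depend on it.\<close>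

lemma hardy:
  assumes zt: "zero_trace z Z" and m: "m \<noteq> 0" and pos: "\<And>x. x \<in> K \<Longrightarrow> c + m \<bullet> x \<ge> 0" and d: "\<delta> > 0"
  shows "(LINT x|ME. (z x / (c + m \<bullet> x + \<delta>))\<^sup>2) \<le> 4 / (norm m)\<^sup>2 * (LINT x|ME. (norm (Z x))\<^sup>2)"
    and "square_integrable ME (\<lambda>x. z x / (c + m \<bullet> x + \<delta>))"
proof -
  let ?m = "norm m" and ?l = "\<lambda>x. c + m \<bullet> x + \<delta>"
  note s = zero_traceD[OF zt]
  have lpos: "?l x > 0" if "x \<in> K" for x using pos[OF that] d by simp
  have cl: "continuous_on K (\<lambda>x. 1 / ?l x)"
    using lpos by (intro continuous_intros) (metis less_irrefl)
  have cl2: "continuous_on K (\<lambda>x. - 1 / ?l x)" using continuous_on_minus[OF cl] by simp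
  have lb: "\<bar>1 / ?l x\<bar> \<le> 1 / \<delta>" if "x \<in> K" for x
    using pos[OF that] d by (simp add: field_simps)
  have "square_integrable ME (\<lambda>x. (1 / ?l x) *\<^sub>R z x)"
    using lb E_subset_K by (intro square_integrable_scaleR[OF s(1), where C = "1/\<delta>"] K_measurable cl) auto
  then show sq: "square_integrable ME (\<lambda>x. z x / ?l x)" by simp
  have iy: "integrable ME (\<lambda>x. (z x / ?l x)\<^sup>2)" and iZ: "integrable ME (\<lambda>x. (norm (Z x))\<^sup>2)"
    using square_integrable_integrable_real[OF sq] square_integrable_integrable[OF s(2)] by simp_all
  have "?m\<^sup>2 * (LINT x|ME. (z x / ?l x)\<^sup>2) = (LINT x|ME. (((1 / (?l x)\<^sup>2) *\<^sub>R m) \<bullet> m) * (z x)\<^sup>2)"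
    by (subst Bochner_Integration.integral_mult_right_zero[symmetric])
      (auto intro!: Bochner_Integration.integral_cong simp: power2_norm_eq_inner power_divide)
  \<comment> \<open>Integration by parts with \<open>g = - 1 / ?l\<close>, whose derivative in the
    direction \<open>m\<close> is the singular weight. Unlike its derivative, \<open>g\<close> has
    only the first power of \<open>?l\<close> in the denominator, so it pairs with
    \<open>z / ?l\<close>.\<close>
  also have "\<dots> = - 2 * (LINT x|ME. (- 1 / ?l x) * z x * (Z x \<bullet> m))"
  proof (rule zero_trace_ibp[OF zt])
    fix x assume "x \<in> K"
    then show "((\<lambda>x. - 1 / ?l x) has_derivative (\<lambda>h. ((1 / (?l x)\<^sup>2) *\<^sub>R m) \<bullet> h)) (at x)"
      using lpos[of x] by (auto intro!: derivative_eq_intros simp: power2_eq_square field_simps)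
  next
    show "continuous_on K (\<lambda>x. (1 / (?l x)\<^sup>2) *\<^sub>R m)"
      using lpos by (intro continuous_intros) (metis less_irrefl power_not_zero)
  qed
  also have "\<dots> = (LINT x|ME. - 2 * ((- 1 / ?l x) * z x * (Z x \<bullet> m)))"
    by (rule Bochner_Integration.integral_mult_right_zero[symmetric])
  also have "\<dots> \<le> (LINT x|ME. ?m\<^sup>2 / 2 * (z x / ?l x)\<^sup>2 + 2 * (norm (Z x))\<^sup>2)"
  proof (rule integral_mono)
    show "integrable ME (\<lambda>x. - 2 * ((- 1 / ?l x) * z x * (Z x \<bullet> m)))"
      using zero_trace_integrable(2)[OF zt cl2, of m] by (intro integrable_mult_right) 
    fix x assume "x \<in> space ME"
    have "- 2 * ((- 1 / ?l x) * z x * (Z x \<bullet> m)) \<le> 2 * (\<bar>z x / ?l x\<bar> * \<bar>Z x \<bullet> m\<bar>)"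
      using abs_ge_self[of "z x / ?l x * (Z x \<bullet> m)"] by (simp add: abs_mult)
    also have "\<dots> \<le> 2 * (\<bar>z x / ?l x\<bar> * (norm (Z x) * ?m))"
      by (intro mult_left_mono Cauchy_Schwarz_ineq2) auto
    also have "\<dots> \<le> ?m\<^sup>2 / 2 * (z x / ?l x)\<^sup>2 + 2 * (norm (Z x))\<^sup>2"
    proof -
      have "2 * (y * (Y * M)) \<le> M\<^sup>2 / 2 * y\<^sup>2 + 2 * Y\<^sup>2" for y Y M :: real
        using sum_squares_bound[of "M * y / 2" Y] by (simp add: power_mult_distrib power_divide algebra_simps)
      from this[of "\<bar>z x / ?l x\<bar>"] show ?thesis by (simp only: power2_abs)
    qed
    finally show "- 2 * ((- 1 / ?l x) * z x * (Z x \<bullet> m)) \<le> ?m\<^sup>2 / 2 * (z x / ?l x)\<^sup>2 + 2 * (norm (Z x))\<^sup>2" .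
  qed (use iy iZ in auto)
  also have "\<dots> = ?m\<^sup>2 / 2 * (LINT x|ME. (z x / ?l x)\<^sup>2) + 2 * (LINT x|ME. (norm (Z x))\<^sup>2)"
    using iy iZ by simp
  finally have "?m\<^sup>2 * (LINT x|ME. (z x / ?l x)\<^sup>2) \<le> 4 * (LINT x|ME. (norm (Z x))\<^sup>2)" by simp
  then show "(LINT x|ME. (z x / ?l x)\<^sup>2) \<le> 4 / ?m\<^sup>2 * (LINT x|ME. (norm (Z x))\<^sup>2)"
    using m by (simp add: field_simps)
qed

end

section \<open>Cutoff functions\<close>

lemma compact_closed_subset: "compact B \<Longrightarrow> closed A \<Longrightarrow> A \<subseteq> B \<Longrightarrow> compact (A :: 'a::t2_space set)"
  using compact_Int_closed[of B A] by (simp add: inf.absorb2)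

lemma test_function_mult:
  assumes "test_function S \<omega>" "smooth f"
  shows "test_function S (\<lambda>x. \<omega> x * f x)"
proof -
  have sub: "closure {x. \<omega> x * f x \<noteq> 0} \<subseteq> closure {x. \<omega> x \<noteq> 0}"
    by (rule closure_mono) auto
  then have "compact (closure {x. \<omega> x * f x \<noteq> 0})"
    using assms(1) by (intro compact_closed_subset[OF _ closed_closure sub]) (simp add: test_function_def)
  then show ?thesis using assms sub by (auto simp: test_function_def intro: smooth_mult)
qed

text \<open>Lets the weak gradient be tested with partial derivatives, which is how second
  derivatives of test functions arise. Outside the closed support the function vanishes on a
  neighbourhood, and so does its gradient.\<close>

lemma test_function_grad:
  assumes "test_function S \<phi>"
  shows "test_function S (\<lambda>x. grad \<phi> x $ i)"
proof -
  have z: "grad \<phi> x = 0" if "x \<notin> closure {x. \<phi> x \<noteq> 0}" for x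
  proof (rule grad_eqI)
    have "((\<lambda>x. 0) has_derivative (\<lambda>h. 0 \<bullet> h)) (at x)" by simp
    then show "(\<phi> has_derivative (\<lambda>h. 0 \<bullet> h)) (at x)"
    proof (rule has_derivative_transform_within_open[where s = "- closure {x. \<phi> x \<noteq> 0}"])
      show "0 = \<phi> y" if "y \<in> - closure {x. \<phi> x \<noteq> 0}" for y
        using that closure_subset[of "{x. \<phi> x \<noteq> 0}"] by auto
    qed (use that in auto)
  qed
  then have "{x. grad \<phi> x $ i \<noteq> 0} \<subseteq> closure {x. \<phi> x \<noteq> 0}" by fastforce
  then have sub: "closure {x. grad \<phi> x $ i \<noteq> 0} \<subseteq> closure {x. \<phi> x \<noteq> 0}"
    by (simp add: closure_minimal)
  then have "compact (closure {x. grad \<phi> x $ i \<noteq> 0})"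
    using assms by (intro compact_closed_subset[OF _ closed_closure sub]) (simp add: test_function_def)
  then show ?thesis using assms sub by (auto simp: test_function_def intro: smooth_grad)
qed

lemma test_functionI:
  assumes "smooth \<phi>" "compact C" "C \<subseteq> S" "\<And>x. \<phi> x \<noteq> 0 \<Longrightarrow> x \<in> C"
  shows "test_function S \<phi>"
proof -
  have "closure {x. \<phi> x \<noteq> 0} \<subseteq> C"
    using assms by (intro closure_minimal) (auto simp: compact_imp_closed)
  moreover from this have "compact (closure {x. \<phi> x \<noteq> 0})"
    using compact_closed_subset[OF assms(2) closed_closure] by blast
  ultimately show ?thesis using assms by (auto simp: test_function_def)
qed

context trapezoid
begin

text \<open>The four inequalities that cut out the trapezoid, as indexed affine functions, so that
  the cutoff and Hardy's inequality can be summed over the sides.\<close>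

definition side_const :: "nat \<Rightarrow> real" where
  "side_const i = [- (m_ga \<bullet> a), 1 + m_ga \<bullet> a, - (m_al \<bullet> a), e1 + (e2 - e1) * - (m_ga \<bullet> a) + m_al \<bullet> a] ! i"
definition side_vec :: "nat \<Rightarrow> real^2" where
  "side_vec i = [m_ga, - m_ga, m_al, (e2 - e1) *\<^sub>R m_ga - m_al] ! i"
definition side :: "nat \<Rightarrow> real^2 \<Rightarrow> real" where
  "side i x = side_const i + side_vec i \<bullet> x"

lemma side_simps: "side 0 x = ga x" "side 1 x = 1 - ga x" "side 2 x = al x" "side 3 x = wd (ga x) - al x"
  using wd_ga[of x] by (simp_all add: side_def side_const_def side_vec_def ga_def al_def numeral_eq_Suc)

lemma less_4: "(\<forall>i<4. P i) \<longleftrightarrow> P 0 \<and> P 1 \<and> P 2 \<and> P (3::nat)"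
  by (auto simp: numeral_eq_Suc less_Suc_eq)

lemma K_sides: "x \<in> K \<longleftrightarrow> (\<forall>i<4. 0 \<le> side i x)" and E_sides: "x \<in> E \<longleftrightarrow> (\<forall>i<4. 0 < side i x)"
  unfolding less_4 side_simps by (auto simp: K_def E_def)

lemma side_vec_nonzero: "i < 4 \<Longrightarrow> side_vec i \<noteq> 0"
  using m_nonzero less_4[of "\<lambda>i. side_vec i \<noteq> 0"]
  by (auto simp: side_vec_def numeral_eq_Suc)

lemma continuous_side: "continuous_on S (side i)"
  unfolding side_def[abs_def] by (intro continuous_intros)

text \<open>Because of the shift by 1 the factor vanishes wherever
  \<open>side i x \<le> \<delta>\<close>, which keeps the support of the product inside
  \<open>E\<close>.\<close>

definition cutoff_factor :: "real \<Rightarrow> nat \<Rightarrow> real^2 \<Rightarrow> real" where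
  "cutoff_factor \<delta> i x = flat_exp 0 (side i x / \<delta> - 1)"
definition cutoff :: "real \<Rightarrow> real^2 \<Rightarrow> real" where
  "cutoff \<delta> x = (\<Prod>i<4. cutoff_factor \<delta> i x)"
text \<open>What remains of the gradient of a cutoff factor after
  \<open>norm (side_vec i) / (side i x + \<delta>)\<close> is split off. It is at most 5 on
  \<open>K\<close>, uniformly in \<open>\<delta>\<close>.\<close>

definition cutoff_weight :: "real \<Rightarrow> nat \<Rightarrow> real^2 \<Rightarrow> real" where
  "cutoff_weight \<delta> i x = flat_exp 2 (side i x / \<delta> - 1) * (side i x / \<delta> + 1)"

lemma smooth_cutoff_factor: "smooth (cutoff_factor \<delta> i)"
proof -
  have "cutoff_factor \<delta> i = (\<lambda>x. flat_exp 0 ((side_const i / \<delta> - 1) + ((1 / \<delta>) *\<^sub>R side_vec i) \<bullet> x))"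
    by (auto simp: cutoff_factor_def side_def add_divide_distrib algebra_simps)
  then show ?thesis by (simp only:) (rule smooth_comp[OF smooth1_flat_exp smooth_affine])
qed

lemma cutoff_factor_bounds: "0 \<le> cutoff_factor \<delta> i x" "cutoff_factor \<delta> i x \<le> 1"
  by (auto simp: cutoff_factor_def flat_exp_nonneg flat_exp_0_le_1)

lemma cutoff_bounds: "0 \<le> cutoff \<delta> x" "cutoff \<delta> x \<le> 1"
  unfolding cutoff_def using cutoff_factor_bounds by (auto intro!: prod_nonneg prod_le_1)

lemma smooth_cutoff: "smooth (cutoff \<delta>)"
  unfolding cutoff_def[abs_def] by (intro smooth_prod smooth_cutoff_factor cutoff_factor_bounds)

lemma test_function_cutoff:
  assumes "\<delta> > 0"
  shows "test_function E (cutoff \<delta>)"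
proof (rule test_functionI[OF smooth_cutoff])
  let ?C = "K \<inter> {x. \<forall>i<4. \<delta> \<le> side i x}"
  have "closed {x. \<forall>i<4. \<delta> \<le> side i x}"
    by (intro closed_Collect_all closed_Collect_imp closed_Collect_le continuous_intros continuous_side) auto
  then show "compact ?C" by (rule compact_Int_closed[OF compact_K])
  show "?C \<subseteq> E" using assms unfolding E_sides[abs_def] by (force simp: E_sides)
  show "x \<in> ?C" if "cutoff \<delta> x \<noteq> 0" for x
  proof -
    have "\<delta> \<le> side i x" if "i < 4" for i
    proof -
      have "cutoff_factor \<delta> i x \<noteq> 0" using \<open>cutoff \<delta> x \<noteq> 0\<close> that by (auto simp: cutoff_def)
      then have "side i x / \<delta> - 1 > 0" by (auto simp: cutoff_factor_def flat_exp_def split: if_splits)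
      then show ?thesis using assms by (simp add: field_simps)
    qed
    then show ?thesis using assms by (force simp: K_sides)
  qed
qed

lemma grad_cutoff_factor:
  assumes "\<delta> > 0" "i < 4" "x \<in> K"
  shows "norm (grad (cutoff_factor \<delta> i) x) = norm (side_vec i) * cutoff_weight \<delta> i x / (side i x + \<delta>)"
proof -
  let ?l = "\<lambda>x. (side_const i / \<delta> - 1) + ((1 / \<delta>) *\<^sub>R side_vec i) \<bullet> x"
  have l: "?l x = side i x / \<delta> - 1" for x by (simp add: side_def add_divide_distrib)
  have "cutoff_factor \<delta> i = (\<lambda>x. flat_exp 0 (?l x))" by (rule ext) (simp only: cutoff_factor_def l)
  moreover have "(flat_exp 0 has_real_derivative flat_exp 2 (?l x)) (at (?l x))"
    using flat_exp_deriv[of 0 "?l x"] by (simp add: numeral_2_eq_2)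
  ultimately have "grad (cutoff_factor \<delta> i) x = flat_exp 2 (?l x) *\<^sub>R ((1 / \<delta>) *\<^sub>R side_vec i)"
    using grad_comp[of "flat_exp 0" "flat_exp 2 (?l x)" ?l x, OF _ smooth_affine] by (simp only: grad_affine)
  moreover have "side i x \<ge> 0" using assms K_sides by auto
  moreover from this have "side i x + \<delta> > 0" using assms by simp
  moreover have "side i x / \<delta> + 1 = (side i x + \<delta>) / \<delta>" using assms(1) by (simp add: add_divide_distrib)
  ultimately show ?thesis
    using assms(1) flat_exp_nonneg[of 2 "?l x"] by (simp add: cutoff_weight_def l[symmetric])
qed

lemma cutoff_weight_bounds:
  assumes "\<delta> > 0" "i < 4" "x \<in> K"
  shows "0 \<le> cutoff_weight \<delta> i x" "cutoff_weight \<delta> i x \<le> 5"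
  using flat_exp_cutoff_bound(1,2)[of "side i x / \<delta>"] assms K_sides by (auto simp: cutoff_weight_def)

lemma norm_grad_cutoff:
  assumes "\<delta> > 0" "x \<in> K"
  shows "norm (grad (cutoff \<delta>) x) \<le> (\<Sum>i<4. norm (side_vec i) * cutoff_weight \<delta> i x / (side i x + \<delta>))"
proof -
  have "norm (grad (cutoff \<delta>) x) \<le> (\<Sum>i<4. norm (grad (cutoff_factor \<delta> i) x))"
    unfolding cutoff_def[abs_def] by (intro norm_grad_prod smooth_cutoff_factor cutoff_factor_bounds)
  also have "\<dots> = (\<Sum>i<4. norm (side_vec i) * cutoff_weight \<delta> i x / (side i x + \<delta>))"
    using assms by (intro sum.cong refl grad_cutoff_factor) auto
  finally show ?thesis .
qed

definition dl :: "nat \<Rightarrow> real" where "dl k = 1 / (real k + 1)"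

lemma dl_pos: "dl k > 0" by (simp add: dl_def)

lemma side_over_dl:
  assumes "c > 0"
  shows "filterlim (\<lambda>k. c / dl k - 1) at_top sequentially"
proof -
  have "(\<lambda>k. c / dl k - 1) = (\<lambda>k. (c - 1) + c * real k)" by (auto simp: dl_def algebra_simps)
  moreover have "filterlim (\<lambda>k. (c - 1) + c * real k) at_top sequentially"
    by (intro filterlim_tendsto_add_at_top[OF tendsto_const] filterlim_tendsto_pos_mult_at_top[OF tendsto_const assms]
        filterlim_real_sequentially)
  ultimately show ?thesis by simp
qed

lemma cutoff_limit:
  assumes "x \<in> E"
  shows "(\<lambda>k. cutoff (dl k) x) \<longlonglongrightarrow> 1"
proof -
  have "(\<lambda>k. cutoff_factor (dl k) i x) \<longlonglongrightarrow> 1" if "i < 4" for i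
  proof -
    have "side i x > 0" using assms that E_sides by auto
    note f = side_over_dl[OF this]
    have "((\<lambda>t. exp (- (1 / t))) \<longlongrightarrow> exp (- (0::real))) at_top"
      by (intro tendsto_intros tendsto_divide_0[OF tendsto_const] filterlim_at_top_imp_at_infinity filterlim_ident)
    from filterlim_compose[OF this f]
    have "(\<lambda>k. exp (- (1 / (side i x / dl k - 1)))) \<longlonglongrightarrow> 1" by simp
    then show ?thesis
    proof (rule Lim_transform_eventually)
      show "\<forall>\<^sub>F k in sequentially. exp (- (1 / (side i x / dl k - 1))) = cutoff_factor (dl k) i x"
        using f[THEN filterlim_at_top_dense[THEN iffD1], rule_format, of 0]
        by eventually_elim (simp add: cutoff_factor_def flat_exp_def)
    qed
  qed
  then have "(\<lambda>k. \<Prod>i<4. cutoff_factor (dl k) i x) \<longlonglongrightarrow> (\<Prod>i<4::nat. 1)"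
    by (intro tendsto_prod) auto
  then show ?thesis by (simp add: cutoff_def)
qed

text \<open>At a fixed point of \<open>E\<close> the ratio of \<open>side\<close> and
  \<open>\<delta>\<close> tends to infinity, where the third bound of
  \<open>flat_exp_cutoff_bound\<close> decays.\<close>

lemma cutoff_weight_limit:
  assumes "x \<in> E" "i < 4"
  shows "(\<lambda>k. cutoff_weight (dl k) i x) \<longlonglongrightarrow> 0"
proof -
  have p: "side i x > 0" and xK: "x \<in> K" using assms E_sides E_subset_K by auto
  note f = side_over_dl[OF p]
  have "((\<lambda>t. 1 / t + 2 * (1 / t)\<^sup>2) \<longlongrightarrow> 0 + 2 * (0::real)\<^sup>2) at_top"
    by (intro tendsto_intros tendsto_divide_0[OF tendsto_const] filterlim_at_top_imp_at_infinity filterlim_ident)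
  from filterlim_compose[OF this f]
  have lim: "(\<lambda>k. 1 / (side i x / dl k - 1) + 2 * (1 / (side i x / dl k - 1))\<^sup>2) \<longlonglongrightarrow> 0" by simp
  show ?thesis
  proof (rule Lim_null_comparison[OF _ lim])
    show "\<forall>\<^sub>F k in sequentially. norm (cutoff_weight (dl k) i x)
        \<le> 1 / (side i x / dl k - 1) + 2 * (1 / (side i x / dl k - 1))\<^sup>2"
      using f[THEN filterlim_at_top_dense[THEN iffD1], rule_format, of 0]
    proof eventually_elim
      case (elim k)
      then show ?case
        using flat_exp_cutoff_bound(3)[of "side i x / dl k"] cutoff_weight_bounds(1)[OF dl_pos assms(2) xK, of k] p dl_pos[of k]
        by (simp add: cutoff_weight_def)
    qed
  qed
qed

lemma cutoff_scaleR_conv: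
  assumes "square_integrable ME G"
  shows "L2_conv ME (\<lambda>k x. cutoff (dl k) x *\<^sub>R G x) G"
proof -
  have "L2_conv ME (\<lambda>k x. cutoff (dl k) x *\<^sub>R G x) (\<lambda>x. 1 *\<^sub>R G x)"
    by (rule L2_conv_dominated[OF assms, where C = 1])
      (use cutoff_bounds cutoff_limit in \<open>auto intro!: AE_I2 K_measurable smooth_continuous smooth_cutoff\<close>)
  then show ?thesis by simp
qed

lemma cutoff_weight_scaleR_conv:
  assumes "square_integrable ME G" "i < 4"
  shows "L2_conv ME (\<lambda>k x. cutoff_weight (dl k) i x *\<^sub>R G x) (\<lambda>x. 0)"
proof -
  have c: "continuous_on K (\<lambda>x. cutoff_weight \<delta> i x)" if "\<delta> > 0" for \<delta>
    unfolding cutoff_weight_def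
    by (intro continuous_intros continuous_side continuous_on_compose2[OF smooth1_continuous[OF smooth1_flat_exp, of UNIV]])
      (use that in auto)
  have "L2_conv ME (\<lambda>k x. cutoff_weight (dl k) i x *\<^sub>R G x) (\<lambda>x. 0 *\<^sub>R G x)"
  proof (rule L2_conv_dominated[OF assms(1), where C = 5])
    show "\<bar>cutoff_weight (dl k) i x\<bar> \<le> 5" if "x \<in> space ME" for k x
      using cutoff_weight_bounds[OF dl_pos assms(2), of x k] that E_subset_K by auto
    show "AE x in ME. (\<lambda>k. cutoff_weight (dl k) i x) \<longlonglongrightarrow> 0"
      using cutoff_weight_limit assms(2) by (auto intro!: AE_I2)
  qed (auto intro!: K_measurable c dl_pos)
  then show ?thesis by simp
qed

text \<open>
  The gradient of the cutoff is at most \<open>cutoff_weight / (side + \<delta>)\<close> on each side, so that Hardy's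
  inequality absorbs the singular factor, while the bounded weights tend to \<open>0\<close> pointwise.
\<close>

lemma zero_trace_grad_cutoff:
  assumes zt: "zero_trace z Z" and G: "square_integrable ME G"
  shows "(\<lambda>k. LINT x|ME. G x \<bullet> (z x *\<^sub>R grad (cutoff (dl k)) x)) \<longlonglongrightarrow> 0"
proof (rule Lim_null_comparison[OF always_eventually])
  note s = zero_traceD[OF zt]
  \<comment> \<open>Cauchy-Schwarz on each side: the weight times \<open>G\<close> tends to 0 in L2,
    and \<open>z / (side + \<delta>)\<close> is bounded by Hardy's inequality independently of
    \<open>k\<close>. The 2 is the square root of Hardy's 4.\<close>
  let ?B = "\<lambda>k. \<Sum>i<4. norm (side_vec i) * (L2_norm ME (\<lambda>x. cutoff_weight (dl k) i x *\<^sub>R G x - 0) *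
       (2 / norm (side_vec i) * L2_norm ME Z))"
  have "?B \<longlonglongrightarrow> (\<Sum>i<4::nat. 0)"
    by (intro tendsto_sum tendsto_mult_right_zero tendsto_mult_left_zero L2_convD(3)[OF cutoff_weight_scaleR_conv[OF G]]) auto
  then show "?B \<longlonglongrightarrow> 0" by simp
  show "\<forall>k. norm (LINT x|ME. G x \<bullet> (z x *\<^sub>R grad (cutoff (dl k)) x)) \<le> ?B k"
  proof
    fix k
    let ?c = "\<lambda>i x. cutoff_weight (dl k) i x *\<^sub>R G x" and ?y = "\<lambda>i x. z x / (side i x + dl k)"
    have sc: "square_integrable ME (?c i)" if "i < 4" for i
      using L2_convD(1)[OF cutoff_weight_scaleR_conv[OF G that]] .
    have sN: "square_integrable ME (\<lambda>x. norm (?c i x))" if "i < 4" for i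
      by (rule square_integrable_bound[OF sc[OF that], where c = 1]) (use square_integrable_measurable[OF sc[OF that]] in \<open>auto simp del: norm_scaleR\<close>)
    have hy: "square_integrable ME (?y i)" "(LINT x|ME. (?y i x)\<^sup>2) \<le> 4 / (norm (side_vec i))\<^sup>2 * (LINT x|ME. (norm (Z x))\<^sup>2)"
      if "i < 4" for i
      using hardy[OF zt side_vec_nonzero[OF that], of "side_const i" "dl k"] dl_pos K_sides that by (auto simp: side_def)
    have sy: "square_integrable ME (\<lambda>x. \<bar>?y i x\<bar>)" if "i < 4" for i
      by (rule square_integrable_bound[OF hy(1)[OF that], where c = 1]) (use square_integrable_measurable[OF hy(1)[OF that]] in \<open>auto simp del: abs_divide\<close>)
    have Ly: "L2_norm ME (\<lambda>x. \<bar>?y i x\<bar>) \<le> 2 / norm (side_vec i) * L2_norm ME Z" if "i < 4" for i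
    proof -
      have "L2_norm ME (\<lambda>x. \<bar>?y i x\<bar>) = sqrt (LINT x|ME. (?y i x)\<^sup>2)"
        by (simp only: L2_norm_def real_norm_def power2_abs abs_idempotent)
      then show ?thesis
        using real_sqrt_le_mono[OF hy(2)[OF that]] by (simp add: L2_norm_def real_sqrt_mult real_sqrt_divide)
    qed
    have "norm (LINT x|ME. G x \<bullet> (z x *\<^sub>R grad (cutoff (dl k)) x)) \<le>
      (LINT x|ME. (\<Sum>i<4. norm (side_vec i) * (norm (?c i x) * \<bar>?y i x\<bar>)))"
    proof (rule Bochner_Integration.integral_norm_bound_integral)
      obtain C where C: "\<And>x. x \<in> K \<Longrightarrow> norm (grad (cutoff (dl k)) x) \<le> C"
        using K_bounded[OF smooth_continuous_grad[OF smooth_cutoff]] by blast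
      have "square_integrable ME (\<lambda>x. z x *\<^sub>R grad (cutoff (dl k)) x)"
      proof (rule square_integrable_bound[OF s(1), where c = C])
        show "(\<lambda>x. z x *\<^sub>R grad (cutoff (dl k)) x) \<in> borel_measurable ME"
          using square_integrable_measurable[OF s(1)] K_measurable[OF smooth_continuous_grad[OF smooth_cutoff]] by measurable
        show "AE x in ME. norm (z x *\<^sub>R grad (cutoff (dl k)) x) \<le> C * norm (z x)"
          using C E_subset_K by (auto intro!: AE_I2 mult_left_mono simp: mult.commute[of C])
      qed
      then show "integrable ME (\<lambda>x. G x \<bullet> (z x *\<^sub>R grad (cutoff (dl k)) x))"
        by (rule square_integrable_inner[OF G])
      show "integrable ME (\<lambda>x. \<Sum>i<4. norm (side_vec i) * (norm (?c i x) * \<bar>?y i x\<bar>))"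
        by (intro Bochner_Integration.integrable_sum integrable_mult_right square_integrable_mult sN sy) auto
      fix x assume "x \<in> space ME"
      then have x: "x \<in> K" using E_subset_K by auto
      have "norm (G x \<bullet> (z x *\<^sub>R grad (cutoff (dl k)) x)) \<le> norm (G x) * (\<bar>z x\<bar> * norm (grad (cutoff (dl k)) x))"
        using Cauchy_Schwarz_ineq2[of "G x" "z x *\<^sub>R grad (cutoff (dl k)) x"] by simp
      also have "\<dots> \<le> norm (G x) * (\<bar>z x\<bar> * (\<Sum>i<4. norm (side_vec i) * cutoff_weight (dl k) i x / (side i x + dl k)))"
        by (intro mult_left_mono norm_grad_cutoff dl_pos x) auto
      also have "\<dots> = (\<Sum>i<4. norm (side_vec i) * (norm (?c i x) * \<bar>?y i x\<bar>))"
        unfolding sum_distrib_left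
      proof (rule sum.cong[OF refl])
        fix i :: nat assume "i \<in> {..<4}"
        then have "0 \<le> cutoff_weight (dl k) i x" "side i x + dl k > 0"
          using cutoff_weight_bounds[OF dl_pos _ x] K_sides x dl_pos[of k] by (auto intro: add_nonneg_pos)
        then show "norm (G x) * (\<bar>z x\<bar> * (norm (side_vec i) * cutoff_weight (dl k) i x / (side i x + dl k)))
          = norm (side_vec i) * (norm (?c i x) * \<bar>?y i x\<bar>)" by (simp add: field_simps)
      qed
      finally show "norm (G x \<bullet> (z x *\<^sub>R grad (cutoff (dl k)) x)) \<le> (\<Sum>i<4. norm (side_vec i) * (norm (?c i x) * \<bar>?y i x\<bar>))" .
    qed
    also have "\<dots> = (\<Sum>i<4. norm (side_vec i) * (LINT x|ME. norm (?c i x) * \<bar>?y i x\<bar>))"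
      by (subst Bochner_Integration.integral_sum)
        (auto intro!: integrable_mult_right square_integrable_mult sN sy simp del: abs_divide norm_scaleR)
    also have "\<dots> \<le> ?B k"
    proof (intro sum_mono mult_left_mono)
      fix i :: nat assume "i \<in> {..<4}"
      then have i: "i < 4" by simp
      have "(LINT x|ME. norm (?c i x) * \<bar>?y i x\<bar>) \<le> L2_norm ME (\<lambda>x. norm (?c i x)) * L2_norm ME (\<lambda>x. \<bar>?y i x\<bar>)"
        using L2_Cauchy_Schwarz[OF sN[OF i] sy[OF i]] by (simp only: inner_real_def abs_le_iff)
      also have "L2_norm ME (\<lambda>x. norm (?c i x)) = L2_norm ME (\<lambda>x. ?c i x - 0)" by (simp add: L2_norm_def)
      also have "\<dots> * L2_norm ME (\<lambda>x. \<bar>?y i x\<bar>) \<le> \<dots> * (2 / norm (side_vec i) * L2_norm ME Z)"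
        by (intro mult_left_mono Ly i L2_norm_nonneg)
      finally show "(LINT x|ME. norm (?c i x) * \<bar>?y i x\<bar>) \<le> L2_norm ME (\<lambda>x. ?c i x - 0) * (2 / norm (side_vec i) * L2_norm ME Z)" .
    qed auto
    finally show "norm (LINT x|ME. G x \<bullet> (z x *\<^sub>R grad (cutoff (dl k)) x)) \<le> ?B k" .
  qed
qed

text \<open>A cutoff times an approximant \<open>\<zeta> n\<close> is an admissible test function.
  For a fixed cutoff the approximants are passed to their limit first; then the cutoff tends to 1,
  and \<open>zero_trace_grad_cutoff\<close> removes the term with its gradient.\<close>

lemma zero_trace_test:
  assumes zt: "zero_trace z Z" and G: "square_integrable ME G" and p: "square_integrable ME p"
    and weak: "\<And>\<phi>. test_function E \<phi> \<Longrightarrow> (LINT x|ME. G x \<bullet> grad \<phi> x) = - (LINT x|ME. p x * \<phi> x)"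
  shows "(LINT x|ME. G x \<bullet> Z x) = - (LINT x|ME. p x * z x)"
proof -
  obtain \<zeta> where sm: "\<And>n. smooth (\<zeta> n)" and cz: "L2_conv ME \<zeta> z" and cZ: "L2_conv ME (\<lambda>n. grad (\<zeta> n)) Z"
    using zt unfolding zero_trace_def by fast
  note s = zero_traceD[OF zt]
  let ?\<omega> = "\<lambda>k. cutoff (dl k)"
  have sub: "square_integrable ME (\<lambda>x. z x *\<^sub>R grad (?\<omega> k) x)" and
    step: "(LINT x|ME. G x \<bullet> (?\<omega> k x *\<^sub>R Z x + z x *\<^sub>R grad (?\<omega> k) x)) = - (LINT x|ME. p x * (?\<omega> k x *\<^sub>R z x))" for k
  proof -
    obtain C where C: "\<And>x. x \<in> K \<Longrightarrow> norm (grad (?\<omega> k) x) \<le> C"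
      using K_bounded[OF smooth_continuous_grad[OF smooth_cutoff]] by blast
    note mg = K_measurable[OF smooth_continuous_grad[OF smooth_cutoff[of "dl k"]]]
    note mc = K_measurable[OF smooth_continuous[OF smooth_cutoff[of "dl k"]]]
    show sub: "square_integrable ME (\<lambda>x. z x *\<^sub>R grad (?\<omega> k) x)"
    proof (rule square_integrable_bound[OF s(1), where c = C])
      show "(\<lambda>x. z x *\<^sub>R grad (?\<omega> k) x) \<in> borel_measurable ME"
        using square_integrable_measurable[OF s(1)] mg by measurable
      show "AE x in ME. norm (z x *\<^sub>R grad (?\<omega> k) x) \<le> C * norm (z x)"
        using C E_subset_K by (auto intro!: AE_I2 mult_left_mono simp: mult.commute[of C])
    qed
    have cg: "L2_conv ME (\<lambda>n x. \<zeta> n x *\<^sub>R grad (?\<omega> k) x) (\<lambda>x. z x *\<^sub>R grad (?\<omega> k) x)"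
    proof (rule L2_conv_bound[OF cz _ sub, where c = C])
      show "(\<lambda>x. \<zeta> m x *\<^sub>R grad (?\<omega> k) x) \<in> borel_measurable ME" for m
        using square_integrable_measurable[OF L2_convD(1)[OF cz]] mg by measurable
      show "AE x in ME. norm (\<zeta> m x *\<^sub>R grad (?\<omega> k) x - z x *\<^sub>R grad (?\<omega> k) x) \<le> C * norm (\<zeta> m x - z x)" for m
        using C E_subset_K by (auto intro!: AE_I2 mult_left_mono simp: scaleR_diff_left[symmetric] mult.commute[of C])
    qed
    have b: "\<bar>?\<omega> k x\<bar> \<le> 1" for x using cutoff_bounds[of "dl k" x] by simp
    have c1: "L2_conv ME (\<lambda>n x. ?\<omega> k x *\<^sub>R grad (\<zeta> n) x) (\<lambda>x. ?\<omega> k x *\<^sub>R Z x)"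
      by (rule L2_conv_scaleR[OF cZ mc, where C = 1]) (rule b)
    have c2: "L2_conv ME (\<lambda>n x. ?\<omega> k x *\<^sub>R \<zeta> n x) (\<lambda>x. ?\<omega> k x *\<^sub>R z x)"
      by (rule L2_conv_scaleR[OF cz mc, where C = 1]) (rule b)
    have "(LINT x|ME. G x \<bullet> (?\<omega> k x *\<^sub>R grad (\<zeta> m) x + \<zeta> m x *\<^sub>R grad (?\<omega> k) x)) = - (LINT x|ME. p x * (?\<omega> k x *\<^sub>R \<zeta> m x))" for m
      using weak[OF test_function_mult[OF test_function_cutoff[OF dl_pos[of k]] sm[of m]]] grad_mult[OF smooth_cutoff sm]
      by simp
    moreover have "(\<lambda>m. LINT x|ME. G x \<bullet> (?\<omega> k x *\<^sub>R grad (\<zeta> m) x + \<zeta> m x *\<^sub>R grad (?\<omega> k) x))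
      \<longlonglongrightarrow> (LINT x|ME. G x \<bullet> (?\<omega> k x *\<^sub>R Z x + z x *\<^sub>R grad (?\<omega> k) x))"
      by (intro L2_conv_inner L2_conv_const G L2_conv_add c1 cg)
    moreover have "(\<lambda>m. LINT x|ME. p x * (?\<omega> k x *\<^sub>R \<zeta> m x)) \<longlonglongrightarrow> (LINT x|ME. p x * (?\<omega> k x *\<^sub>R z x))"
      by (intro L2_conv_mult L2_conv_const p c2)
    ultimately show "(LINT x|ME. G x \<bullet> (?\<omega> k x *\<^sub>R Z x + z x *\<^sub>R grad (?\<omega> k) x)) = - (LINT x|ME. p x * (?\<omega> k x *\<^sub>R z x))"
      by (auto intro: LIMSEQ_unique[OF _ tendsto_minus])
  qed
  have "(LINT x|ME. G x \<bullet> (?\<omega> k x *\<^sub>R Z x + z x *\<^sub>R grad (?\<omega> k) x)) =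
     (LINT x|ME. G x \<bullet> (?\<omega> k x *\<^sub>R Z x)) + (LINT x|ME. G x \<bullet> (z x *\<^sub>R grad (?\<omega> k) x))" for k
    unfolding inner_add_right
    by (intro Bochner_Integration.integral_add square_integrable_inner G sub L2_convD(1)[OF cutoff_scaleR_conv[OF s(2)]])
  moreover have "(\<lambda>k. (LINT x|ME. G x \<bullet> (?\<omega> k x *\<^sub>R Z x)) + (LINT x|ME. G x \<bullet> (z x *\<^sub>R grad (?\<omega> k) x))) \<longlonglongrightarrow> (LINT x|ME. G x \<bullet> Z x) + 0"
    by (intro tendsto_add zero_trace_grad_cutoff[OF zt G] L2_conv_inner L2_conv_const G cutoff_scaleR_conv s)
  moreover have "(\<lambda>k. - (LINT x|ME. p x * (?\<omega> k x *\<^sub>R z x))) \<longlonglongrightarrow> - (LINT x|ME. p x * z x)"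
    by (intro tendsto_minus L2_conv_mult L2_conv_const p cutoff_scaleR_conv s)
  ultimately have "(LINT x|ME. G x \<bullet> Z x) + 0 = - (LINT x|ME. p x * z x)"
    unfolding step by (auto intro: LIMSEQ_unique)
  then show ?thesis by simp
qed

end

section \<open>Truncation and the maximum principle\<close>

lemma contraction_of_deriv:
  fixes \<eta> :: "real \<Rightarrow> real"
  assumes "\<And>t. (\<eta> has_real_derivative \<eta>' t) (at t)" "\<And>t. 0 \<le> \<eta>' t" "\<And>t. \<eta>' t \<le> 1"
  shows "\<bar>\<eta> x - \<eta> y\<bar> \<le> \<bar>x - y\<bar>"
proof -
  have "norm (\<eta> x - \<eta> y) \<le> 1 * norm (x - y)"
  proof (rule field_differentiable_bound[of UNIV \<eta> \<eta>'])
    show "(\<eta> has_field_derivative \<eta>' t) (at t within UNIV)" for t using assms(1) by simp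
    show "norm (\<eta>' t) \<le> 1" for t using assms(2,3)[of t] by simp
  qed auto
  then show ?thesis by simp
qed

context trapezoid
begin

text \<open>The content of \<open>has_trace\<close> edge by edge: boundary convergence is stated on
  the parameter interval, with the edge lengths divided out.\<close>

definition approximates ::
  "(nat \<Rightarrow> real^2 \<Rightarrow> real) \<Rightarrow> (real^2 \<Rightarrow> real) \<Rightarrow> (real^2 \<Rightarrow> real^2) \<Rightarrow> (real^2 \<Rightarrow> real) \<Rightarrow> bool" where
  "approximates \<phi> v G \<beta> \<longleftrightarrow> (\<forall>k. smooth (\<phi> k)) \<and> L2_conv ME \<phi> v \<and> L2_conv ME (\<lambda>k. grad (\<phi> k)) G \<and>
     (\<forall>(p, q) \<in> perimeter_edges. L2_conv MI (\<lambda>k t. \<phi> k (linepath p q t)) (\<lambda>t. \<beta> (linepath p q t)))"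

lemma approximatesD:
  assumes "approximates \<phi> v G \<beta>"
  shows "smooth (\<phi> k)" "L2_conv ME \<phi> v" "L2_conv ME (\<lambda>k. grad (\<phi> k)) G"
    "(p, q) \<in> perimeter_edges \<Longrightarrow> L2_conv MI (\<lambda>k t. \<phi> k (linepath p q t)) (\<lambda>t. \<beta> (linepath p q t))"
  using assms by (auto simp: approximates_def)

lemma continuous_edge_square_integrable:
  assumes "continuous_on K (f :: real^2 \<Rightarrow> real)" "(p, q) \<in> perimeter_edges"
  shows "square_integrable MI (\<lambda>t. f (linepath p q t))"
proof -
  have c: "continuous_on {0..1} (\<lambda>t. f (linepath p q t))"
    by (rule continuous_on_compose2[OF assms(1)]) (use edge_mem_K[OF assms(2)] in \<open>auto intro!: continuous_intros\<close>)
  have "(\<lambda>t. f (linepath p q t)) \<in> borel_measurable (restrict_space borel {0..1})"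
    using c by (rule borel_measurable_continuous_on_restrict)
  then have m: "(\<lambda>t. f (linepath p q t)) \<in> borel_measurable MI"
    by (simp add: measurable_cong_sets[OF sets_restrict_space_cong[OF sets_lborel]])
  have "integrable MI (\<lambda>t. (f (linepath p q t))\<^sup>2)"
    using borel_integrable_atLeastAtMost'[of 0 1 "\<lambda>t. (f (linepath p q t))\<^sup>2"] c
    by (simp add: integrable_restrict_space set_integrable_def continuous_on_power)
  with m show ?thesis by (simp add: square_integrable_def)
qed

lemma approximates_of_trace:
  assumes "has_trace verts v \<beta>"
  obtains \<phi> G where "has_weak_gradient E v G" "approximates \<phi> v G \<beta>"
proof -
  obtain G \<phi> where sb: "square_integrable MB \<beta>" and wg: "has_weak_gradient E v G" and sm: "\<And>k. smooth (\<phi> k)"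
    and l1: "(\<lambda>k. \<integral>\<^sup>+x. ennreal ((\<phi> k x - v x)\<^sup>2) \<partial>ME) \<longlonglongrightarrow> 0"
    and l2: "(\<lambda>k. \<integral>\<^sup>+x. ennreal ((norm (grad (\<phi> k) x - G x))\<^sup>2) \<partial>ME) \<longlonglongrightarrow> 0"
    and l3: "(\<lambda>k. \<integral>\<^sup>+x. ennreal ((\<phi> k x - \<beta> x)\<^sup>2) \<partial>MB) \<longlonglongrightarrow> 0"
    using assms by (auto simp: has_trace_def polygon_eq)
  have [measurable]: "\<beta> \<in> borel_measurable borel"
    using square_integrable_measurable[OF sb] measurable_cong_sets[OF sets_boundary_measure refl] by blast
  have [measurable]: "\<phi> k \<in> borel_measurable borel" for k
    using smooth_continuous[OF sm] by (rule borel_measurable_continuous_onI)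
  have "L2_conv MI (\<lambda>k t. \<phi> k (linepath p q t)) (\<lambda>t. \<beta> (linepath p q t))" if e: "(p, q) \<in> perimeter_edges" for p q
  proof (rule L2_convI_nn)
    have d: "dist p q > 0" using edge_dist_pos[OF e] .
    have bound: "(\<integral>\<^sup>+t. ennreal (f (linepath p q t)) \<partial>MI) \<le> ennreal (1 / dist p q) * (\<integral>\<^sup>+x. ennreal (f x) \<partial>MB)"
      if [measurable]: "f \<in> borel_measurable borel" for f
    proof -
      have "(\<integral>\<^sup>+t. ennreal (f (linepath p q t)) \<partial>MI) = ennreal (1 / dist p q) * (ennreal (dist p q) * (\<integral>\<^sup>+t. ennreal (f (linepath p q t)) \<partial>MI))"
        using d by (simp add: mult.assoc[symmetric] ennreal_mult'[symmetric])
      also have "\<dots> \<le> ennreal (1 / dist p q) * (\<integral>\<^sup>+x. ennreal (f x) \<partial>MB)"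
        by (intro mult_left_mono nn_integral_edge_le[OF e]) auto
      finally show ?thesis .
    qed
    show "square_integrable MI (\<lambda>t. \<phi> k (linepath p q t))" for k
      by (rule continuous_edge_square_integrable[OF smooth_continuous[OF sm] e])
    show "square_integrable MI (\<lambda>t. \<beta> (linepath p q t))"
      unfolding square_integrable_def
    proof
      show [measurable]: "(\<lambda>t. \<beta> (linepath p q t)) \<in> borel_measurable MI" by measurable
      have "(\<integral>\<^sup>+x. ennreal ((norm (\<beta> x))\<^sup>2) \<partial>MB) < \<infinity>"
        using square_integrable_integrable[OF sb] by (auto simp: integrable_iff_bounded)
      then have "(\<integral>\<^sup>+t. ennreal ((norm (\<beta> (linepath p q t)))\<^sup>2) \<partial>MI) < \<infinity>"
        by (intro le_less_trans[OF bound]) (auto simp: ennreal_mult_less_top)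
      then show "integrable MI (\<lambda>t. (norm (\<beta> (linepath p q t)))\<^sup>2)"
        by (intro integrableI_bounded) auto
    qed
    show "(\<lambda>k. \<integral>\<^sup>+t. ennreal ((norm (\<phi> k (linepath p q t) - \<beta> (linepath p q t)))\<^sup>2) \<partial>MI) \<longlonglongrightarrow> 0"
    proof (rule tendsto_sandwich[OF always_eventually always_eventually tendsto_const])
      show "\<forall>k. (\<integral>\<^sup>+t. ennreal ((norm (\<phi> k (linepath p q t) - \<beta> (linepath p q t)))\<^sup>2) \<partial>MI)
        \<le> ennreal (1 / dist p q) * (\<integral>\<^sup>+x. ennreal ((\<phi> k x - \<beta> x)\<^sup>2) \<partial>MB)"
        using bound[of "\<lambda>x. (\<phi> _ x - \<beta> x)\<^sup>2"] by simp
      show "(\<lambda>k. ennreal (1 / dist p q) * (\<integral>\<^sup>+x. ennreal ((\<phi> k x - \<beta> x)\<^sup>2) \<partial>MB)) \<longlonglongrightarrow> 0"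
        using ennreal_tendsto_cmult[OF _ l3, of "ennreal (1 / dist p q)"] by simp
    qed simp
  qed
  moreover have "L2_conv ME \<phi> v"
    using l1 wg by (intro L2_convI_nn) (auto simp: has_weak_gradient_def intro: continuous_square_integrable smooth_continuous sm)
  moreover have "L2_conv ME (\<lambda>k. grad (\<phi> k)) G"
    using l2 wg by (intro L2_convI_nn) (auto simp: has_weak_gradient_def intro: continuous_square_integrable smooth_continuous_grad sm)
  ultimately have "approximates \<phi> v G \<beta>" using sm by (auto simp: approximates_def)
  with wg that show thesis by blast
qed

lemma approximates_affine_comb:
  assumes "approximates \<phi> v G \<beta>" "smooth s0"
  shows "approximates (\<lambda>k x. c * \<phi> k x + s0 x) (\<lambda>x. c * v x + s0 x) (\<lambda>x. c *\<^sub>R G x + grad s0 x) (\<lambda>x. c * \<beta> x + s0 x)"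
proof -
  note A = approximatesD[OF assms(1)]
  have g: "grad (\<lambda>x. c * \<phi> k x + s0 x) = (\<lambda>x. c *\<^sub>R grad (\<phi> k) x + grad s0 x)" for k
  proof
    fix x
    have "grad (\<lambda>x. c) x = 0" using grad_affine[of c 0 x] by simp
    then show "grad (\<lambda>x. c * \<phi> k x + s0 x) x = c *\<^sub>R grad (\<phi> k) x + grad s0 x"
      by (simp add: grad_add[OF smooth_mult[OF smooth_const A(1)] assms(2)] grad_mult[OF smooth_const A(1)])
  qed
  have cM: "L2_conv ME (\<lambda>k x. c *\<^sub>R \<phi> k x + s0 x) (\<lambda>x. c *\<^sub>R v x + s0 x)"
    by (intro L2_conv_add L2_conv_const continuous_square_integrable smooth_continuous assms(2) L2_conv_scaleR[OF A(2), where C = "\<bar>c\<bar>"]) auto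
  have cG: "L2_conv ME (\<lambda>k x. c *\<^sub>R grad (\<phi> k) x + grad s0 x) (\<lambda>x. c *\<^sub>R G x + grad s0 x)"
    by (intro L2_conv_add L2_conv_const continuous_square_integrable smooth_continuous_grad assms(2) L2_conv_scaleR[OF A(3), where C = "\<bar>c\<bar>"]) auto
  have cE: "L2_conv MI (\<lambda>k t. c *\<^sub>R \<phi> k (linepath p q t) + s0 (linepath p q t)) (\<lambda>t. c *\<^sub>R \<beta> (linepath p q t) + s0 (linepath p q t))"
    if "(p, q) \<in> perimeter_edges" for p q
    by (intro L2_conv_add L2_conv_const continuous_edge_square_integrable[OF smooth_continuous[OF assms(2)] that]
        L2_conv_scaleR[OF A(4)[OF that], where C = "\<bar>c\<bar>"]) auto
  show ?thesis
    using cM cG cE by (auto simp: approximates_def g intro!: smooth_add smooth_mult smooth_const A(1) assms(2))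
qed

text \<open>The approximants are \<open>\<eta>\<close> composed with the given sequence. Since
  \<open>\<eta>\<close> is a contraction, values and edge values converge, the latter to 0. As
  \<open>\<eta>'\<close> is not assumed Lipschitz, the gradients require a subsequence that
  converges almost everywhere.\<close>

lemma truncation_zero_trace:
  assumes ap: "approximates \<phi> v G \<beta>" and sm: "smooth1 \<eta>"
    and d: "\<And>t. (\<eta> has_real_derivative \<eta>' t) (at t)" and c: "continuous_on UNIV \<eta>'"
    and b: "\<And>t. 0 \<le> \<eta>' t" "\<And>t. \<eta>' t \<le> 1"
    and z: "\<And>p q. (p, q) \<in> perimeter_edges \<Longrightarrow> AE t in MI. \<eta> (\<beta> (linepath p q t)) = 0"
  shows "zero_trace (\<lambda>x. \<eta> (v x)) (\<lambda>x. \<eta>' (v x) *\<^sub>R G x)"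
proof -
  note A = approximatesD[OF ap]
  obtain r :: "nat \<Rightarrow> nat" where r: "strict_mono r" and ae: "AE x in ME. (\<lambda>k. \<phi> (r k) x) \<longlonglongrightarrow> v x"
    using L2_conv_AE_subseq[OF A(2)] .
  define \<psi> where "\<psi> = (\<lambda>k. \<phi> (r k))"
  have s\<psi>: "smooth (\<psi> k)" for k using A(1) by (simp add: \<psi>_def)
  have cv: "L2_conv ME \<psi> v" and cG: "L2_conv ME (\<lambda>k. grad (\<psi> k)) G"
    unfolding \<psi>_def using L2_conv_subseq[OF A(2) r] L2_conv_subseq[OF A(3) r] by auto
  have cE: "L2_conv MI (\<lambda>k t. \<psi> k (linepath p q t)) (\<lambda>t. \<beta> (linepath p q t))" if "(p, q) \<in> perimeter_edges" for p q
    unfolding \<psi>_def using L2_conv_subseq[OF A(4)[OF that] r] by auto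
  have lip: "\<bar>\<eta> x - \<eta> y\<bar> \<le> \<bar>x - y\<bar>" for x y using contraction_of_deriv[OF d b] .
  have [measurable]: "\<eta> \<in> borel_measurable borel" "\<eta>' \<in> borel_measurable borel"
    using smooth1_continuous[OF sm, of UNIV] c by (auto intro: borel_measurable_continuous_onI)
  note [measurable] = square_integrable_measurable[OF L2_convD(1)[OF cv]] square_integrable_measurable[OF L2_convD(2)[OF cv]]
    square_integrable_measurable[OF L2_convD(1)[OF cG]] square_integrable_measurable[OF L2_convD(2)[OF cG]]
  have \<eta>sq: "square_integrable N (\<lambda>x. \<eta> (f x))" if "square_integrable N f" "finite_measure N" for N and f :: "'c \<Rightarrow> real"
  proof -
    interpret finite_measure N by fact
    note [measurable] = square_integrable_measurable[OF that(1)]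
    have "square_integrable N (\<lambda>x. \<eta> (f x) - \<eta> 0)"
      by (rule square_integrable_bound[OF that(1), where c = 1]) (use lip[of _ 0] in auto)
    moreover have "square_integrable N (\<lambda>x. \<eta> 0)" by (simp add: square_integrable_def)
    ultimately show ?thesis using square_integrable_add by fastforce
  qed
  have 1: "L2_conv ME (\<lambda>k x. \<eta> (\<psi> k x)) (\<lambda>x. \<eta> (v x))"
    by (rule L2_conv_bound[OF cv _ \<eta>sq[OF L2_convD(2)[OF cv] finite_ME], where c = 1]) (use lip in auto)
  have 2: "L2_conv ME (\<lambda>k. grad (\<lambda>x. \<eta> (\<psi> k x))) (\<lambda>x. \<eta>' (v x) *\<^sub>R G x)"
  proof -
    \<comment> \<open>The first summand tends to 0 because \<open>\<eta>'\<close> is bounded; in the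
      second the gradient is frozen at \<open>G\<close>, so dominated convergence applies.\<close>
    have g: "grad (\<lambda>x. \<eta> (\<psi> k x)) x = \<eta>' (\<psi> k x) *\<^sub>R (grad (\<psi> k) x - G x) + \<eta>' (\<psi> k x) *\<^sub>R G x" for k x
      using grad_comp[OF d s\<psi>] by (simp add: scaleR_diff_right)
    have b': "\<bar>\<eta>' t\<bar> \<le> 1" for t using b[of t] by simp
    have "L2_conv ME (\<lambda>k x. \<eta>' (\<psi> k x) *\<^sub>R (grad (\<psi> k) x - G x)) (\<lambda>x. 0)"
      by (rule L2_conv_bound[OF cG, where c = 1]) (use b' in \<open>auto simp: square_integrable_def intro!: AE_I2 mult_left_le_one_le\<close>)
    moreover have "L2_conv ME (\<lambda>k x. \<eta>' (\<psi> k x) *\<^sub>R G x) (\<lambda>x. \<eta>' (v x) *\<^sub>R G x)"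
    proof (rule L2_conv_dominated[OF L2_convD(2)[OF cG], where C = 1])
      show "AE x in ME. (\<lambda>k. \<eta>' (\<psi> k x)) \<longlonglongrightarrow> \<eta>' (v x)"
        using ae
      proof eventually_elim
        case (elim x)
        have "isCont \<eta>' (v x)" using c by (simp add: continuous_on_eq_continuous_at)
        then show ?case using elim by (auto simp: \<psi>_def intro: isCont_tendsto_compose)
      qed
    qed (use b' in auto)
    ultimately have "L2_conv ME (\<lambda>k x. \<eta>' (\<psi> k x) *\<^sub>R (grad (\<psi> k) x - G x) + \<eta>' (\<psi> k x) *\<^sub>R G x) (\<lambda>x. 0 + \<eta>' (v x) *\<^sub>R G x)"
      by (rule L2_conv_add)
    then show ?thesis by (simp add: g[abs_def])
  qed
  have 3: "(\<lambda>k. edge_integral p q (\<lambda>x. (\<eta> (\<psi> k x))\<^sup>2)) \<longlonglongrightarrow> 0" if e: "(p, q) \<in> perimeter_edges" for p q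
  proof -
    note [measurable] = square_integrable_measurable[OF L2_convD(1)[OF cE[OF e]]]
    have "L2_conv MI (\<lambda>k t. \<eta> (\<psi> k (linepath p q t))) (\<lambda>t. \<eta> (\<beta> (linepath p q t)))"
      by (rule L2_conv_bound[OF cE[OF e] _ \<eta>sq[OF L2_convD(2)[OF cE[OF e]] finite_MI], where c = 1]) (use lip in auto)
    from L2_conv_mult[OF this this]
    have "(\<lambda>k. LINT t|MI. (\<eta> (\<psi> k (linepath p q t)))\<^sup>2) \<longlonglongrightarrow> (LINT t|MI. (\<eta> (\<beta> (linepath p q t)))\<^sup>2)"
      by (simp add: power2_eq_square)
    also have "(LINT t|MI. (\<eta> (\<beta> (linepath p q t)))\<^sup>2) = 0"
      using z[OF e] by (intro integral_eq_zero_AE) (auto elim: eventually_mono)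
    also have "(\<lambda>k. LINT t|MI. (\<eta> (\<psi> k (linepath p q t)))\<^sup>2) = (\<lambda>k. edge_integral p q (\<lambda>x. (\<eta> (\<psi> k x))\<^sup>2))"
      by (intro ext edge_integral_eq_MI[OF _ e, symmetric] continuous_on_power smooth_continuous[OF smooth_comp[OF sm s\<psi>]])
    finally show ?thesis .
  qed
  show ?thesis
    unfolding zero_trace_def
    by (rule exI[of _ "\<lambda>k x. \<eta> (\<psi> k x)"]) (use 1 2 3 in \<open>auto intro: smooth_comp[OF sm s\<psi>]\<close>)
qed

lemma edge_not_in_E: "(p, q) \<in> perimeter_edges \<Longrightarrow> linepath p q t \<notin> E"
proof -
  have "linepath vc vd t = linepath vd vc (1 - t)" "linepath vd a t = linepath a vd (1 - t)"
    by (simp_all add: linepath_def)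
  then show "(p, q) \<in> perimeter_edges \<Longrightarrow> linepath p q t \<notin> E"
    by (auto simp: perimeter_edges_def edge_points E_pt)
qed

text \<open>The edges lie outside \<open>E\<close>, so the boundary terms of the divergence theorem
  are 0.\<close>

lemma integral_grad_test_function:
  assumes "test_function E \<phi>"
  shows "(LINT x|ME. grad \<phi> x \<bullet> w) = 0"
proof -
  have sm: "smooth \<phi>" using assms by (simp add: test_function_def)
  have z: "edge_integral p q \<phi> = 0" if "(p, q) \<in> perimeter_edges" for p q
  proof -
    have "\<phi> (linepath p q t) = 0" for t
      using assms edge_not_in_E[OF that, of t] closure_subset[of "{x. \<phi> x \<noteq> 0}"] by (auto simp: test_function_def)
    then show ?thesis by (simp add: edge_integral_def)
  qed
  have int: "integrable ME (\<lambda>x. grad \<phi> x \<bullet> w)" for w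
    by (intro continuous_integrable continuous_intros smooth_continuous_grad sm)
  have "(LINT x|ME. grad \<phi> x \<bullet> u) = 0" "(LINT x|ME. grad \<phi> x \<bullet> leg) = 0"
    using divergence_theorem[of \<phi> "grad \<phi>", OF smooth_has_derivative[OF sm] smooth_continuous_grad[OF sm]]
    by (simp_all add: z perimeter_edges_def)
  then show ?thesis
    by (subst direction_expansion) (simp add: inner_add_right int)
qed

text \<open>A quadratic function of \<open>al\<close> alone with Laplacian -1. On \<open>K\<close>
  it takes values between 0 and half of W^2, because \<open>al\<close> ranges over an interval of
  length \<open>em\<close>.\<close>

definition barrier :: "real^2 \<Rightarrow> real" where
  "barrier x = (em\<^sup>2 - (al x)\<^sup>2) / (2 * (norm m_al)\<^sup>2)"

lemma smooth_al: "smooth al"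
  unfolding al_def[abs_def] by (rule smooth_affine)

lemma grad_al: "grad al x = m_al"
  unfolding al_def[abs_def] by (rule grad_affine)

lemma barrier_eq: "barrier = (\<lambda>x. em\<^sup>2 / (2 * (norm m_al)\<^sup>2) + (- 1 / (2 * (norm m_al)\<^sup>2)) * (al x * al x))"
  by (auto simp: barrier_def power2_eq_square diff_divide_distrib)

lemma smooth_barrier: "smooth barrier"
  unfolding barrier_eq by (intro smooth_add smooth_mult smooth_const smooth_al)

lemma grad_barrier: "grad barrier x = (- al x / (norm m_al)\<^sup>2) *\<^sub>R m_al"
proof -
  have c: "grad (\<lambda>x. k) x = 0" for k x using grad_affine[of k 0 x] by simp
  show ?thesis
    unfolding barrier_eq grad_add[OF smooth_const smooth_mult[OF smooth_const smooth_mult[OF smooth_al smooth_al]]]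
      grad_mult[OF smooth_const smooth_mult[OF smooth_al smooth_al]] grad_mult[OF smooth_al smooth_al] c grad_al
    by (simp add: scaleR_add_left[symmetric] del: scaleR_left.add)
qed

lemma barrier_bounds:
  assumes "x \<in> K"
  shows "0 \<le> barrier x" "barrier x \<le> W\<^sup>2 / 2"
proof -
  have "(al x)\<^sup>2 \<le> em\<^sup>2" using al_bounds[OF assms] by (intro power_mono) auto
  then show "0 \<le> barrier x" by (simp add: barrier_def)
  show "barrier x \<le> W\<^sup>2 / 2"
    by (simp add: barrier_def W_def power_divide divide_right_mono mult.commute)
qed

text \<open>The gradient of \<open>\<phi> * al\<close> has mean 0 since the product is again a test
  function; the product rule then moves the derivative from \<open>\<phi>\<close> to
  \<open>al\<close>.\<close>

lemma barrier_laplacian: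
  assumes "test_function E \<phi>"
  shows "(LINT x|ME. grad barrier x \<bullet> grad \<phi> x) = (LINT x|ME. \<phi> x)"
proof -
  have sm: "smooth \<phi>" using assms by (simp add: test_function_def)
  have i1: "integrable ME (\<lambda>x. \<phi> x)" and i2: "integrable ME (\<lambda>x. al x * (grad \<phi> x \<bullet> m_al))"
    by (intro continuous_integrable continuous_intros smooth_continuous_grad smooth_continuous sm continuous_al)+
  have "0 = (LINT x|ME. grad (\<lambda>x. \<phi> x * al x) x \<bullet> m_al)"
    using integral_grad_test_function[OF test_function_mult[OF assms smooth_al]] by simp
  also have "\<dots> = (LINT x|ME. (norm m_al)\<^sup>2 * \<phi> x + al x * (grad \<phi> x \<bullet> m_al))"
    by (intro Bochner_Integration.integral_cong refl) (simp add: grad_mult sm smooth_al grad_al inner_add_left power2_norm_eq_inner)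
  also have "\<dots> = (norm m_al)\<^sup>2 * (LINT x|ME. \<phi> x) + (LINT x|ME. al x * (grad \<phi> x \<bullet> m_al))"
    using i1 i2 by simp
  finally have e: "(LINT x|ME. al x * (grad \<phi> x \<bullet> m_al)) = - (norm m_al)\<^sup>2 * (LINT x|ME. \<phi> x)" by simp
  have "(LINT x|ME. grad barrier x \<bullet> grad \<phi> x) = (LINT x|ME. (- 1 / (norm m_al)\<^sup>2) * (al x * (grad \<phi> x \<bullet> m_al)))"
    by (intro Bochner_Integration.integral_cong refl) (simp add: grad_barrier inner_commute)
  also have "\<dots> = (LINT x|ME. \<phi> x)"
    using m_nonzero by (subst Bochner_Integration.integral_mult_right_zero, subst e) simp
  finally show ?thesis .
qed

text \<open>\<open>U\<close>, which is \<open>v - P * barrier - M\<close>, has Laplacian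
  \<open>p + P \<ge> 0\<close> and is nonpositive on the boundary. Testing with
  \<open>ramp U\<close> shows that the gradient of \<open>ramp U\<close> vanishes, and by Poincare
  so does \<open>ramp U\<close> itself.\<close>

lemma maximum_principle:
  assumes ap: "approximates \<phi> v G \<beta>" and p: "continuous_on K p" "\<And>x. x \<in> K \<Longrightarrow> - P \<le> p x" and P: "P \<ge> 0"
    and weak: "\<And>\<phi>. test_function E \<phi> \<Longrightarrow> (LINT x|ME. G x \<bullet> grad \<phi> x) = - (LINT x|ME. p x * \<phi> x)"
    and bd: "\<And>p q. (p, q) \<in> perimeter_edges \<Longrightarrow> AE t in MI. \<beta> (linepath p q t) \<le> M"
  shows "AE x in ME. v x \<le> M + P * W\<^sup>2 / 2"
proof -
  define s0 where "s0 = (\<lambda>x. - P * barrier x - M)"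
  have s0: "smooth s0" unfolding s0_def by (intro smooth_diff smooth_mult smooth_const smooth_barrier)
  have gs0: "grad s0 x = - P *\<^sub>R grad barrier x" for x
  proof -
    have c: "grad (\<lambda>x. k) x = 0" for k x using grad_affine[of k 0 x] by simp
    show ?thesis
      unfolding s0_def grad_diff[OF smooth_mult[OF smooth_const smooth_barrier] smooth_const] grad_mult[OF smooth_const smooth_barrier] c by simp
  qed
  have ap': "approximates (\<lambda>k x. 1 * \<phi> k x + s0 x) (\<lambda>x. 1 * v x + s0 x) (\<lambda>x. 1 *\<^sub>R G x + grad s0 x) (\<lambda>x. 1 * \<beta> x + s0 x)"
    by (rule approximates_affine_comb[OF ap s0])
  define U where "U = (\<lambda>x. v x + s0 x)"
  define H where "H = (\<lambda>x. G x + grad s0 x)"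
  have zt: "zero_trace (\<lambda>x. ramp (U x)) (\<lambda>x. ramp' (U x) *\<^sub>R H x)"
  proof -
    have "zero_trace (\<lambda>x. ramp (1 * v x + s0 x)) (\<lambda>x. ramp' (1 * v x + s0 x) *\<^sub>R (1 *\<^sub>R G x + grad s0 x))"
    proof (rule truncation_zero_trace[OF ap' smooth1_ramp ramp_deriv continuous_ramp' ramp'_nonneg ramp'_le_1])
      fix p q assume e: "(p, q) \<in> perimeter_edges"
      have "AE t in MI. t \<in> space MI" by (rule AE_space)
      then show "AE t in MI. ramp (1 * \<beta> (linepath p q t) + s0 (linepath p q t)) = 0"
        using bd[OF e]
      proof eventually_elim
        case (elim t)
        then have "linepath p q t \<in> K" using edge_mem_K[OF e] by (simp add: space_restrict_space)
        then have "0 \<le> P * barrier (linepath p q t)" using barrier_bounds(1) P by simp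
        then show ?case using elim by (simp add: ramp_eq_0 s0_def)
      qed
    qed
    then show ?thesis by (simp add: U_def H_def)
  qed
  note s = zero_traceD[OF zt]
  have sG: "square_integrable ME G" using approximatesD(3)[OF ap] L2_convD(2) by blast
  have sH: "square_integrable ME H"
    unfolding H_def by (intro square_integrable_add sG continuous_square_integrable smooth_continuous_grad s0)
  have sp: "square_integrable ME (\<lambda>x. p x + P)"
    by (intro continuous_square_integrable continuous_intros p)
  have weakH: "(LINT x|ME. H x \<bullet> grad \<psi> x) = - (LINT x|ME. (p x + P) * \<psi> x)" if "test_function E \<psi>" for \<psi>
  proof -
    have sm: "smooth \<psi>" using that by (simp add: test_function_def)
    have sg: "square_integrable ME (grad \<psi>)" by (intro continuous_square_integrable smooth_continuous_grad sm)
    have "(LINT x|ME. H x \<bullet> grad \<psi> x) = (LINT x|ME. G x \<bullet> grad \<psi> x + (- P) * (grad barrier x \<bullet> grad \<psi> x))"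
      by (simp add: H_def gs0 inner_add_left inner_diff_left)
    also have "\<dots> = (LINT x|ME. G x \<bullet> grad \<psi> x) + (- P) * (LINT x|ME. grad barrier x \<bullet> grad \<psi> x)"
      using square_integrable_inner[OF sG sg]
        square_integrable_inner[OF continuous_square_integrable[OF smooth_continuous_grad[OF smooth_barrier]] sg] by simp
    also have "\<dots> = - ((LINT x|ME. p x * \<psi> x) + P * (LINT x|ME. \<psi> x))"
      using weak[OF that] barrier_laplacian[OF that] by simp
    also have "(LINT x|ME. p x * \<psi> x) + P * (LINT x|ME. \<psi> x) = (LINT x|ME. (p x + P) * \<psi> x)"
      by (simp add: distrib_right continuous_integrable continuous_on_mult smooth_continuous[OF sm] p)
    finally show ?thesis .
  qed
  have "(LINT x|ME. (norm (ramp' (U x) *\<^sub>R H x))\<^sup>2) \<le> (LINT x|ME. H x \<bullet> (ramp' (U x) *\<^sub>R H x))"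
  proof (rule integral_mono)
    fix x
    \<comment> \<open>A number between 0 and 1 dominates its square, so the pairing with
      \<open>H\<close> controls the whole energy of the truncated function.\<close>
    have "(ramp' (U x))\<^sup>2 \<le> ramp' (U x)"
      using ramp'_nonneg[of "U x"] ramp'_le_1[of "U x"] by (simp add: power2_eq_square mult_left_le)
    then show "(norm (ramp' (U x) *\<^sub>R H x))\<^sup>2 \<le> H x \<bullet> (ramp' (U x) *\<^sub>R H x)"
      by (simp add: power_mult_distrib power2_norm_eq_inner[symmetric] mult_right_mono)
  qed (use square_integrable_integrable[OF s(2)] square_integrable_inner[OF sH s(2)] in auto)
  also have "\<dots> = - (LINT x|ME. (p x + P) * ramp (U x))"
    by (rule zero_trace_test[OF zt sH sp weakH])
  also have "\<dots> \<le> 0"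
  proof -
    have "p x + P \<ge> 0" if "x \<in> E" for x using p(2)[of x] E_subset_K that by force
    then have "0 \<le> (LINT x|ME. (p x + P) * ramp (U x))"
      by (intro integral_nonneg_AE) (auto intro!: AE_I2 mult_nonneg_nonneg ramp_bounds(3))
    then show ?thesis by simp
  qed
  finally have "(LINT x|ME. (norm (ramp' (U x) *\<^sub>R H x))\<^sup>2) \<le> 0" .
  then have "4 * W\<^sup>2 * (LINT x|ME. (norm (ramp' (U x) *\<^sub>R H x))\<^sup>2) \<le> 0"
    using W_pos by (simp add: mult_nonneg_nonpos)
  with poincare[OF zt] have "(LINT x|ME. (ramp (U x))\<^sup>2) \<le> 0" by linarith
  moreover have "0 \<le> (LINT x|ME. (ramp (U x))\<^sup>2)" by simp
  ultimately have "(LINT x|ME. (ramp (U x))\<^sup>2) = 0" by linarith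
  then have "AE x in ME. (ramp (U x))\<^sup>2 = 0"
    using square_integrable_integrable_real[OF s(1)] by (subst (asm) integral_nonneg_eq_0_iff_AE) auto
  moreover have "AE x in ME. x \<in> space ME" by (rule AE_space)
  ultimately show ?thesis
  proof eventually_elim
    case (elim x)
    then have "v x \<le> M + P * barrier x" by (simp add: ramp_eq_0 U_def s0_def)
    also have "P * barrier x \<le> P * (W\<^sup>2 / 2)"
      using elim E_subset_K by (intro mult_left_mono barrier_bounds P) auto
    finally show ?case by simp
  qed
qed

end

section \<open>Uniqueness of traces\<close>

text \<open>The truncation written theta in the overview; in the proofs below
  \<open>\<theta>\<close> is the projection. The threshold contributes an error M and the inequality
  \<open>t - 1 \<le> ramp t\<close>, scaled by M, another one; hence the 2 M in
  \<open>excess_error\<close>.\<close>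

definition excess :: "real \<Rightarrow> real \<Rightarrow> real" where
  "excess M t = M * ramp (-1 + (1 / M) * t) - M * ramp (-1 + (- 1 / M) * t)"
definition excess' :: "real \<Rightarrow> real \<Rightarrow> real" where
  "excess' M t = ramp' (-1 + (1 / M) * t) + ramp' (-1 + (- 1 / M) * t)"

lemma smooth1_excess: "smooth1 (excess M)"
proof -
  have "excess M = (\<lambda>t. M * ramp (-1 + (1 / M) * t) + (- M) * ramp (-1 + (- 1 / M) * t))"
    by (auto simp: excess_def)
  moreover have "smooth1 (\<lambda>t. M * ramp (-1 + (1 / M) * t) + (- M) * ramp (-1 + (- 1 / M) * t))"
    by (intro smooth1_add smooth1_mult smooth1_const smooth1_comp_affine[OF smooth1_ramp])
  ultimately show ?thesis by simp
qed

lemma excess_deriv: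
  assumes "M > 0"
  shows "(excess M has_real_derivative excess' M t) (at t)"
proof -
  have d: "((\<lambda>t. ramp (-1 + c * t)) has_real_derivative ramp' (-1 + c * t) * c) (at t)" for c
    by (rule DERIV_chain2[OF ramp_deriv]) (auto intro!: derivative_eq_intros)
  have "(excess M has_real_derivative M * (ramp' (-1 + (1 / M) * t) * (1 / M)) - M * (ramp' (-1 + (- 1 / M) * t) * (- 1 / M))) (at t)"
    unfolding excess_def[abs_def] by (intro DERIV_diff DERIV_cmult d)
  then show ?thesis using assms by (simp add: excess'_def)
qed

lemma continuous_excess': "continuous_on S (excess' M)"
  unfolding excess'_def[abs_def]
  by (intro continuous_intros continuous_on_compose2[OF continuous_ramp'[of UNIV]]) auto

lemma ramp'_neg: "t \<le> 0 \<Longrightarrow> ramp' t = 0"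
  by (simp add: ramp'_def flat_exp_def)

text \<open>For either sign of \<open>t\<close> only one of the two ramps is active.\<close>

lemma excess'_bounds:
  assumes "M > 0"
  shows "0 \<le> excess' M t" "excess' M t \<le> 1"
proof -
  show "0 \<le> excess' M t" by (simp add: excess'_def ramp'_nonneg)
  show "excess' M t \<le> 1"
  proof (cases "t \<ge> 0")
    case True
    then have "-1 + (- 1 / M) * t \<le> 0" using assms by (simp add: field_simps)
    then show ?thesis using ramp'_le_1 by (simp add: excess'_def ramp'_neg)
  next
    case False
    then have "-1 + (1 / M) * t \<le> 0" using assms by (simp add: field_simps)
    then show ?thesis using ramp'_le_1 by (simp add: excess'_def ramp'_neg)
  qed
qed

lemma excess_zero:
  assumes "M > 0" "\<bar>t\<bar> \<le> M"
  shows "excess M t = 0"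
proof -
  have "-1 + (1 / M) * t \<le> 0" "-1 + (- 1 / M) * t \<le> 0" using assms by (auto simp: field_simps)
  then show ?thesis by (simp add: excess_def iffD2[OF ramp_eq_0])
qed

lemma excess_error:
  assumes M: "M > 0"
  shows "\<bar>t - excess M t\<bar> \<le> 2 * M"
proof -
  have *: "t - M * ramp (-1 + (1 / M) * t) \<le> 2 * M" "0 \<le> t - M * ramp (-1 + (1 / M) * t)" if "t > M" for t
  proof -
    let ?r = "-1 + (1 / M) * t"
    have r: "?r > 0" using that M by (simp add: field_simps)
    have "M * (?r - 1) \<le> M * ramp ?r" "M * ramp ?r \<le> M * ?r"
      using ramp_bounds[of ?r] r M by (auto intro: mult_left_mono)
    moreover have "M * (?r - 1) = t - 2 * M" "M * ?r = t - M" using M by (auto simp: field_simps)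
    ultimately show "t - M * ramp ?r \<le> 2 * M" "0 \<le> t - M * ramp ?r" using M by linarith+
  qed
  consider "\<bar>t\<bar> \<le> M" | "t > M" | "- t > M" by linarith
  then show ?thesis
  proof cases
    case 1
    then show ?thesis using excess_zero[OF M 1] M by simp
  next
    case 2
    then have "-1 + (- 1 / M) * t \<le> 0" using M by (simp add: field_simps)
    then have "excess M t = M * ramp (-1 + (1 / M) * t)" by (simp add: excess_def iffD2[OF ramp_eq_0])
    then show ?thesis using *[OF 2] by simp
  next
    case 3
    then have "-1 + (1 / M) * t \<le> 0" using M by (simp add: field_simps)
    then have "excess M t = - (M * ramp (-1 + (1 / M) * (- t)))" by (simp add: excess_def iffD2[OF ramp_eq_0])
    then show ?thesis using *[OF 3] by simp
  qed
qed

context trapezoid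
begin

lemma approximates_diff:
  assumes "approximates \<phi> v G \<beta>" "approximates \<phi>' v' G' \<beta>'"
  shows "approximates (\<lambda>k x. \<phi> k x - \<phi>' k x) (\<lambda>x. v x - v' x) (\<lambda>x. G x - G' x) (\<lambda>x. \<beta> x - \<beta>' x)"
proof -
  note A = approximatesD[OF assms(1)] and B = approximatesD[OF assms(2)]
  have g: "grad (\<lambda>x. \<phi> k x - \<phi>' k x) = (\<lambda>x. grad (\<phi> k) x - grad (\<phi>' k) x)" for k
    using grad_diff[OF A(1) B(1)] by auto
  show ?thesis
    unfolding approximates_def g
    using L2_conv_diff[OF A(2) B(2)] L2_conv_diff[OF A(3) B(3)] L2_conv_diff[OF A(4) B(4)] smooth_diff[OF A(1) B(1)]
    by auto
qed

text \<open>Every volume term contains a factor \<open>\<psi> k\<close>, which tends to 0 in L2,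
  while the gradients stay bounded in L2 because they converge. This needs no knowledge that the
  limit \<open>G\<close> is 0.\<close>

lemma divergence_limit:
  assumes ap: "approximates \<psi> (\<lambda>x. 0) G \<beta>" and g: "g = (\<lambda>x. c + m \<bullet> x)"
  shows "(\<lambda>k. edge_integral vb vc (\<lambda>x. g x * (\<psi> k x)\<^sup>2) - edge_integral vd a (\<lambda>x. g x * (\<psi> k x)\<^sup>2)) \<longlonglongrightarrow> 0" (is ?th1)
    and "(\<lambda>k. e2 * edge_integral vc vd (\<lambda>x. g x * (\<psi> k x)\<^sup>2) - e1 * edge_integral a vb (\<lambda>x. g x * (\<psi> k x)\<^sup>2)
      - (e2 - e1) * edge_integral vb vc (\<lambda>x. g x * (\<psi> k x)\<^sup>2)) \<longlonglongrightarrow> 0" (is ?th2)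
proof -
  note A = approximatesD[OF ap]
  note sc = smooth_continuous[OF A(1)] smooth_continuous_grad[OF A(1)]
  have sg: "smooth g" and gg: "grad g x = m" for x unfolding g by (rule smooth_affine, rule grad_affine)
  have gc: "continuous_on S g" for S using smooth_continuous[OF sg] .
  obtain C where C: "\<And>x. x \<in> K \<Longrightarrow> norm (2 * g x) \<le> C"
    using K_bounded[OF continuous_on_mult[OF continuous_on_const gc]] by blast
  let ?f = "\<lambda>k x. g x * (\<psi> k x * \<psi> k x)"
  have sf: "smooth (?f k)" for k by (rule smooth_mult[OF sg smooth_mult[OF A(1) A(1)]])
  have gf: "grad (?f k) x = (\<psi> k x)\<^sup>2 *\<^sub>R m + (2 * g x * \<psi> k x) *\<^sub>R grad (\<psi> k) x" for k x
    unfolding grad_mult[OF sg smooth_mult[OF A(1) A(1)]] grad_mult[OF A(1) A(1)] gg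
    by (simp add: power2_eq_square scaleR_add_left[symmetric] del: scaleR_left.add)
  have lim: "(\<lambda>k. LINT x|ME. grad (?f k) x \<bullet> w) \<longlonglongrightarrow> 0" for w
  proof -
    have 1: "(\<lambda>k. LINT x|ME. \<psi> k x * ((m \<bullet> w) *\<^sub>R \<psi> k x)) \<longlonglongrightarrow> (LINT x|ME. 0 * ((m \<bullet> w) *\<^sub>R 0))"
      by (intro L2_conv_mult A(2) L2_conv_scaleR[OF A(2), where C = "\<bar>m \<bullet> w\<bar>"]) auto
    have 2: "(\<lambda>k. LINT x|ME. (2 * g x) *\<^sub>R \<psi> k x * (grad (\<psi> k) x \<bullet> w)) \<longlonglongrightarrow> (LINT x|ME. (2 * g x) *\<^sub>R 0 * (G x \<bullet> w))"
      using C E_subset_K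
      by (intro L2_conv_mult L2_conv_inner_const A(3) L2_conv_scaleR[OF A(2), where C = C] K_measurable continuous_intros gc) auto
    have "(LINT x|ME. grad (?f k) x \<bullet> w) = (LINT x|ME. \<psi> k x * ((m \<bullet> w) *\<^sub>R \<psi> k x)) + (LINT x|ME. (2 * g x) *\<^sub>R \<psi> k x * (grad (\<psi> k) x \<bullet> w))" for k
      by (subst Bochner_Integration.integral_add[symmetric])
        (auto intro!: continuous_integrable continuous_intros sc gc Bochner_Integration.integral_cong
          simp: gf inner_add_left power2_eq_square algebra_simps)
    then show ?thesis using tendsto_add[OF 1 2] by simp
  qed
  have div: "(LINT x|ME. grad (?f k) x \<bullet> u) = h * (edge_integral vb vc (?f k) - edge_integral vd a (?f k))"
    "(LINT x|ME. grad (?f k) x \<bullet> leg) = h * (e2 * edge_integral vc vd (?f k) - e1 * edge_integral a vb (?f k) - (e2 - e1) * edge_integral vb vc (?f k))" for k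
    by (rule divergence_theorem[OF smooth_has_derivative[OF sf] smooth_continuous_grad[OF sf]])+
  show ?th1 using tendsto_mult[OF tendsto_const[of "1 / h"] lim[of u]] h_pos unfolding div by (simp add: power2_eq_square)
  show ?th2 using tendsto_mult[OF tendsto_const[of "1 / h"] lim[of leg]] h_pos unfolding div by (simp add: power2_eq_square)
qed

lemma edge_integral_scaled:
  assumes "(p, q) \<in> perimeter_edges" "\<And>t. t \<in> {0..1} \<Longrightarrow> g (linepath p q t) = r"
  shows "edge_integral p q (\<lambda>x. g x * f x) = r * edge_integral p q f"
proof -
  have "edge_integral p q (\<lambda>x. g x * f x) = integral {0..1} (\<lambda>t. r * f (linepath p q t))"
    unfolding edge_integral_def by (rule integral_cong) (simp add: assms(2))
  then show ?thesis by (simp add: edge_integral_def)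
qed

text \<open>No regularity of \<open>f\<close> is required: without integrability the integral is 0
  by convention.\<close>

lemma edge_integral_sq_nonneg: "0 \<le> edge_integral p q (\<lambda>x. (f x)\<^sup>2)"
proof (cases "(\<lambda>t. (f (linepath p q t))\<^sup>2) integrable_on {0..1}")
  case True
  then show ?thesis unfolding edge_integral_def by (rule Henstock_Kurzweil_Integration.integral_nonneg) simp
qed (simp add: edge_integral_def not_integrable_integral)

lemma edge_integral_lower:
  assumes e: "(p, q) \<in> perimeter_edges" and g: "continuous_on K g" and f: "continuous_on K f"
    and r: "\<And>t. t \<in> {0..1} \<Longrightarrow> r \<le> g (linepath p q t)"
  shows "r * edge_integral p q (\<lambda>x. (f x)\<^sup>2) \<le> edge_integral p q (\<lambda>x. g x * (f x)\<^sup>2)"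
proof -
  have c: "continuous_on {0..1} (\<lambda>t. F (linepath p q t))" if "continuous_on K F" for F :: "real^2 \<Rightarrow> real"
    by (rule continuous_on_compose2[OF that]) (use edge_mem_K[OF e] in \<open>auto intro!: continuous_intros\<close>)
  have "integral {0..1} (\<lambda>t. r * (f (linepath p q t))\<^sup>2) \<le> integral {0..1} (\<lambda>t. g (linepath p q t) * (f (linepath p q t))\<^sup>2)"
    by (rule integral_le) (auto intro!: integrable_continuous_real continuous_intros c f g mult_right_mono r)
  then show ?thesis by (simp add: edge_integral_def)
qed

lemma edge_coords:
  "ga (linepath a vb t) = 0" "al (linepath a vd t) = 0" "al (linepath vd a t) = 0"
  "ga (linepath vb vc t) = t" "al (linepath vb vc t) = wd t" "ga (linepath vc vd t) = 1" "ga (linepath vd a t) = 1 - t"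
proof -
  have r: "linepath vc vd t = linepath vd vc (1 - t)" "linepath vd a t = linepath a vd (1 - t)" for t
    by (simp_all add: linepath_def)
  show "ga (linepath a vb t) = 0" "al (linepath a vd t) = 0" "al (linepath vd a t) = 0"
  "ga (linepath vb vc t) = t" "al (linepath vb vc t) = wd t" "ga (linepath vc vd t) = 1" "ga (linepath vd a t) = 1 - t"
    by (simp_all add: r edge_points)
qed

lemma al_fun: "al = (\<lambda>x. - (m_al \<bullet> a) + m_al \<bullet> x)" and ga_fun: "ga = (\<lambda>x. - (m_ga \<bullet> a) + m_ga \<bullet> x)"
  by (auto simp: al_def ga_def)

lemma wd_lower: "0 \<le> y \<Longrightarrow> y \<le> 1 \<Longrightarrow> min e1 e2 \<le> wd y"
proof -
  assume y: "0 \<le> y" "y \<le> 1"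
  have "(1 - y) * min e1 e2 + y * min e1 e2 \<le> wd y"
    unfolding wd_def using y by (intro add_mono mult_left_mono) auto
  then show "min e1 e2 \<le> wd y" by (simp add: algebra_simps)
qed

text \<open>
  The divergence theorem is applied to \<open>g \<psi>\<^sup>2\<close>, with an affine \<open>g\<close> that vanishes on one side, which
  isolates the sides one after the other.
\<close>

lemma zero_limit_trace:
  assumes ap: "approximates \<psi> (\<lambda>x. 0) G \<beta>" and e: "(p, q) \<in> perimeter_edges"
  shows "AE t in MI. \<beta> (linepath p q t) = 0"
proof -
  note A = approximatesD[OF ap]
  note sc = smooth_continuous[OF A(1)]
  let ?I = "\<lambda>p q k. edge_integral p q (\<lambda>x. (\<psi> k x)\<^sup>2)"
  have mem: "(a, vb) \<in> perimeter_edges" "(vb, vc) \<in> perimeter_edges" "(vc, vd) \<in> perimeter_edges" "(vd, a) \<in> perimeter_edges"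
    by (auto simp: perimeter_edges_def)
  define r where "r = min e1 e2"
  have r: "r > 0" using e1_pos e2_pos by (simp add: r_def)
  have squeeze: "f \<longlonglongrightarrow> 0" if "\<And>k. 0 \<le> f k" "\<And>k. r * f k \<le> F k" "F \<longlonglongrightarrow> 0" for f F :: "nat \<Rightarrow> real"
  proof (rule tendsto_sandwich[OF always_eventually always_eventually tendsto_const])
    show "\<forall>k. f k \<le> F k / r" using that(2) r by (simp add: field_simps)
    show "(\<lambda>k. F k / r) \<longlonglongrightarrow> 0" using tendsto_divide[OF that(3) tendsto_const[of r]] r by simp
  qed (use that in simp)
  have BC: "?I vb vc \<longlonglongrightarrow> 0"
  proof (rule squeeze)
    \<comment> \<open>\<open>al\<close> vanishes on the leg \<open>vd a\<close> and equals
      \<open>wd\<close>, which is at least \<open>min e1 e2\<close>, on the leg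
      \<open>vb vc\<close>; so the difference of the two legs reduces to the latter.\<close>
    have z: "edge_integral vd a (\<lambda>x. al x * (\<psi> k x)\<^sup>2) = 0" for k
      using edge_integral_scaled[OF mem(4), of al 0] by (simp add: edge_coords)
    show "(\<lambda>k. edge_integral vb vc (\<lambda>x. al x * (\<psi> k x)\<^sup>2)) \<longlonglongrightarrow> 0"
      using divergence_limit(1)[OF ap al_fun] by (simp add: z)
    show "r * ?I vb vc k \<le> edge_integral vb vc (\<lambda>x. al x * (\<psi> k x)\<^sup>2)" for k
      by (rule edge_integral_lower[OF mem(2) continuous_al sc]) (simp add: edge_coords wd_lower r_def)
  qed (rule edge_integral_sq_nonneg)
  have DA: "?I vd a \<longlonglongrightarrow> 0"
  proof (rule squeeze)
    \<comment> \<open>The mirror image: this affine function vanishes on \<open>vb vc\<close> and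
      equals \<open>wd\<close> on \<open>vd a\<close>.\<close>
    have w: "(\<lambda>x. wd (ga x) - al x) = (\<lambda>x. (e1 + (e2 - e1) * - (m_ga \<bullet> a) + m_al \<bullet> a) + ((e2 - e1) *\<^sub>R m_ga - m_al) \<bullet> x)"
      using wd_ga by auto
    have z: "edge_integral vb vc (\<lambda>x. (wd (ga x) - al x) * (\<psi> k x)\<^sup>2) = 0" for k
      using edge_integral_scaled[OF mem(2), of "\<lambda>x. wd (ga x) - al x" 0] by (simp add: edge_coords)
    show "(\<lambda>k. edge_integral vd a (\<lambda>x. (wd (ga x) - al x) * (\<psi> k x)\<^sup>2)) \<longlonglongrightarrow> 0"
      using divergence_limit(1)[OF ap w] tendsto_minus_cancel_left[of "\<lambda>k. edge_integral vd a (\<lambda>x. (wd (ga x) - al x) * (\<psi> k x)\<^sup>2)" 0] by (simp add: z)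
    show "r * ?I vd a k \<le> edge_integral vd a (\<lambda>x. (wd (ga x) - al x) * (\<psi> k x)\<^sup>2)" for k
    proof (rule edge_integral_lower[OF mem(4) _ sc])
      show "continuous_on K (\<lambda>x. wd (ga x) - al x)"
        by (intro continuous_on_diff continuous_al continuous_on_compose2[OF continuous_wd[of UNIV] continuous_ga]) auto
    qed (simp add: edge_coords wd_lower r_def)
  qed (rule edge_integral_sq_nonneg)
  have gBC: "(\<lambda>k. edge_integral vb vc (\<lambda>x. g x * (\<psi> k x)\<^sup>2)) \<longlonglongrightarrow> 0" if g: "continuous_on K g" for g
  proof -
    obtain C where C: "\<And>x. x \<in> K \<Longrightarrow> norm (g x) \<le> C" using K_bounded[OF g] by blast
    show ?thesis
    proof (rule Lim_null_comparison[OF always_eventually])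
      show "\<forall>k. norm (edge_integral vb vc (\<lambda>x. g x * (\<psi> k x)\<^sup>2)) \<le> C * ?I vb vc k"
        using edge_integral_weight_bound[OF g _ sc mem(2)] C by simp
      show "(\<lambda>k. C * ?I vb vc k) \<longlonglongrightarrow> 0" using BC by (rule tendsto_mult_right_zero)
    qed
  qed
  have CD: "?I vc vd \<longlonglongrightarrow> 0"
  proof -
    \<comment> \<open>The leg in the second divergence identity is already settled. Of the bases,
      \<open>ga\<close> sees only \<open>vc vd\<close>.\<close>
    have z: "edge_integral a vb (\<lambda>x. ga x * (\<psi> k x)\<^sup>2) = 0" "edge_integral vc vd (\<lambda>x. ga x * (\<psi> k x)\<^sup>2) = ?I vc vd k" for k
      using edge_integral_scaled[OF mem(1), of ga 0] edge_integral_scaled[OF mem(3), of ga 1] by (simp_all add: edge_coords)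
    have "(\<lambda>k. e2 * ?I vc vd k - (e2 - e1) * edge_integral vb vc (\<lambda>x. ga x * (\<psi> k x)\<^sup>2)) \<longlonglongrightarrow> 0"
      using divergence_limit(2)[OF ap ga_fun] by (simp add: z)
    from tendsto_add[OF this tendsto_mult_right_zero[OF gBC[OF continuous_ga], of "e2 - e1"]]
    have "(\<lambda>k. e2 * ?I vc vd k) \<longlonglongrightarrow> 0" by simp
    from tendsto_mult[OF tendsto_const[of "1 / e2"] this] show ?thesis using e2_pos by simp
  qed
  have AB: "?I a vb \<longlonglongrightarrow> 0"
  proof -
    have w: "(\<lambda>x. 1 - ga x) = (\<lambda>x. (1 + m_ga \<bullet> a) + (- m_ga) \<bullet> x)" by (auto simp: ga_def)
    have z: "edge_integral a vb (\<lambda>x. (1 - ga x) * (\<psi> k x)\<^sup>2) = ?I a vb k" "edge_integral vc vd (\<lambda>x. (1 - ga x) * (\<psi> k x)\<^sup>2) = 0" for k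
      using edge_integral_scaled[OF mem(1), of "\<lambda>x. 1 - ga x" 1] edge_integral_scaled[OF mem(3), of "\<lambda>x. 1 - ga x" 0] by (simp_all add: edge_coords)
    have c: "continuous_on K (\<lambda>x. 1 - ga x)" by (intro continuous_intros continuous_ga)
    have "(\<lambda>k. - (e1 * ?I a vb k) - (e2 - e1) * edge_integral vb vc (\<lambda>x. (1 - ga x) * (\<psi> k x)\<^sup>2)) \<longlonglongrightarrow> 0"
      using divergence_limit(2)[OF ap w] by (simp add: z)
    from tendsto_add[OF this tendsto_mult_right_zero[OF gBC[OF c], of "e2 - e1"]]
    have "(\<lambda>k. - (e1 * ?I a vb k)) \<longlonglongrightarrow> 0" by simp
    from tendsto_mult[OF tendsto_const[of "- 1 / e1"] this] show ?thesis using e1_pos by simp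
  qed
  have lim: "?I p q \<longlonglongrightarrow> 0" using e AB BC CD DA by (auto simp: perimeter_edges_def)
  note s = L2_convD(2)[OF A(4)[OF e]]
  have "(\<lambda>k. LINT t|MI. \<psi> k (linepath p q t) * \<psi> k (linepath p q t)) \<longlonglongrightarrow> (LINT t|MI. \<beta> (linepath p q t) * \<beta> (linepath p q t))"
    by (rule L2_conv_mult[OF A(4)[OF e] A(4)[OF e]])
  moreover have "(LINT t|MI. \<psi> k (linepath p q t) * \<psi> k (linepath p q t)) = ?I p q k" for k
    using edge_integral_eq_MI[OF continuous_on_power[OF sc] e, of k 2] by (simp add: power2_eq_square)
  ultimately have "(LINT t|MI. \<beta> (linepath p q t) * \<beta> (linepath p q t)) = 0"
    using lim by (simp add: LIMSEQ_unique)
  then have "AE t in MI. \<beta> (linepath p q t) * \<beta> (linepath p q t) = 0"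
    using square_integrable_mult[OF s s] by (subst (asm) integral_nonneg_eq_0_iff_AE) auto
  then show ?thesis by (auto elim: eventually_mono)
qed

lemma trace_borel: "has_trace verts v \<beta> \<Longrightarrow> \<beta> \<in> borel_measurable borel"
proof -
  assume "has_trace verts v \<beta>"
  then have "\<beta> \<in> borel_measurable MB" by (simp add: has_trace_def square_integrable_def)
  then show ?thesis using measurable_cong_sets[OF sets_boundary_measure refl] by blast
qed

text \<open>Two approximating sequences of \<open>v\<close> differ by one that tends to 0. Needed in
  \<open>projection_bound\<close>, where the normalisation of the projection speaks of some trace of
  \<open>v\<close>.\<close>

lemma trace_unique:
  assumes "has_trace verts v \<beta>" "has_trace verts v \<beta>'"
  shows "AE x in MB. \<beta> x = \<beta>' x"
proof -
  obtain \<phi> G where A: "approximates \<phi> v G \<beta>" using approximates_of_trace[OF assms(1)] by blast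
  obtain \<phi>' G' where B: "approximates \<phi>' v G' \<beta>'" using approximates_of_trace[OF assms(2)] by blast
  note [measurable] = trace_borel[OF assms(1)] trace_borel[OF assms(2)]
  have ap: "approximates (\<lambda>k x. \<phi> k x - \<phi>' k x) (\<lambda>x. 0) (\<lambda>x. G x - G' x) (\<lambda>x. \<beta> x - \<beta>' x)"
    using approximates_diff[OF A B] by simp
  have "{x. \<beta> x \<noteq> \<beta>' x} \<in> sets borel" by measurable
  then show ?thesis
    using zero_limit_trace[OF ap] by (subst AE_MB_iff) auto
qed

text \<open>The cutoffs are test functions that tend to 1, so \<open>v\<close> determines the mean
  of its weak gradient. The projection and the trace each come with a weak gradient of their
  own.\<close>

lemma weak_gradient_mean_unique:
  assumes "has_weak_gradient E v G" "has_weak_gradient E v G'"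
  shows "(LINT x|ME. G x \<bullet> w) = (LINT x|ME. G' x \<bullet> w)"
proof -
  have sG: "square_integrable ME G" "square_integrable ME G'" using assms by (auto simp: has_weak_gradient_def)
  have comp: "square_integrable ME (\<lambda>x. F x $ i)" if "square_integrable ME F" for F :: "real^2 \<Rightarrow> real^2" and i
    using L2_convD(2)[OF L2_conv_inner_const[OF L2_conv_const[OF that], of "axis i 1"]] by (simp add: inner_axis)
  have lim: "(\<lambda>k. LINT x|ME. F x $ i * cutoff (dl k) x) \<longlonglongrightarrow> (LINT x|ME. F x $ i)"
    if "square_integrable ME F" for F :: "real^2 \<Rightarrow> real^2" and i
    using L2_conv_mult[OF cutoff_scaleR_conv[OF comp[OF that]] L2_conv_const[OF continuous_square_integrable[of "\<lambda>_. 1"]]]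
    by (simp add: mult.commute)
  have "(LINT x|ME. G x $ i * cutoff (dl k) x) = (LINT x|ME. G' x $ i * cutoff (dl k) x)" for i k
    using assms test_function_cutoff[OF dl_pos[of k]] by (simp add: has_weak_gradient_def)
  then have eq: "(LINT x|ME. G x $ i) = (LINT x|ME. G' x $ i)" for i
    using LIMSEQ_unique[OF lim[OF sG(1), of i]] lim[OF sG(2), of i] by simp
  have "(LINT x|ME. F x \<bullet> w) = (LINT x|ME. F x $ 1) * w $ 1 + (LINT x|ME. F x $ 2) * w $ 2"
    if "square_integrable ME F" for F :: "real^2 \<Rightarrow> real^2"
    using comp[OF that, THEN square_integrable_integrable_ME] by (simp add: inner_vec_def sum_2)
  then show ?thesis using eq sG by simp
qed

lemma measure_E: "measure ME E = h * (e1 + e2) / 2"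
proof -
  have "measure ME E = (LINT x|ME. 1)"
    by simp
  also have "\<dots> = h * integral {0..1} wd"
    by (subst integral_E) (auto intro: continuous_intros)
  also have "integral {0..1} wd = (e1 + e2) / 2"
  proof -
    have "(wd has_integral ((\<lambda>y. y * e1 + y\<^sup>2 / 2 * (e2 - e1)) 1 - (\<lambda>y. y * e1 + y\<^sup>2 / 2 * (e2 - e1)) 0)) {0..1}"
      by (rule fundamental_theorem_of_calculus)
        (auto intro!: derivative_eq_intros simp: has_real_derivative_iff_has_vector_derivative[symmetric] wd_def field_simps)
    then show ?thesis by (simp add: integral_unique field_simps)
  qed
  finally show ?thesis by simp
qed

lemma measure_E_bounds: "h * em / 2 \<le> measure ME E" "measure ME E \<le> h * em"
proof -
  have "em \<le> e1 + e2" "e1 + e2 \<le> 2 * em" using e1_pos e2_pos by (auto simp: em_def)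
  then show "h * em / 2 \<le> measure ME E" "measure ME E \<le> h * em"
    using h_pos mult_left_mono[of em "e1 + e2" h] mult_left_mono[of "e1 + e2" "2 * em" h] by (auto simp: measure_E)
qed

end

section \<open>Bounds for the projection and for the source term\<close>

text \<open>Symmetric about 1/4, with an odd companion \<open>bump1\<close>: mixed moments vanish,
  and each coefficient of an affine function can be isolated. The arguments have the form
  \<open>c + m * t\<close> expected by \<open>smooth1_comp_affine\<close>.\<close>

definition bump :: "real \<Rightarrow> real" where
  "bump t = flat_exp 0 (- 1 / 8 + 1 * t) * flat_exp 0 (3 / 8 + (- 1) * t)"
definition bump1 :: "real \<Rightarrow> real" where
  "bump1 t = (- 1 / 4 + 1 * t) * bump t"

lemma smooth1_bump: "smooth1 bump" and smooth1_bump1: "smooth1 bump1"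
proof -
  show *: "smooth1 bump"
    unfolding bump_def[abs_def] by (intro smooth1_mult smooth1_comp_affine smooth1_flat_exp)
  show "smooth1 bump1"
    unfolding bump1_def[abs_def] by (intro smooth1_mult smooth1_affine *)
qed

lemma bump_support: "t \<notin> {1/8..3/8} \<Longrightarrow> bump t = 0" "t \<notin> {1/8..3/8} \<Longrightarrow> bump1 t = 0"
  by (auto simp: bump_def bump1_def flat_exp_def)

lemma bump_nonneg: "0 \<le> bump t"
  by (simp add: bump_def flat_exp_nonneg)

text \<open>The interval keeps the distance 1/16 from the ends of the support and 1/32 from the
  centre 1/4, so that it serves for the second moment as well.\<close>

lemma bump_lower:
  assumes "t \<in> {9/32..5/16}"
  shows "exp (- 32) \<le> bump t"
proof -
  have "exp (- 16) \<le> flat_exp 0 r" if "r \<ge> 1 / 16" for r :: real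
    using that by (simp add: flat_exp_def field_simps)
  from mult_mono[OF this this, of "- 1 / 8 + 1 * t" "3 / 8 + (- 1) * t"] assms
  show ?thesis by (simp add: bump_def mult_exp_exp flat_exp_nonneg)
qed

lemma compact_support_integrable:
  fixes A :: "real \<Rightarrow> real"
  assumes "continuous_on UNIV A" "\<And>t. t \<notin> {1/8..3/8} \<Longrightarrow> A t = 0"
  shows "integrable lborel A"
proof -
  have "indicator {1/8..3/8} t *\<^sub>R A t = A t" for t
    using assms(2)[of t] by (cases "t \<in> {1/8..3/8}") auto
  then have "(\<lambda>t. indicator {1/8..3/8} t *\<^sub>R A t) = A" ..
  moreover have "set_integrable lborel {1/8..3/8} A"
    by (rule borel_integrable_atLeastAtMost') (use assms(1) continuous_on_subset in blast)
  ultimately show ?thesis by (simp add: set_integrable_def)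
qed

lemma deriv_support:
  fixes A :: "real \<Rightarrow> real"
  assumes "\<And>t. t \<notin> {1/8..3/8} \<Longrightarrow> A t = 0" "t \<notin> {1/8..3/8}"
  shows "deriv A t = 0"
proof -
  have "((\<lambda>t. 0) has_real_derivative 0) (at t)" by simp
  then have "(A has_real_derivative 0) (at t)"
    by (rule has_field_derivative_transform_within_open[where S = "- {1/8..3/8}"]) (use assms in auto)
  then show ?thesis by (rule DERIV_imp_deriv)
qed

lemma compact_support_bounded:
  fixes A :: "real \<Rightarrow> real"
  assumes "continuous_on UNIV A" "\<And>t. t \<notin> {1/8..3/8} \<Longrightarrow> A t = 0"
  obtains C where "\<And>t. \<bar>A t\<bar> \<le> C"
proof -
  have "compact (A ` {1/8..3/8})"
    by (rule compact_continuous_image) (use assms(1) continuous_on_subset in blast, simp)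
  then have "bounded (A ` {1/8..3/8})" by (rule compact_imp_bounded)
  then obtain C where "\<forall>y \<in> A ` {1/8..3/8}. norm y \<le> C" unfolding bounded_iff by blast
  then have C: "\<And>t. t \<in> {1/8..3/8} \<Longrightarrow> \<bar>A t\<bar> \<le> C" by fastforce
  have "\<bar>A t\<bar> \<le> max C 0" for t
    using C[of t] assms(2)[of t] by (cases "t \<in> {1/8..3/8}") auto
  then show thesis by (rule that)
qed

text \<open>The common support and the bounds up to the second derivative are what the estimate of
  \<open>test_lap\<close> consumes; \<open>C\<close> refers to no trapezoid.\<close>

definition profile :: "real \<Rightarrow> (real \<Rightarrow> real) \<Rightarrow> bool" where
  "profile C A \<longleftrightarrow> smooth1 A \<and> (\<forall>t. t \<notin> {1/8..3/8} \<longrightarrow> A t = 0) \<and>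
     (\<forall>t. \<bar>A t\<bar> \<le> C \<and> \<bar>deriv A t\<bar> \<le> C \<and> \<bar>deriv (deriv A) t\<bar> \<le> C)"

lemma profile_exists:
  assumes "smooth1 A" "\<And>t. t \<notin> {1/8..3/8} \<Longrightarrow> A t = 0"
  shows "\<exists>C. profile C A"
proof -
  note s = assms(1) smooth1_deriv(2)[OF assms(1)] smooth1_deriv(2)[OF smooth1_deriv(2)[OF assms(1)]]
  note z = assms(2) deriv_support[OF assms(2)] deriv_support[OF deriv_support[OF assms(2)]]
  obtain C0 where C0: "\<And>t. \<bar>A t\<bar> \<le> C0"
    using compact_support_bounded[OF smooth1_continuous[OF s(1)] z(1)] by blast
  obtain C1 where C1: "\<And>t. \<bar>deriv A t\<bar> \<le> C1"
    using compact_support_bounded[OF smooth1_continuous[OF s(2)] z(2)] by blast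
  obtain C2 where C2: "\<And>t. \<bar>deriv (deriv A) t\<bar> \<le> C2"
    using compact_support_bounded[OF smooth1_continuous[OF s(3)] z(3)] by blast
  have "profile (max C0 (max C1 C2)) A"
    using assms C0 C1 C2 by (auto simp: profile_def le_max_iff_disj)
  then show ?thesis ..
qed

lemma profile_mono: "profile C A \<Longrightarrow> C \<le> C' \<Longrightarrow> profile C' A"
  unfolding profile_def by (meson order_trans)

lemma bump_profile:
  obtains C where "C > 0" "profile C bump" "profile C bump1"
proof -
  obtain C1 C2 where "profile C1 bump" "profile C2 bump1"
    using profile_exists[OF smooth1_bump] profile_exists[OF smooth1_bump1] bump_support by blast
  then have "profile (max 1 (max C1 C2)) bump" "profile (max 1 (max C1 C2)) bump1"
    by (auto elim: profile_mono)
  then show thesis by (intro that[of "max 1 (max C1 C2)"]) auto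
qed

definition moment0 :: real where "moment0 = (LINT t|lborel. bump t)"
text \<open>By the definition of \<open>bump1\<close> this is the second moment of
  \<open>bump\<close> about its centre, hence positive.\<close>

definition moment2 :: real where "moment2 = (LINT t|lborel. (t - 1 / 4) * bump1 t)"

lemma bump_integrable: "integrable lborel bump" "integrable lborel bump1"
    "integrable lborel (\<lambda>t. (t - 1 / 4) * bump1 t)"
  by (rule compact_support_integrable; (intro continuous_intros smooth1_continuous smooth1_bump smooth1_bump1 | simp add: bump_support))+

lemma integral_lborel_pos:
  fixes f :: "real \<Rightarrow> real"
  assumes "integrable lborel f" "\<And>t. 0 \<le> f t" "\<And>t. t \<in> {9/32..5/16} \<Longrightarrow> c \<le> f t" "c > 0"
  shows "(LINT t|lborel. f t) > 0"
proof -
  have "0 < c * (1 / 32)" using assms by simp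
  also have "\<dots> = (LINT t|lborel. c * indicator {9/32..5/16::real} t)" by simp
  also have "\<dots> \<le> (LINT t|lborel. f t)"
  proof (rule integral_mono)
    show "integrable lborel (\<lambda>t. c * indicator {9/32..5/16::real} t)" by simp
    show "c * indicator {9/32..5/16} t \<le> f t" for t
      using assms(2,3)[of t] by (cases "t \<in> {9/32..5/16}") simp_all
  qed (fact assms(1))
  finally show ?thesis .
qed

lemma moment_pos: "moment0 > 0" "moment2 > 0"
proof -
  show "moment0 > 0" unfolding moment0_def
    by (rule integral_lborel_pos[OF bump_integrable(1) bump_nonneg bump_lower]) auto
  have eq: "(t - 1 / 4) * bump1 t = (t - 1 / 4)\<^sup>2 * bump t" for t
    by (simp add: bump1_def power2_eq_square)
  have "(1 / 32)\<^sup>2 * exp (- 32) \<le> (t - 1 / 4) * bump1 t" if "t \<in> {9/32..5/16}" for t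
    unfolding eq using that by (intro mult_mono power_mono bump_lower) auto
  then show "moment2 > 0" unfolding moment2_def
    by (intro integral_lborel_pos[OF bump_integrable(3), of "(1 / 32)\<^sup>2 * exp (- 32)"]) (auto simp: eq bump_nonneg)
qed

text \<open>The reflection of \<open>t\<close> to \<open>1 / 2 - t\<close> exchanges the two factors
  of \<open>bump\<close> and changes the sign of \<open>bump1\<close>.\<close>

lemma bump1_integral_zero: "(LINT t|lborel. bump1 t) = 0" "(LINT t|lborel. (t - 1 / 4) * bump t) = 0"
proof -
  have i: "(LINT t|lborel. bump1 t) = (LINT t|lborel. bump1 (1 / 2 + (- 1) * t))"
    using lborel_integral_real_affine[of "- 1" bump1 "1 / 2"] by simp
  have "bump1 (1 / 2 + (- 1) * t) = - bump1 t" for t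
  proof -
    have "- 1 / 8 + 1 * (1 / 2 + (- 1) * t) = 3 / 8 + (- 1) * t" "3 / 8 + (- 1) * (1 / 2 + (- 1) * t) = - 1 / 8 + 1 * t"
      "- 1 / 4 + 1 * (1 / 2 + (- 1) * t) = - (- 1 / 4 + 1 * t)" by simp_all
    then show ?thesis unfolding bump1_def bump_def by (simp add: algebra_simps)
  qed
  then have "(LINT t|lborel. bump1 (1 / 2 + (- 1) * t)) = - (LINT t|lborel. bump1 t)"
    by simp
  with i show *: "(LINT t|lborel. bump1 t) = 0" by linarith
  have "(\<lambda>t. (t - 1 / 4) * bump t) = bump1" by (auto simp: bump1_def)
  with * show "(LINT t|lborel. (t - 1 / 4) * bump t) = 0" by simp
qed

section \<open>The supremum bound for the projection\<close>

context trapezoid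
begin

lemma affine_increment:
  "m \<bullet> x - m \<bullet> y = (ga x - ga y) * (m \<bullet> leg) + (al x - al y) * (m \<bullet> u)"
proof -
  have e: "m \<bullet> x = m \<bullet> a + ga x * (m \<bullet> leg) + al x * (m \<bullet> u)" for x
  proof -
    have "m \<bullet> pt (ga x) (al x) = m \<bullet> a + ga x * (m \<bullet> leg) + al x * (m \<bullet> u)"
      by (simp only: pt_def inner_add_right inner_scaleR_right)
    then show ?thesis by (simp only: pt_coords)
  qed
  show ?thesis unfolding e[of x] e[of y] by (simp add: algebra_simps)
qed

lemma AE_edge_of_MB:
  assumes "AE x in MB. P x" "{x. \<not> P x} \<in> sets borel" "(p, q) \<in> perimeter_edges"
  shows "AE t in MI. P (linepath p q t)"
  using assms AE_MB_iff[OF assms(2)] by auto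

lemma edge_mean_bound:
  assumes "square_integrable MI (\<lambda>t. f t)" "AE t in MI. \<bar>f t\<bar> \<le> (M::real)"
  shows "\<bar>LINT t|MI. f t\<bar> \<le> M"
proof -
  interpret finite_measure MI by (rule finite_MI)
  have one: "square_integrable MI (\<lambda>t. 1 :: real)" by (simp add: square_integrable_def)
  have int: "integrable MI f" using square_integrable_mult[OF assms(1) one] by simp
  have "\<bar>LINT t|MI. f t\<bar> \<le> (LINT t|MI. \<bar>f t\<bar>)" using int by (simp add: Bochner_Integration.integral_abs_bound)
  also have "\<dots> \<le> (LINT t|MI. M)"
    using int assms(2) by (intro integral_mono_AE) auto
  also have "\<dots> = M" by (simp add: measure_restrict_space space_restrict_space)
  finally show ?thesis .
qed

text \<open>The gradient \<open>m\<close> of the projection is the mean gradient of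
  \<open>v\<close>, which the divergence theorem expresses by edge means of \<open>\<beta>\<close>,
  each at most M. This gives 4 M for the variation along the leg and 4 M across it, hence an
  oscillation of 8 M on \<open>K\<close>; equality of the boundary means adds the last M.\<close>

lemma projection_bound:
  assumes tr: "has_trace verts v \<beta>" and bd: "AE x in MB. \<bar>\<beta> x\<bar> \<le> M" and M: "M > 0"
    and pr: "is_nabla_projection verts v \<theta>" and x: "x \<in> K"
  shows "\<bar>\<theta> x\<bar> \<le> 9 * M"
proof -
  obtain \<phi> G where wG: "has_weak_gradient E v G" and ap: "approximates \<phi> v G \<beta>"
    using approximates_of_trace[OF tr] by blast
  note A = approximatesD[OF ap]
  obtain c m where \<theta>: "\<theta> = (\<lambda>x. c + m \<bullet> x)" using pr by (auto simp: is_nabla_projection_def P1_def)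
  obtain G' where wG': "has_weak_gradient E v G'"
    and orth: "\<And>q. q \<in> P1 \<Longrightarrow> (LINT x|ME. (G' x - grad \<theta> x) \<bullet> grad q x) = 0"
    using pr by (auto simp: is_nabla_projection_def polygon_eq)
  obtain \<beta>' where tr': "has_trace verts v \<beta>'" and mean: "(LINT x|MB. \<beta>' x - \<theta> x) = 0"
    using pr by (auto simp: is_nabla_projection_def)
  note [measurable] = trace_borel[OF tr] trace_borel[OF tr']
  have mem: "(a, vb) \<in> perimeter_edges" "(vb, vc) \<in> perimeter_edges" "(vc, vd) \<in> perimeter_edges" "(vd, a) \<in> perimeter_edges"
    by (auto simp: perimeter_edges_def)
  define I where "I = (\<lambda>p q. LINT t|MI. \<beta> (linepath p q t))"
  have I: "\<bar>I p q\<bar> \<le> M" if e: "(p, q) \<in> perimeter_edges" for p q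
  proof -
    have "{x. \<not> \<bar>\<beta> x\<bar> \<le> M} \<in> sets borel" by measurable
    from AE_edge_of_MB[OF bd this e] show ?thesis
      unfolding I_def by (intro edge_mean_bound L2_convD(2)[OF A(4)[OF e]])
  qed
  have lim: "(\<lambda>k. edge_integral p q (\<phi> k)) \<longlonglongrightarrow> I p q" if e: "(p, q) \<in> perimeter_edges" for p q
  proof -
    have one: "square_integrable MI (\<lambda>t. 1 :: real)"
      using finite_MI by (simp add: square_integrable_def finite_measure.integrable_const)
    show ?thesis
      using L2_conv_mult[OF A(4)[OF e] L2_conv_const[OF one]] edge_integral_eq_MI[OF smooth_continuous[OF A(1)] e]
      by (simp add: I_def)
  qed
  have grad_m: "(m \<bullet> w) * measure ME E = (LINT x|ME. G x \<bullet> w)" for w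
  proof -
    have sG: "square_integrable ME (\<lambda>x. G' x \<bullet> w)"
      using wG' L2_convD(2)[OF L2_conv_inner_const[OF L2_conv_const]] by (auto simp: has_weak_gradient_def)
    interpret finite_measure ME by (rule finite_ME)
    \<comment> \<open>The affine function with gradient \<open>w\<close>: orthogonality to it says
      that \<open>m\<close> and the weak gradient have the same mean in the direction
      \<open>w\<close>.\<close>
    have "(\<lambda>x. 0 + w \<bullet> x) \<in> P1" unfolding P1_def by blast
    from orth[OF this] have "(LINT x|ME. (G' x - m) \<bullet> w) = 0" by (simp only: \<theta> grad_affine)
    then have "(LINT x|ME. G' x \<bullet> w) - (LINT x|ME. m \<bullet> w) = 0"
      using square_integrable_integrable_ME[OF sG] by (simp add: inner_diff_left)
    then have "(LINT x|ME. G' x \<bullet> w) = (m \<bullet> w) * measure ME E" by simp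
    then show ?thesis using weak_gradient_mean_unique[OF wG' wG, of w] by simp
  qed
  have Glim: "(\<lambda>k. LINT x|ME. grad (\<phi> k) x \<bullet> w) \<longlonglongrightarrow> (LINT x|ME. G x \<bullet> w)" for w
    using L2_conv_mult[OF L2_conv_inner_const[OF A(3), of w] L2_conv_const[OF continuous_square_integrable[of "\<lambda>_. 1"]]] by simp
  have div: "(LINT x|ME. grad (\<phi> k) x \<bullet> u) = h * (edge_integral vb vc (\<phi> k) - edge_integral vd a (\<phi> k))"
    "(LINT x|ME. grad (\<phi> k) x \<bullet> leg) = h * (e2 * edge_integral vc vd (\<phi> k) - e1 * edge_integral a vb (\<phi> k) - (e2 - e1) * edge_integral vb vc (\<phi> k))" for k
    by (rule divergence_theorem[OF smooth_has_derivative[OF A(1)] smooth_continuous_grad[OF A(1)]])+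
  have "(LINT x|ME. G x \<bullet> u) = h * (I vb vc - I vd a)"
    by (rule LIMSEQ_unique[OF Glim]) (unfold div, intro tendsto_intros lim mem)
  then have "\<bar>m \<bullet> u\<bar> * measure ME E = h * \<bar>I vb vc - I vd a\<bar>"
    using grad_m[of u] h_pos by (metis abs_mult abs_of_nonneg abs_of_pos measure_nonneg)
  also have "\<dots> \<le> h * (2 * M)"
    using I[OF mem(2)] I[OF mem(4)] h_pos by (intro mult_left_mono) auto
  finally have "\<bar>m \<bullet> u\<bar> * (h * em / 2) \<le> h * (2 * M)"
    using mult_left_mono[OF measure_E_bounds(1), of "\<bar>m \<bullet> u\<bar>"] by simp
  then have "h * (em * \<bar>m \<bullet> u\<bar>) \<le> h * (4 * M)" by (simp add: algebra_simps)
  then have mu: "em * \<bar>m \<bullet> u\<bar> \<le> 4 * M" using h_pos by simp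
  have "(LINT x|ME. G x \<bullet> leg) = h * (e2 * I vc vd - e1 * I a vb - (e2 - e1) * I vb vc)"
    by (rule LIMSEQ_unique[OF Glim]) (unfold div, intro tendsto_intros lim mem)
  then have "\<bar>m \<bullet> leg\<bar> * measure ME E = h * \<bar>e2 * I vc vd - e1 * I a vb - (e2 - e1) * I vb vc\<bar>"
    using grad_m[of leg] h_pos by (metis abs_mult abs_of_nonneg abs_of_pos measure_nonneg)
  also have "\<dots> \<le> h * (e2 * M + e1 * M + \<bar>e2 - e1\<bar> * M)"
  proof (rule mult_left_mono)
    have "\<bar>e2 * I vc vd\<bar> \<le> e2 * M" "\<bar>e1 * I a vb\<bar> \<le> e1 * M" "\<bar>(e2 - e1) * I vb vc\<bar> \<le> \<bar>e2 - e1\<bar> * M"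
      using I mem e1_pos e2_pos by (auto simp: abs_mult intro!: mult_left_mono)
    then show "\<bar>e2 * I vc vd - e1 * I a vb - (e2 - e1) * I vb vc\<bar> \<le> e2 * M + e1 * M + \<bar>e2 - e1\<bar> * M" by linarith
  qed (use h_pos in simp)
  \<comment> \<open>\<open>e1 + e2 + \<bar>e2 - e1\<bar>\<close> is twice the maximum.\<close>
  also have "\<dots> = h * (2 * em * M)"
    by (auto simp: em_def max_def abs_if algebra_simps)
  finally have "\<bar>m \<bullet> leg\<bar> * (h * em / 2) \<le> h * (2 * em * M)"
    using mult_left_mono[OF measure_E_bounds(1), of "\<bar>m \<bullet> leg\<bar>"] by simp
  then have "(h * em) * \<bar>m \<bullet> leg\<bar> \<le> (h * em) * (4 * M)" by (simp add: algebra_simps)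
  then have ml: "\<bar>m \<bullet> leg\<bar> \<le> 4 * M" using h_pos em_pos by simp
  have osc: "\<bar>\<theta> x - \<theta> y\<bar> \<le> 8 * M" if y: "y \<in> K" for y
  proof -
    have g: "\<bar>ga x - ga y\<bar> \<le> 1" using x y by (auto simp: K_def)
    have l: "\<bar>al x - al y\<bar> \<le> em" using al_bounds[OF x] al_bounds[OF y] by auto
    have "\<bar>\<theta> x - \<theta> y\<bar> \<le> \<bar>ga x - ga y\<bar> * \<bar>m \<bullet> leg\<bar> + \<bar>al x - al y\<bar> * \<bar>m \<bullet> u\<bar>"
      using affine_increment[of m x y] by (simp add: \<theta>) (metis abs_mult abs_triangle_ineq)
    also have "\<dots> \<le> 1 * (4 * M) + em * \<bar>m \<bullet> u\<bar>"
      using g l ml by (intro add_mono mult_mono) auto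
    finally show ?thesis using mu by simp
  qed
  interpret MB: finite_measure MB by (rule finite_MB)
  let ?L = "measure MB (space MB)"
  have L: "?L > 0" using MB_pos by (simp add: MB.emeasure_eq_measure)
  have one: "square_integrable MB (\<lambda>t. 1 :: real)" by (simp add: square_integrable_def)
  have sb: "square_integrable MB \<beta>'" using tr' by (simp add: has_trace_def)
  have ib: "integrable MB \<beta>'" using square_integrable_mult[OF sb one] by simp
  have [measurable]: "\<theta> \<in> borel_measurable borel"
    unfolding \<theta> by (intro borel_measurable_continuous_onI continuous_intros)
  have aeK: "AE y in MB. y \<in> K"
  proof -
    have "closed K" using compact_K by (rule compact_imp_closed)
    then have "{y. y \<notin> K} \<in> sets borel" by (auto simp: Collect_neg_eq)
    moreover have "AE t in MI. linepath p q t \<in> K" if "(p, q) \<in> perimeter_edges" for p q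
      using AE_space[of MI] by (rule eventually_mono) (use edge_mem_K[OF that] in \<open>simp add: space_restrict_space\<close>)
    ultimately show ?thesis by (subst AE_MB_iff) auto
  qed
  have ip: "integrable MB (\<lambda>y. \<theta> x - \<theta> y)"
  proof (rule MB.integrable_const_bound[where B = "8 * M"])
    have "(\<lambda>y. \<theta> x - \<theta> y) \<in> borel_measurable borel" by measurable
    then show "(\<lambda>y. \<theta> x - \<theta> y) \<in> borel_measurable MB"
      using measurable_cong_sets[OF sets_boundary_measure refl] by blast
    show "AE y in MB. norm (\<theta> x - \<theta> y) \<le> 8 * M"
      using aeK by (rule eventually_mono) (use osc in simp)
  qed
  have i\<theta>: "integrable MB \<theta>"
    using Bochner_Integration.integrable_diff[OF _ ip, of "\<lambda>y. \<theta> x"] by simp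
  have "(LINT y|MB. \<beta>' y) = (LINT y|MB. \<theta> y)" using mean ib i\<theta> by simp
  \<comment> \<open>The value at \<open>x\<close> is averaged over the boundary, and the mean of
    \<open>\<theta>\<close> is exchanged for that of \<open>\<beta>'\<close>. The integrand is then
    at most 8 M + M.\<close>
  then have "\<theta> x * ?L = (LINT y|MB. (\<theta> x - \<theta> y) + \<beta>' y)"
    using ib i\<theta> by (simp add: mult.commute)
  also have "\<bar>\<dots>\<bar> \<le> (LINT y|MB. \<bar>(\<theta> x - \<theta> y) + \<beta>' y\<bar>)"
    by (rule Bochner_Integration.integral_abs_bound)
  also have "\<dots> \<le> (LINT y|MB. 9 * M)"
  proof (rule integral_mono_AE)
    show "AE y in MB. \<bar>(\<theta> x - \<theta> y) + \<beta>' y\<bar> \<le> 9 * M"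
      using aeK bd trace_unique[OF tr tr']
    proof eventually_elim
      case (elim y)
      then show ?case using osc[of y] by simp
    qed
  qed (use ip ib in \<open>auto intro!: integrable_abs Bochner_Integration.integrable_add\<close>)
  also have "\<dots> = 9 * M * ?L" by simp
  finally have "\<bar>\<theta> x\<bar> * ?L \<le> 9 * M * ?L" by (simp add: abs_mult)
  then show ?thesis using L by simp
qed


text \<open>
  The test functions are supported in the half of the trapezoid adjacent to the longer base, where
  the width is at least \<open>em / 2\<close>.
\<close>

definition base_shift :: real where "base_shift = (if e1 \<ge> e2 then 0 else 1 / 2)"

definition test_fun :: "(real \<Rightarrow> real) \<Rightarrow> (real \<Rightarrow> real) \<Rightarrow> real^2 \<Rightarrow> real" where
  "test_fun A D x = A (al x / em) * D (ga x - base_shift)"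

text \<open>The Laplacian of \<open>test_fun A D\<close>, as \<open>sum_grad_grad_test_fun\<close>
  shows. The mixed term reflects the shear, without which \<open>m_al\<close> and
  \<open>m_ga\<close> are orthogonal.\<close>

definition test_lap :: "(real \<Rightarrow> real) \<Rightarrow> (real \<Rightarrow> real) \<Rightarrow> real^2 \<Rightarrow> real" where
  "test_lap A D x = test_fun (deriv (deriv A)) D x * (norm m_al / em)\<^sup>2
     + 2 * test_fun (deriv A) (deriv D) x * ((m_al \<bullet> m_ga) / em) + test_fun A (deriv (deriv D)) x * (norm m_ga)\<^sup>2"

lemma test_coords:
  "(\<lambda>x. al x / em) = (\<lambda>x. - (m_al \<bullet> a) / em + ((1 / em) *\<^sub>R m_al) \<bullet> x)"
  "(\<lambda>x. ga x - base_shift) = (\<lambda>x. (- (m_ga \<bullet> a) - base_shift) + m_ga \<bullet> x)"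
  by (auto simp: al_def ga_def diff_divide_distrib add_divide_distrib)

lemma smooth_test_coords: "smooth (\<lambda>x. al x / em)" "smooth (\<lambda>x. ga x - base_shift)"
  unfolding test_coords by (rule smooth_affine)+

lemma grad_test_coords: "grad (\<lambda>x. al x / em) x = (1 / em) *\<^sub>R m_al" "grad (\<lambda>x. ga x - base_shift) x = m_ga"
  unfolding test_coords by (rule grad_affine)+

lemma smooth_test_fun: "smooth1 A \<Longrightarrow> smooth1 D \<Longrightarrow> smooth (test_fun A D)"
  unfolding test_fun_def[abs_def]
  by (intro smooth_mult smooth_comp[OF _ smooth_test_coords(1)] smooth_comp[OF _ smooth_test_coords(2)])

lemma grad_test_fun:
  assumes "smooth1 A" "smooth1 D"
  shows "grad (test_fun A D) x = (test_fun (deriv A) D x / em) *\<^sub>R m_al + test_fun A (deriv D) x *\<^sub>R m_ga"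
proof -
  note sA = smooth_comp[OF assms(1) smooth_test_coords(1)] and sD = smooth_comp[OF assms(2) smooth_test_coords(2)]
  show ?thesis
    unfolding test_fun_def[abs_def] grad_mult[OF sA sD]
      grad_comp[OF smooth1_deriv(1)[OF assms(1)] smooth_test_coords(1)]
      grad_comp[OF smooth1_deriv(1)[OF assms(2)] smooth_test_coords(2)] grad_test_coords
    by (simp add: algebra_simps)
qed

lemma sum_grad_grad_test_fun:
  assumes "smooth1 A" "smooth1 D"
  shows "(\<Sum>i\<in>UNIV. grad (\<lambda>x. grad (test_fun A D) x $ i) x $ i) = test_lap A D x"
proof -
  note dA = smooth1_deriv(2)[OF assms(1)] and dD = smooth1_deriv(2)[OF assms(2)]
  have c: "grad (\<lambda>x. k) x = 0" for k x using grad_affine[of k 0 x] by simp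
  have eq: "(\<lambda>x. grad (test_fun A D) x $ i) = (\<lambda>x. (m_al $ i / em) * test_fun (deriv A) D x + (m_ga $ i) * test_fun A (deriv D) x)" for i
    by (auto simp: grad_test_fun[OF assms])
  have "grad (\<lambda>x. grad (test_fun A D) x $ i) x $ i
     = test_fun (deriv (deriv A)) D x * (m_al $ i / em * (m_al $ i / em)) + 2 * test_fun (deriv A) (deriv D) x * (m_al $ i * m_ga $ i / em)
       + test_fun A (deriv (deriv D)) x * (m_ga $ i * m_ga $ i)" for i
    unfolding eq grad_add[OF smooth_mult[OF smooth_const smooth_test_fun[OF dA assms(2)]] smooth_mult[OF smooth_const smooth_test_fun[OF assms(1) dD]]]
      grad_mult[OF smooth_const smooth_test_fun[OF dA assms(2)]] grad_mult[OF smooth_const smooth_test_fun[OF assms(1) dD]] c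
      grad_test_fun[OF dA assms(2)] grad_test_fun[OF assms(1) dD]
    by (simp add: algebra_simps)
  then have "(\<Sum>i\<in>UNIV. grad (\<lambda>x. grad (test_fun A D) x $ i) x $ i) =
      test_fun (deriv (deriv A)) D x * ((m_al $ 1 / em) * (m_al $ 1 / em) + (m_al $ 2 / em) * (m_al $ 2 / em))
      + 2 * test_fun (deriv A) (deriv D) x * ((m_al $ 1 * m_ga $ 1 + m_al $ 2 * m_ga $ 2) / em)
      + test_fun A (deriv (deriv D)) x * (m_ga $ 1 * m_ga $ 1 + m_ga $ 2 * m_ga $ 2)"
    by (simp add: sum_2 algebra_simps add_divide_distrib)
  also have "\<dots> = test_lap A D x"
  proof -
    have n: "(norm w)\<^sup>2 = w $ 1 * w $ 1 + w $ 2 * w $ 2" for w :: "real^2"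
      by (simp add: power2_norm_eq_inner inner_vec_def sum_2)
    have "(norm m_al / em)\<^sup>2 = (m_al $ 1 / em) * (m_al $ 1 / em) + (m_al $ 2 / em) * (m_al $ 2 / em)"
      by (simp only: power_divide n) (simp add: add_divide_distrib power2_eq_square)
    then show ?thesis by (simp add: test_lap_def n inner_vec_def sum_2)
  qed
  finally show ?thesis .
qed

lemma test_fun_support:
  assumes "\<And>t. t \<notin> {1/8..3/8} \<Longrightarrow> A t = 0" "\<And>t. t \<notin> {1/8..3/8} \<Longrightarrow> D t = 0" "test_fun A D x \<noteq> 0"
  shows "al x / em \<in> {1/8..3/8}" "ga x - base_shift \<in> {1/8..3/8}" "x \<in> E"
proof -
  show 1: "al x / em \<in> {1/8..3/8}" "ga x - base_shift \<in> {1/8..3/8}"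
    using assms unfolding test_fun_def by (metis mult_eq_0_iff)+
  then have al: "em / 8 \<le> al x" "al x \<le> 3 * em / 8" using em_pos by (auto simp: field_simps)
  have g: "0 < ga x" "ga x < 1" "base_shift \<le> ga x" "ga x \<le> base_shift + 1 / 2" using 1(2) by (auto simp: base_shift_def split: if_splits)
  \<comment> \<open>This exceeds \<open>3 * em / 8\<close>, the largest value of \<open>al\<close>
    on the support, and so yields the last inequality defining \<open>E\<close>.\<close>
  have "em / 2 \<le> wd (ga x)"
  proof (cases "e1 \<ge> e2")
    case True
    then have "em * (1 / 2) \<le> em * (1 - ga x)" using g em_pos by (intro mult_left_mono) (auto simp: base_shift_def)
    moreover have "wd (ga x) = em * (1 - ga x) + ga x * e2" using True by (simp add: wd_def em_def max_absorb1)
    moreover have "0 \<le> ga x * e2" using g e2_pos by simp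
    ultimately show ?thesis by linarith
  next
    case False
    then have "em * (1 / 2) \<le> em * ga x" using g em_pos by (intro mult_left_mono) (auto simp: base_shift_def)
    moreover have "wd (ga x) = (1 - ga x) * e1 + em * ga x" using False by (simp add: wd_def em_def max_absorb2)
    moreover have "0 \<le> (1 - ga x) * e1" using g e1_pos by simp
    ultimately show ?thesis by linarith
  qed
  then show "x \<in> E" using g al em_pos by (auto simp: E_def)
qed

lemma test_function_test_fun:
  assumes "profile C A" "profile C D"
  shows "test_function E (test_fun A D)"
proof (rule test_functionI)
  note P = assms[unfolded profile_def]
  show "smooth (test_fun A D)" using P by (intro smooth_test_fun) auto
  let ?C = "K \<inter> {x. em / 8 \<le> al x \<and> al x \<le> 3 * em / 8 \<and> 1 / 8 \<le> ga x - base_shift \<and> ga x - base_shift \<le> 3 / 8}"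
  have "closed {x. em / 8 \<le> al x \<and> al x \<le> 3 * em / 8 \<and> 1 / 8 \<le> ga x - base_shift \<and> ga x - base_shift \<le> 3 / 8}"
    by (intro closed_Collect_conj closed_Collect_le continuous_intros continuous_al continuous_ga)
  then show "compact ?C" by (rule compact_Int_closed[OF compact_K])
  \<comment> \<open>The support lemma is reused with indicators as profiles: their product is
    nonzero on all of \<open>?C\<close>, hence \<open>?C\<close> lies in \<open>E\<close>.\<close>
  have ind: "indicator {1/8..3/8} t = (0::real)" if "t \<notin> {1/8..3/8}" for t :: real using that by simp
  show "?C \<subseteq> E"
  proof
    fix x assume "x \<in> ?C"
    then have "al x / em \<in> {1/8..3/8}" "ga x - base_shift \<in> {1/8..3/8}" using em_pos by (auto simp: field_simps)
    then have "test_fun (indicator {1/8..3/8}) (indicator {1/8..3/8}) x \<noteq> 0" by (simp add: test_fun_def)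
    from test_fun_support(3)[OF ind ind this] show "x \<in> E" by blast
  qed
  show "x \<in> ?C" if "test_fun A D x \<noteq> 0" for x
    using test_fun_support[OF _ _ that] P E_subset_K em_pos by (auto simp: field_simps)
qed

text \<open>Two integrations by parts: the weak equation with the bump, and the definition of the
  weak gradient with its partial derivatives.\<close>

lemma test_lap_identity:
  assumes "profile C A" "profile C D" and wG: "has_weak_gradient E v G"
    and weak: "\<And>\<phi>. test_function E \<phi> \<Longrightarrow> (LINT x|ME. G x \<bullet> grad \<phi> x) = - (LINT x|ME. p x * \<phi> x)"
  shows "(LINT x|ME. p x * test_fun A D x) = (LINT x|ME. v x * test_lap A D x)"
proof -
  have s: "smooth1 A" "smooth1 D" using assms by (auto simp: profile_def)
  let ?\<phi> = "test_fun A D"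
  have t: "test_function E ?\<phi>" by (rule test_function_test_fun[OF assms(1,2)])
  have sm: "smooth ?\<phi>" by (rule smooth_test_fun[OF s])
  have sv: "square_integrable ME v" "square_integrable ME G" using wG by (auto simp: has_weak_gradient_def)
  have comp: "square_integrable ME (\<lambda>x. G x $ i)" for i
    using L2_convD(2)[OF L2_conv_inner_const[OF L2_conv_const[OF sv(2)], of "axis i 1"]] by (simp add: inner_axis)
  have i1: "integrable ME (\<lambda>x. G x $ i * grad ?\<phi> x $ i)" for i
    by (intro square_integrable_mult comp continuous_square_integrable smooth_continuous smooth_grad sm)
  have i2: "integrable ME (\<lambda>x. v x * grad (\<lambda>x. grad ?\<phi> x $ i) x $ i)" for i
    by (intro square_integrable_mult sv continuous_square_integrable smooth_continuous smooth_grad sm)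
  have "(LINT x|ME. v x * grad (\<lambda>x. grad ?\<phi> x $ i) x $ i) = - (LINT x|ME. G x $ i * grad ?\<phi> x $ i)" for i
    using wG test_function_grad[OF t, of i] by (simp add: has_weak_gradient_def)
  then have "(\<Sum>i\<in>UNIV. LINT x|ME. v x * grad (\<lambda>x. grad ?\<phi> x $ i) x $ i) = - (\<Sum>i\<in>UNIV. LINT x|ME. G x $ i * grad ?\<phi> x $ i)"
    by (simp add: sum_negf)
  also have "(\<Sum>i\<in>UNIV. LINT x|ME. G x $ i * grad ?\<phi> x $ i) = (LINT x|ME. G x \<bullet> grad ?\<phi> x)"
    by (subst Bochner_Integration.integral_sum[symmetric]) (use i1 in \<open>auto simp: inner_vec_def\<close>)
  also have "(\<Sum>i\<in>UNIV. LINT x|ME. v x * grad (\<lambda>x. grad ?\<phi> x $ i) x $ i) = (LINT x|ME. v x * test_lap A D x)"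
    by (subst Bochner_Integration.integral_sum[symmetric])
      (use i2 in \<open>auto simp: sum_distrib_left[symmetric] sum_grad_grad_test_fun[OF s]\<close>)
  finally show ?thesis using weak[OF t] by simp
qed

text \<open>Both coordinate gradients, after scaling \<open>al\<close> by \<open>em\<close>, have
  length at most 1/W. The 4 counts the two pure terms once and the mixed term twice.\<close>

lemma test_lap_bound:
  assumes "profile C A" "profile C D" "h \<ge> em"
  shows "\<bar>test_lap A D x\<bar> \<le> 4 * C\<^sup>2 / W\<^sup>2"
proof -
  have C: "\<bar>f (al x / em) * g (ga x - base_shift)\<bar> \<le> C\<^sup>2" if "\<And>t. \<bar>f t\<bar> \<le> C" "\<And>t. \<bar>g t\<bar> \<le> C" for f g :: "real \<Rightarrow> real"
    unfolding abs_mult power2_eq_square using that order_trans[OF abs_ge_zero that(1)] by (intro mult_mono) auto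
  note P = assms(1,2)[unfolded profile_def]
  have b: "\<bar>test_fun (deriv (deriv A)) D x\<bar> \<le> C\<^sup>2" "\<bar>test_fun (deriv A) (deriv D) x\<bar> \<le> C\<^sup>2" "\<bar>test_fun A (deriv (deriv D)) x\<bar> \<le> C\<^sup>2"
    unfolding test_fun_def using P by (auto intro!: C)
  have w: "norm m_al / em = 1 / W" by (simp add: W_def)
  \<comment> \<open>\<open>m_al \<bullet> u = 1\<close> with a unit vector \<open>u\<close>. Hence W
    \<le> em \<le> h, which is where the height condition is used.\<close>
  have "1 \<le> norm m_al"
    using norm_cauchy_schwarz[of m_al u] norm_u by (simp add: m_al_def inner_diff_left inner_frame)
  then have "W \<le> em" unfolding W_def using em_pos by (intro divide_le_eq[THEN iffD2]) auto
  then have Wh: "W \<le> h" using assms(3) by simp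
  then have g: "norm m_ga \<le> 1 / W"
    using h_pos W_pos norm_n Wh by (simp add: m_ga_def frac_le)
  have g2: "(norm m_ga)\<^sup>2 \<le> 1 / W\<^sup>2" using power_mono[OF g, of 2] by (simp add: power_divide)
  have gm: "\<bar>(m_al \<bullet> m_ga) / em\<bar> \<le> 1 / W\<^sup>2"
  proof -
    have "\<bar>(m_al \<bullet> m_ga) / em\<bar> \<le> (norm m_al / em) * norm m_ga"
      using Cauchy_Schwarz_ineq2[of m_al m_ga] em_pos by (simp add: abs_divide divide_right_mono)
    also have "\<dots> \<le> (1 / W) * (1 / W)" unfolding w using g W_pos by (intro mult_left_mono) auto
    finally show ?thesis by (simp add: power2_eq_square)
  qed
  have m: "\<bar>r * q\<bar> \<le> C\<^sup>2 * (1 / W\<^sup>2)" if "\<bar>r\<bar> \<le> C\<^sup>2" "\<bar>q\<bar> \<le> 1 / W\<^sup>2" for r q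
    unfolding abs_mult using that by (intro mult_mono) auto
  have "\<bar>test_fun (deriv (deriv A)) D x * (norm m_al / em)\<^sup>2\<bar> \<le> C\<^sup>2 * (1 / W\<^sup>2)"
    unfolding w by (rule m[OF b(1)]) (simp add: power_divide)
  moreover have "\<bar>test_fun (deriv A) (deriv D) x * ((m_al \<bullet> m_ga) / em)\<bar> \<le> C\<^sup>2 * (1 / W\<^sup>2)"
    by (rule m[OF b(2) gm])
  moreover have "\<bar>test_fun A (deriv (deriv D)) x * (norm m_ga)\<^sup>2\<bar> \<le> C\<^sup>2 * (1 / W\<^sup>2)"
    by (rule m[OF b(3)]) (simp add: g2)
  moreover have "4 * C\<^sup>2 / W\<^sup>2 = 4 * (C\<^sup>2 * (1 / W\<^sup>2))" by simp
  ultimately show ?thesis unfolding test_lap_def mult.assoc by linarith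
qed

lemma continuous_test_lap:
  assumes "smooth1 A" "smooth1 D"
  shows "continuous_on S (test_lap A D)"
proof -
  note d = smooth1_deriv(2)[OF assms(1)] smooth1_deriv(2)[OF assms(2)]
    smooth1_deriv(2)[OF smooth1_deriv(2)[OF assms(1)]] smooth1_deriv(2)[OF smooth1_deriv(2)[OF assms(2)]]
  show ?thesis
    unfolding test_lap_def[abs_def]
    by (intro continuous_intros smooth_continuous smooth_test_fun assms d)
qed

text \<open>The two parts of \<open>v\<close> are measured differently: \<open>z\<close> in L2,
  where Poincare's inequality controls it, and \<open>v - z\<close> in the supremum norm. Both parts
  use that the area of \<open>E\<close> is at most \<open>h * em\<close>.\<close>

lemma test_estimate:
  assumes "profile C A" "profile C D" "h \<ge> em" and M: "M \<ge> 0"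
    and v: "square_integrable ME v" and z: "square_integrable ME z" and vz: "\<And>x. \<bar>v x - z x\<bar> \<le> 2 * M"
  shows "\<bar>LINT x|ME. v x * test_lap A D x\<bar> \<le> (4 * C\<^sup>2 / W\<^sup>2) * (sqrt (h * em) * L2_norm ME z + 2 * M * (h * em))"
proof -
  interpret finite_measure ME by (rule finite_ME)
  let ?B = "4 * C\<^sup>2 / W\<^sup>2" and ?l = "test_lap A D"
  have B: "\<bar>?l x\<bar> \<le> ?B" for x by (rule test_lap_bound[OF assms(1-3)])
  have B0: "?B \<ge> 0" by simp
  have l: "square_integrable ME ?l"
    using assms(1,2) by (intro continuous_square_integrable continuous_test_lap) (auto simp: profile_def)
  have d: "square_integrable ME (\<lambda>x. v x - z x)" by (rule square_integrable_diff[OF v z])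
  have Ln: "L2_norm ME ?l \<le> ?B * sqrt (h * em)"
  proof -
    have "(LINT x|ME. (norm (?l x))\<^sup>2) \<le> (LINT x|ME. ?B\<^sup>2)"
    proof (rule integral_mono)
      show "(norm (?l x))\<^sup>2 \<le> ?B\<^sup>2" for x
        unfolding real_norm_def by (rule power_mono[OF B abs_ge_zero])
    qed (use square_integrable_integrable[OF l] in simp_all)
    also have "\<dots> = ?B\<^sup>2 * measure ME E" by simp
    also have "\<dots> \<le> ?B\<^sup>2 * (h * em)" using measure_E_bounds(2) by (intro mult_left_mono) auto
    finally have "sqrt (LINT x|ME. (norm (?l x))\<^sup>2) \<le> sqrt (?B\<^sup>2 * (h * em))" by (rule real_sqrt_le_mono)
    also have "\<dots> = ?B * sqrt (h * em)" using B0 by (simp only: real_sqrt_mult real_sqrt_abs abs_of_nonneg)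
    finally show ?thesis by (simp add: L2_norm_def)
  qed
  have "(LINT x|ME. v x * ?l x) = (LINT x|ME. z x * ?l x) + (LINT x|ME. (v x - z x) * ?l x)"
    using square_integrable_mult[OF v l] square_integrable_mult[OF z l] by (simp add: left_diff_distrib)
  moreover have "\<bar>LINT x|ME. z x * ?l x\<bar> \<le> L2_norm ME z * (?B * sqrt (h * em))"
    using L2_Cauchy_Schwarz[OF z l] mult_left_mono[OF Ln L2_norm_nonneg[of ME z]] by simp
  moreover have "\<bar>LINT x|ME. (v x - z x) * ?l x\<bar> \<le> (2 * M * ?B) * (h * em)"
  proof -
    have "norm (LINT x|ME. (v x - z x) * ?l x) \<le> (LINT x|ME. 2 * M * ?B)"
    proof (rule Bochner_Integration.integral_norm_bound_integral)
      show "norm ((v x - z x) * ?l x) \<le> 2 * M * ?B" for x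
        unfolding real_norm_def abs_mult using vz[of x] B[of x] M by (intro mult_mono) auto
    qed (use square_integrable_mult[OF d l] in auto)
    also have "\<dots> = (2 * M * ?B) * measure ME E" by simp
    also have "\<dots> \<le> (2 * M * ?B) * (h * em)" using measure_E_bounds(2) M by (intro mult_left_mono) auto
    finally show ?thesis by simp
  qed
  ultimately have "\<bar>LINT x|ME. v x * ?l x\<bar> \<le> L2_norm ME z * (?B * sqrt (h * em)) + (2 * M * ?B) * (h * em)" by linarith
  also have "\<dots> = ?B * (sqrt (h * em) * L2_norm ME z + 2 * M * (h * em))" by (simp add: algebra_simps)
  finally show ?thesis .
qed

text \<open>In the coordinates scaled by \<open>em\<close> the bump is a product and
  \<open>p\<close> a sum of products, so Fubini's theorem leaves moments in one variable;
  \<open>h * em\<close> is the Jacobian.\<close>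

lemma test_moments:
  assumes A: "profile C A" and D: "profile C D"
    and p: "\<And>x. p x = q0 + q1 * (al x / em - 1 / 4) + q2 * (ga x - base_shift - 1 / 4)"
  shows "(LINT x|ME. p x * test_fun A D x) = h * em * (q0 * ((LINT t|lborel. A t) * (LINT t|lborel. D t))
    + q1 * ((LINT t|lborel. (t - 1 / 4) * A t) * (LINT t|lborel. D t)) + q2 * ((LINT t|lborel. A t) * (LINT t|lborel. (t - 1 / 4) * D t)))"
proof -
  note P = assms(1,2)[unfolded profile_def]
  have s: "smooth1 A" "smooth1 D" using P by auto
  have i: "integrable lborel A" "integrable lborel D" "integrable lborel (\<lambda>t. (t - 1 / 4) * A t)" "integrable lborel (\<lambda>t. (t - 1 / 4) * D t)"
    using P by (auto intro!: compact_support_integrable continuous_on_mult continuous_on_diff continuous_on_id continuous_on_const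
        smooth1_continuous[OF s(1)] smooth1_continuous[OF s(2)])
  have pc: "continuous_on S p" for S
    unfolding p[abs_def] by (intro continuous_intros continuous_al continuous_ga) (use em_pos in auto)
  have c: "continuous_on S (\<lambda>x. p x * test_fun A D x)" for S
    by (intro continuous_intros pc smooth_continuous smooth_test_fun s)
  have det: "leg$1 * (em *\<^sub>R u)$2 - leg$2 * (em *\<^sub>R u)$1 = em * (leg$1 * u$2 - leg$2 * u$1)"
    by (simp add: algebra_simps)
  then have adet: "\<bar>leg$1 * (em *\<^sub>R u)$2 - leg$2 * (em *\<^sub>R u)$1\<bar> = h * em" using leg_det em_pos by (simp add: abs_mult)
  then have nz: "leg$1 * (em *\<^sub>R u)$2 - leg$2 * (em *\<^sub>R u)$1 \<noteq> 0" using h_pos em_pos mult_pos_pos[of h em] by (metis abs_zero less_irrefl)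
  have "(LINT x|ME. p x * test_fun A D x) = (LINT x|lborel. indicator E x * (p x * test_fun A D x))"
    by (rule integral_ME_lborel(1)[OF c])
  \<comment> \<open>The support lies in \<open>E\<close>, so the integral extends to the plane and
    the slanted sides disappear.\<close>
  also have "\<dots> = (LINT x|lborel. p x * test_fun A D x)"
  proof (rule Bochner_Integration.integral_cong[OF refl])
    fix x show "indicator E x * (p x * test_fun A D x) = p x * test_fun A D x"
      using test_fun_support(3)[of A D x] P by (cases "test_fun A D x = 0") auto
  qed
  also have "\<dots> = h * em * (LINT y|lborel. (p (a + fst y *\<^sub>R leg + snd y *\<^sub>R (em *\<^sub>R u)) * test_fun A D (a + fst y *\<^sub>R leg + snd y *\<^sub>R (em *\<^sub>R u))))"
    using integral_real2_affine[OF nz borel_measurable_continuous_onI[OF c], of a] unfolding adet .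
  also have "(\<lambda>y. a + fst y *\<^sub>R leg + snd y *\<^sub>R (em *\<^sub>R u)) = (\<lambda>y. pt (fst y) (snd y * em))"
    by (auto simp: pt_def)
  finally have 1: "(LINT x|ME. p x * test_fun A D x) = h * em * (LINT y|lborel. p (pt (fst y) (snd y * em)) * test_fun A D (pt (fst y) (snd y * em)))"
    by (simp add: pt_def)
  define D' where "D' = (\<lambda>t. D (t - base_shift))"
  define D1' where "D1' = (\<lambda>t. (t - base_shift - 1 / 4) * D (t - base_shift))"
  have sh: "(LINT t|lborel. f (t - base_shift)) = (LINT t|lborel. f t)" "integrable lborel f \<Longrightarrow> integrable lborel (\<lambda>t. f (t - base_shift))" for f :: "real \<Rightarrow> real"
    using lborel_integral_real_affine[of 1 f "- base_shift"] lborel_integrable_real_affine[of f 1 "- base_shift"] by simp_all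
  have D': "integrable lborel D'" "(LINT t|lborel. D' t) = (LINT t|lborel. D t)"
    using sh[of D] i by (auto simp: D'_def)
  have D1': "integrable lborel D1'" "(LINT t|lborel. D1' t) = (LINT t|lborel. (t - 1 / 4) * D t)"
    using sh[of "\<lambda>t. (t - 1 / 4) * D t"] i by (auto simp: D1'_def)
  have "p (pt (fst y) (snd y * em)) * test_fun A D (pt (fst y) (snd y * em))
     = q0 * (D' (fst y) * A (snd y)) + q1 * (D' (fst y) * ((snd y - 1 / 4) * A (snd y))) + q2 * (D1' (fst y) * A (snd y))" for y
    using em_pos by (simp add: p test_fun_def D'_def D1'_def algebra_simps)
  then have "(LINT y|lborel. p (pt (fst y) (snd y * em)) * test_fun A D (pt (fst y) (snd y * em)))
     = q0 * ((LINT t|lborel. D' t) * (LINT t|lborel. A t)) + q1 * ((LINT t|lborel. D' t) * (LINT t|lborel. (t - 1 / 4) * A t))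
      + q2 * ((LINT t|lborel. D1' t) * (LINT t|lborel. A t))"
    using integral_prod_lborel[OF D'(1) i(1)] integral_prod_lborel[OF D'(1) i(3)] integral_prod_lborel[OF D1'(1) i(1)]
    by simp
  then show ?thesis unfolding 1 D'(2) D1'(2) by (simp add: mult.commute)
qed

end

text \<open>12 is 3 times 4: three coefficients of \<open>p\<close>, each with the 4 of
  \<open>test_lap_bound\<close>. The denominator is the smallest factor with which a coefficient
  occurs in \<open>test_moments\<close>.\<close>

definition growth :: "real \<Rightarrow> real" where
  "growth C = 12 * C\<^sup>2 / min (moment0 * moment0) (moment0 * moment2)"

section \<open>Closing the circle of estimates\<close>

context trapezoid
begin

text \<open>Tested with partial derivatives of \<open>\<phi>\<close>, both pairings are expressed by
  \<open>v\<close> alone. This reconciles the gradient in the weak Laplacian with that of the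
  trace.\<close>

lemma weak_gradient_test_unique:
  assumes "has_weak_gradient E v G" "has_weak_gradient E v G'" and t: "test_function E \<phi>"
  shows "(LINT x|ME. G x \<bullet> grad \<phi> x) = (LINT x|ME. G' x \<bullet> grad \<phi> x)"
proof -
  have sm: "smooth \<phi>" using t by (simp add: test_function_def)
  have *: "(LINT x|ME. F x \<bullet> grad \<phi> x) = - (\<Sum>i\<in>UNIV. LINT x|ME. v x * grad (\<lambda>x. grad \<phi> x $ i) x $ i)"
    if F: "has_weak_gradient E v F" for F
  proof -
    have sF: "square_integrable ME F" using F by (simp add: has_weak_gradient_def)
    have "integrable ME (\<lambda>x. F x $ i * grad \<phi> x $ i)" for i
      using L2_convD(2)[OF L2_conv_inner_const[OF L2_conv_const[OF sF], of "axis i 1"]]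
      by (intro square_integrable_mult[OF _ continuous_square_integrable[OF smooth_continuous[OF smooth_grad[OF sm]]]]) (simp add: inner_axis)
    then have "(LINT x|ME. F x \<bullet> grad \<phi> x) = (\<Sum>i\<in>UNIV. LINT x|ME. F x $ i * grad \<phi> x $ i)"
      by (subst Bochner_Integration.integral_sum[symmetric]) (auto simp: inner_vec_def)
    also have "\<dots> = (\<Sum>i\<in>UNIV. - (LINT x|ME. v x * grad (\<lambda>x. grad \<phi> x $ i) x $ i))"
      using F test_function_grad[OF t] by (intro sum.cong refl) (simp add: has_weak_gradient_def)
    finally show ?thesis by (simp add: sum_negf)
  qed
  show ?thesis using *[OF assms(1)] *[OF assms(2)] by simp
qed

lemma integral_mult_bound:
  assumes "square_integrable ME f" "square_integrable ME g" "\<And>x. x \<in> E \<Longrightarrow> \<bar>f x\<bar> \<le> F" "\<And>x. x \<in> E \<Longrightarrow> \<bar>g x\<bar> \<le> B" "0 \<le> F" "0 \<le> B"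
  shows "\<bar>LINT x|ME. f x * g x\<bar> \<le> F * B * (h * em)"
proof -
  interpret finite_measure ME by (rule finite_ME)
  have "norm (LINT x|ME. f x * g x) \<le> (LINT x|ME. F * B)"
  proof (rule Bochner_Integration.integral_norm_bound_integral)
    show "norm (f x * g x) \<le> F * B" if "x \<in> space ME" for x
      unfolding real_norm_def abs_mult using assms that by (intro mult_mono) auto
  qed (use square_integrable_mult[OF assms(1,2)] in auto)
  also have "\<dots> = F * B * measure ME E" by simp
  also have "\<dots> \<le> F * B * (h * em)" using measure_E_bounds(2) assms by (intro mult_left_mono) auto
  finally show ?thesis by simp
qed

text \<open>Write Y = P W^2, S^2 = h em, k = \<open>growth C\<close>, and L for the norm of
  \<open>z\<close>. The bumps give Y S \<le> k (L + 2 M S), and the energy gives L^2 \<le> 44 Y M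
  S^2. So L involves only the square root of Y, and half of Y can be absorbed.\<close>

lemma source_bound:
  assumes hem: "h \<ge> em" and C: "C > 0" "profile C bump" "profile C bump1" and M: "M > 0"
    and wG: "has_weak_gradient E v G" and ap: "approximates \<phi> v G \<beta>"
    and weak: "\<And>\<phi>. test_function E \<phi> \<Longrightarrow> (LINT x|ME. G x \<bullet> grad \<phi> x) = - (LINT x|ME. p x * \<phi> x)"
    and p: "\<And>x. p x = q0 + q1 * (al x / em - 1 / 4) + q2 * (ga x - base_shift - 1 / 4)"
    and pb: "\<And>x. x \<in> K \<Longrightarrow> \<bar>p x\<bar> \<le> \<bar>q0\<bar> + \<bar>q1\<bar> + \<bar>q2\<bar>"
    and bd: "\<And>p q. (p, q) \<in> perimeter_edges \<Longrightarrow> AE t in MI. \<bar>\<beta> (linepath p q t)\<bar> \<le> M"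
    and pr: "continuous_on K \<theta>" "\<And>x. x \<in> K \<Longrightarrow> \<bar>\<theta> x\<bar> \<le> 9 * M" "(LINT x|ME. (v x - \<theta> x) * p x) = 0"
  shows "(\<bar>q0\<bar> + \<bar>q1\<bar> + \<bar>q2\<bar>) * W\<^sup>2 \<le> (44 * (growth C)\<^sup>2 + 4 * growth C) * M"
proof -
  define P where "P = \<bar>q0\<bar> + \<bar>q1\<bar> + \<bar>q2\<bar>"
  have P0: "P \<ge> 0" by (simp add: P_def)
  define z where "z = (\<lambda>x. excess M (v x))"
  define Z where "Z = (\<lambda>x. excess' M (v x) *\<^sub>R G x)"
  have zt: "zero_trace z Z"
    unfolding z_def Z_def
  proof (rule truncation_zero_trace[OF ap smooth1_excess excess_deriv[OF M] continuous_excess' excess'_bounds[OF M]])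
    fix p q assume "(p, q) \<in> perimeter_edges"
    from bd[OF this] show "AE t in MI. excess M (\<beta> (linepath p q t)) = 0"
      by (rule eventually_mono) (rule excess_zero[OF M])
  qed
  note s = zero_traceD[OF zt]
  have sv: "square_integrable ME v" "square_integrable ME G" using wG by (auto simp: has_weak_gradient_def)
  have pc: "continuous_on S p" for S
    unfolding p[abs_def] by (intro continuous_intros continuous_al continuous_ga) (use em_pos in auto)
  have sp: "square_integrable ME p" by (rule continuous_square_integrable[OF pc])
  have s\<theta>: "square_integrable ME \<theta>" by (rule continuous_square_integrable[OF pr(1)])
  have vz: "\<bar>v x - z x\<bar> \<le> 2 * M" for x unfolding z_def by (rule excess_error[OF M])

  have "(LINT x|ME. (norm (Z x))\<^sup>2) \<le> (LINT x|ME. G x \<bullet> Z x)"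
  proof (rule integral_mono)
    fix x
    have "(excess' M (v x))\<^sup>2 \<le> excess' M (v x)"
      using excess'_bounds[OF M, of "v x"] by (simp add: power2_eq_square mult_left_le)
    then show "(norm (Z x))\<^sup>2 \<le> G x \<bullet> Z x"
      by (simp add: Z_def power_mult_distrib power2_norm_eq_inner[symmetric] mult_right_mono)
  qed (use square_integrable_integrable[OF s(2)] square_integrable_inner[OF sv(2) s(2)] in auto)
  also have "\<dots> = - (LINT x|ME. p x * z x)" by (rule zero_trace_test[OF zt sv(2) sp weak])
  \<comment> \<open>The enhancement constraint, with \<open>p\<close> itself as the polynomial,
    exchanges \<open>v\<close> for the projection; both remaining integrals contain only factors
    bounded by \<open>P\<close> and M.\<close>
  also have "\<dots> = (LINT x|ME. p x * (v x - z x)) - (LINT x|ME. p x * \<theta> x)"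
  proof -
    have "(LINT x|ME. p x * (v x - \<theta> x)) = 0" using pr(3) by (simp add: mult.commute)
    then have "(LINT x|ME. p x * v x) = (LINT x|ME. p x * \<theta> x)"
      using square_integrable_mult[OF sp sv(1)] square_integrable_mult[OF sp s\<theta>] by (simp add: right_diff_distrib)
    then show ?thesis
      using square_integrable_mult[OF sp sv(1)] square_integrable_mult[OF sp s(1)] by (simp add: right_diff_distrib)
  qed
  \<comment> \<open>2 M bounds \<open>v - z\<close> and 9 M the projection: this is the 11 of the
    energy.\<close>
  also have "\<dots> \<le> P * (2 * M) * (h * em) + P * (9 * M) * (h * em)"
  proof -
    have pE: "\<bar>p x\<bar> \<le> P" "\<bar>\<theta> x\<bar> \<le> 9 * M" if "x \<in> E" for x
      using pb[of x] pr(2)[of x] subsetD[OF E_subset_K that] by (simp_all add: P_def)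
    have M2: "0 \<le> 2 * M" "0 \<le> 9 * M" using M by simp_all
    have "\<bar>LINT x|ME. p x * (v x - z x)\<bar> \<le> P * (2 * M) * (h * em)"
      by (rule integral_mult_bound[OF sp square_integrable_diff[OF sv(1) s(1)] pE(1) vz P0 M2(1)])
    moreover have "\<bar>LINT x|ME. p x * \<theta> x\<bar> \<le> P * (9 * M) * (h * em)"
      by (rule integral_mult_bound[OF sp s\<theta> pE P0 M2(2)])
    ultimately show ?thesis by linarith
  qed
  finally have energy: "(LINT x|ME. (norm (Z x))\<^sup>2) \<le> 11 * P * M * (h * em)" by (simp add: algebra_simps)

  define S where "S = sqrt (h * em)"
  have S: "S > 0" "S * S = h * em" using h_pos em_pos by (auto simp: S_def)
  define L where "L = L2_norm ME z"
  have "L\<^sup>2 \<le> 4 * W\<^sup>2 * (LINT x|ME. (norm (Z x))\<^sup>2)"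
    using poincare[OF zt] by (simp add: L_def L2_norm_sq)
  also have "\<dots> \<le> 4 * W\<^sup>2 * (11 * P * M * (h * em))" by (rule mult_left_mono[OF energy]) simp
  finally have L2: "L\<^sup>2 \<le> 44 * (P * W\<^sup>2) * M * (S * S)" by (simp add: S algebra_simps)

  define R where "R = (4 * C\<^sup>2 / W\<^sup>2) * (S * L + 2 * M * (S * S))"
  have T: "\<bar>LINT x|ME. p x * test_fun A D x\<bar> \<le> R" if "profile C A" "profile C D" for A D
  proof -
    have id: "(LINT x|ME. p x * test_fun A D x) = (LINT x|ME. v x * test_lap A D x)"
      by (rule test_lap_identity[OF that wG weak])
    show ?thesis
      unfolding id R_def S(2) L_def unfolding S_def
      by (rule test_estimate[OF that hem _ sv(1) s(1) vz]) (use M in simp)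
  qed
  define cm where "cm = min (moment0 * moment0) (moment0 * moment2)"
  have cm: "cm > 0" "cm \<le> moment0 * moment0" "cm \<le> moment0 * moment2" using moment_pos by (auto simp: cm_def)
  have coef: "\<bar>q\<bar> * (cm * (S * S)) \<le> R" if "\<bar>h * em * (q * c)\<bar> \<le> R" "cm \<le> c" for q c
  proof -
    have "\<bar>q\<bar> * (cm * (S * S)) \<le> \<bar>q\<bar> * (c * (S * S))"
      using that(2) S(1) by (intro mult_left_mono mult_right_mono) auto
    also have "\<dots> = \<bar>h * em * (q * c)\<bar>"
      using that(2) cm(1) h_pos em_pos by (simp add: S(2) abs_mult)
    finally show ?thesis using that(1) by simp
  qed
  have "\<bar>q0\<bar> * (cm * (S * S)) \<le> R"
    by (rule coef[OF _ cm(2)])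
      (use T[OF C(2,2)] test_moments[OF C(2,2) p] in \<open>simp add: bump1_integral_zero moment0_def\<close>)
  moreover have "\<bar>q1\<bar> * (cm * (S * S)) \<le> R"
    by (rule coef[OF _ cm(3)])
      (use T[OF C(3,2)] test_moments[OF C(3,2) p] in \<open>simp add: bump1_integral_zero moment0_def moment2_def mult.commute\<close>)
  moreover have "\<bar>q2\<bar> * (cm * (S * S)) \<le> R"
    by (rule coef[OF _ cm(3)])
      (use T[OF C(2,3)] test_moments[OF C(2,3) p] in \<open>simp add: bump1_integral_zero moment0_def moment2_def\<close>)
  ultimately have "P * (cm * (S * S)) \<le> 3 * R" by (simp add: P_def algebra_simps)
  then have "P * (cm * (S * S)) * W\<^sup>2 \<le> 3 * R * W\<^sup>2" by (rule mult_right_mono) simp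
  also have "3 * R * W\<^sup>2 = (12 * C\<^sup>2) * (L + 2 * M * S) * S"
    using W_pos by (simp add: R_def field_simps)
  finally have "(P * W\<^sup>2 * S * cm) * S \<le> ((12 * C\<^sup>2) * (L + 2 * M * S)) * S" by (simp add: algebra_simps)
  then have "P * W\<^sup>2 * S * cm \<le> (12 * C\<^sup>2) * (L + 2 * M * S)"
    by (rule mult_right_le_imp_le[OF _ S(1)])
  then have "P * W\<^sup>2 * S \<le> (12 * C\<^sup>2) * (L + 2 * M * S) / cm" using cm(1) by (simp add: pos_le_divide_eq)
  then have Q: "P * W\<^sup>2 * S \<le> growth C * (L + 2 * M * S)" by (simp add: growth_def cm_def)
  define k where "k = growth C"
  define Y where "Y = P * W\<^sup>2"
  have Y0: "Y \<ge> 0" using P0 by (simp add: Y_def)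
  \<comment> \<open>Arithmetic-geometric mean: 44 k^2 Y M is 4 (Y/2) (22 k^2 M), at most the square
    of the sum. The share Y/2 is chosen so that it can be absorbed.\<close>
  have "k * L \<le> S * (Y / 2 + 22 * k\<^sup>2 * M)"
  proof (rule power2_le_imp_le)
    have "(k * L)\<^sup>2 \<le> k\<^sup>2 * (44 * Y * M * (S * S))"
      unfolding power_mult_distrib using L2 by (intro mult_left_mono) (auto simp: Y_def)
    also have "\<dots> \<le> (S * S) * (Y / 2 + 22 * k\<^sup>2 * M)\<^sup>2"
    proof -
      have "4 * r * t \<le> (r + t)\<^sup>2" for r t :: real
        using zero_le_power2[of "r - t"] by (simp add: power2_diff power2_sum)
      from this[of "Y / 2" "22 * k\<^sup>2 * M"]
       have "(S * S) * (4 * (Y / 2) * (22 * k\<^sup>2 * M)) \<le> (S * S) * (Y / 2 + 22 * k\<^sup>2 * M)\<^sup>2"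
        by (intro mult_left_mono) auto
      then show ?thesis by (simp add: algebra_simps)
    qed
    finally show "(k * L)\<^sup>2 \<le> (S * (Y / 2 + 22 * k\<^sup>2 * M))\<^sup>2"
      unfolding power_mult_distrib[of S] power2_eq_square[of S] .
    show "0 \<le> S * (Y / 2 + 22 * k\<^sup>2 * M)" using S(1) Y0 M by simp
  qed
  with Q have "Y * S \<le> S * (Y / 2 + 22 * k\<^sup>2 * M) + k * (2 * M * S)"
    by (simp add: Y_def k_def algebra_simps)
  then have "S * Y \<le> S * (Y / 2 + 22 * k\<^sup>2 * M + 2 * k * M)" by (simp add: algebra_simps)
  then have "Y \<le> Y / 2 + 22 * k\<^sup>2 * M + 2 * k * M" using S(1) by simp
  then show ?thesis unfolding P_def[symmetric] Y_def[symmetric] k_def[symmetric] by (simp add: algebra_simps)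
qed

text \<open>The maximum principle for \<open>v\<close> and for \<open>- v\<close>, whose boundary
  values and sources obey the same bounds; \<open>source_bound\<close> then turns the contribution
  of the source into a multiple of M.\<close>

lemma sup_bound:
  assumes hem: "h \<ge> em" and C: "C > 0" "profile C bump" "profile C bump1" and M: "M > 0"
    and v: "v \<in> VE_space verts" and tr: "has_trace verts v \<beta>" and bd: "AE x in MB. \<bar>\<beta> x\<bar> \<le> M"
  shows "AE x in ME. \<bar>v x\<bar> \<le> (1 + 22 * (growth C)\<^sup>2 + 2 * growth C) * M"
proof -
  obtain \<phi> G where wG: "has_weak_gradient E v G" and ap: "approximates \<phi> v G \<beta>"
    using approximates_of_trace[OF tr] by blast
  obtain p where p1: "p \<in> P1" and wl: "has_weak_laplacian E v p"
    using v by (auto simp: VE_space_def polygon_eq)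
  obtain \<theta> where pj: "is_nabla_projection verts v \<theta>"
    and orth: "\<And>q. q \<in> P1 \<Longrightarrow> (LINT x|ME. (v x - \<theta> x) * q x) = 0"
    using v by (auto simp: VE_space_def polygon_eq)
  have \<theta>c: "continuous_on K \<theta>"
    using pj by (auto simp: is_nabla_projection_def P1_def intro!: continuous_intros)
  have weak: "(LINT x|ME. G x \<bullet> grad \<psi> x) = - (LINT x|ME. p x * \<psi> x)" if tt: "test_function E \<psi>" for \<psi>
  proof -
    obtain G2 where "has_weak_gradient E v G2" and 2: "(LINT x|ME. G2 x \<bullet> grad \<psi> x) = - (LINT x|ME. p x * \<psi> x)"
      using wl tt unfolding has_weak_laplacian_def by blast
    from weak_gradient_test_unique[OF wG this(1) tt] 2 show ?thesis by simp
  qed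
  have [measurable]: "\<beta> \<in> borel_measurable borel" by (rule trace_borel[OF tr])
  have eb: "AE t in MI. \<bar>\<beta> (linepath p q t)\<bar> \<le> M" if "(p, q) \<in> perimeter_edges" for p q
    by (rule AE_edge_of_MB[OF bd _ that]) measurable
  obtain c m where pm: "p = (\<lambda>x. c + m \<bullet> x)" using p1 by (auto simp: P1_def)
  \<comment> \<open>Expansion of \<open>p\<close> about the common centre of the bumps,
    \<open>al = em / 4\<close> and \<open>ga = base_shift + 1 / 4\<close>, where the mixed moments
    vanish.\<close>
  define q0 where "q0 = p (pt (base_shift + 1 / 4) (em / 4))"
  define q1 where "q1 = em * (m \<bullet> u)"
  define q2 where "q2 = m \<bullet> leg"
  have p: "p x = q0 + q1 * (al x / em - 1 / 4) + q2 * (ga x - base_shift - 1 / 4)" for x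
    using affine_increment[of m x "pt (base_shift + 1 / 4) (em / 4)"] em_pos
    by (simp add: pm q0_def q1_def q2_def algebra_simps)
  define P where "P = \<bar>q0\<bar> + \<bar>q1\<bar> + \<bar>q2\<bar>"
  have pb: "\<bar>p x\<bar> \<le> P" if x: "x \<in> K" for x
  proof -
    have "\<bar>al x / em - 1 / 4\<bar> \<le> 1" using al_bounds[OF x] em_pos by (auto simp: abs_le_iff field_simps)
    moreover have "\<bar>ga x - base_shift - 1 / 4\<bar> \<le> 1" using x by (auto simp: K_def base_shift_def abs_le_iff)
    ultimately have "\<bar>q1 * (al x / em - 1 / 4)\<bar> \<le> \<bar>q1\<bar>" "\<bar>q2 * (ga x - base_shift - 1 / 4)\<bar> \<le> \<bar>q2\<bar>"
      by (simp_all add: abs_mult mult_left_le)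
    then show ?thesis unfolding p P_def by linarith
  qed
  have pc: "continuous_on K p" unfolding pm by (intro continuous_intros)
  have P0: "P \<ge> 0" by (simp add: P_def)
  have src: "P * W\<^sup>2 \<le> (44 * (growth C)\<^sup>2 + 4 * growth C) * M"
    unfolding P_def
    by (rule source_bound[OF hem C M wG ap weak p pb[unfolded P_def] eb \<theta>c projection_bound[OF tr bd M pj] orth[OF p1]])
  have up: "AE x in ME. v x \<le> M + P * W\<^sup>2 / 2"
  proof (rule maximum_principle[OF ap pc _ P0 weak])
    show "- P \<le> p x" if "x \<in> K" for x using pb[OF that] by simp
    show "AE t in MI. \<beta> (linepath p q t) \<le> M" if "(p, q) \<in> perimeter_edges" for p q
      using eb[OF that] by (rule eventually_mono) simp
  qed
  have z: "grad (\<lambda>x. 0) x = 0" for x using grad_affine[of 0 0 x] by simp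
  have ap': "approximates (\<lambda>k x. - \<phi> k x) (\<lambda>x. - v x) (\<lambda>x. - G x) (\<lambda>x. - \<beta> x)"
    using approximates_affine_comb[OF ap smooth_const[of 0], of "- 1"] by (simp add: z)
  have down: "AE x in ME. - v x \<le> M + P * W\<^sup>2 / 2"
  proof (rule maximum_principle[OF ap' _ _ P0, of "\<lambda>x. - p x"])
    show "continuous_on K (\<lambda>x. - p x)" by (intro continuous_intros pc)
    show "- P \<le> - p x" if "x \<in> K" for x using pb[OF that] by simp
    show "(LINT x|ME. - G x \<bullet> grad \<psi> x) = - (LINT x|ME. - p x * \<psi> x)" if "test_function E \<psi>" for \<psi>
      using weak[OF that] by simp
    show "AE t in MI. - \<beta> (linepath p q t) \<le> M" if "(p, q) \<in> perimeter_edges" for p q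
      using eb[OF that] by (rule eventually_mono) simp
  qed
  from up down show ?thesis
  proof eventually_elim
    case (elim x)
    then have "\<bar>v x\<bar> \<le> M + P * W\<^sup>2 / 2" by simp
    also have "\<dots> \<le> M + (44 * (growth C)\<^sup>2 + 4 * growth C) * M / 2" using src by simp
    also have "\<dots> = (1 + 22 * (growth C)\<^sup>2 + 2 * growth C) * M" by (simp add: field_simps)
    finally show ?case .
  qed
qed

text \<open>Passes from positive bounds M to the essential supremum, which may be 0 or
  infinite.\<close>

lemma Linf_bound:
  assumes hem: "h \<ge> em" and C: "C > 0" "profile C bump" "profile C bump1"
    and v: "v \<in> VE_space verts" and tr: "has_trace verts v \<beta>"
  shows "Linf_norm ME v \<le> ereal (1 + 22 * (growth C)\<^sup>2 + 2 * growth C) * Linf_norm MB \<beta>"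
proof -
  define B where "B = 1 + 22 * (growth C)\<^sup>2 + 2 * growth C"
  have "growth C \<ge> 0" using moment_pos by (simp add: growth_def)
  then have B: "B > 0" by (simp add: B_def add_pos_nonneg)
  have ae: "AE x in MB. ereal \<bar>\<beta> x\<bar> \<le> Linf_norm MB \<beta>"
    unfolding Linf_norm_def by (rule esssup_AE)
  \<comment> \<open>The essential supremum of nonnegative values can be negative only for a null
    measure, and the boundary has positive length.\<close>
  have nonneg: "0 \<le> Linf_norm MB \<beta>"
  proof (rule ccontr)
    assume neg: "\<not> 0 \<le> Linf_norm MB \<beta>"
    from ae have "AE x in MB. False"
    proof eventually_elim
      case (elim x)
      have "0 \<le> ereal \<bar>\<beta> x\<bar>" by simp
      with elim neg show ?case by (meson order_trans)
    qed
    then show False using MB_pos by (simp add: eventually_False ae_filter_eq_bot_iff)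
  qed
  show ?thesis
  proof (cases "Linf_norm MB \<beta>")
    case (real r)
    have r0: "r \<ge> 0" using nonneg real by simp
    have "Linf_norm ME v \<le> ereal (B * r) + ereal e" if e: "e > 0" for e
    proof -
      \<comment> \<open>\<open>sup_bound\<close> asks for M > 0 while \<open>r\<close> may be 0; the
        increment is scaled to contribute exactly \<open>e\<close> after multiplication by
        \<open>B\<close>.\<close>
      define M where "M = r + e / B"
      have M: "M > 0" "r \<le> M" using r0 e B by (auto simp: M_def add_nonneg_pos)
      have "AE x in MB. \<bar>\<beta> x\<bar> \<le> M"
        using ae by (rule eventually_mono) (use M(2) real in simp)
      from sup_bound[OF hem C M(1) v tr this]
      have "AE x in ME. ereal \<bar>v x\<bar> \<le> ereal (B * M)" by (simp add: B_def)
      moreover have "(\<lambda>x. ereal \<bar>v x\<bar>) \<in> borel_measurable ME"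
      proof -
        have [measurable]: "v \<in> borel_measurable ME"
          using v by (auto simp: VE_space_def H1_def has_weak_gradient_def square_integrable_def polygon_eq)
        show ?thesis by measurable
      qed
      ultimately have "Linf_norm ME v \<le> ereal (B * M)"
        unfolding Linf_norm_def by (rule esssup_I[rotated])
      also have "B * M = B * r + e" using B by (simp add: M_def field_simps)
      finally show ?thesis by simp
    qed
    then have "Linf_norm ME v \<le> ereal (B * r)" by (rule ereal_le_epsilon2)
    then show ?thesis by (simp add: real B_def)
  next
    case PInf
    then show ?thesis using B by (simp add: B_def)
  next
    case MInf
    then show ?thesis using nonneg by simp
  qed
qed

end

theorem proposition5p2:
  shows "\<exists>C::real. \<forall>(a::real^2) (b::real^2) (c::real^2) (d::real^2) (h::real) (\<epsilon>1::real) (\<epsilon>2::real).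
    is_trapezoid a b c d h \<epsilon>1 \<epsilon>2 \<longrightarrow> h \<ge> max \<epsilon>1 \<epsilon>2 \<longrightarrow>
    (\<forall>v \<in> VE_space [a, b, c, d]. \<forall>\<beta>. has_trace [a, b, c, d] v \<beta> \<longrightarrow>
       Linf_norm (lebesgue_on (polygon [a, b, c, d])) v
         \<le> ereal C * Linf_norm (boundary_measure [a, b, c, d]) \<beta>)"
proof -
  \<comment> \<open>\<open>C\<close> belongs to the fixed bumps and is chosen before any trapezoid,
    so the final constant is universal.\<close>
  obtain C where C: "C > 0" "profile C bump" "profile C bump1" using bump_profile .
  have "Linf_norm (lebesgue_on (polygon [a, b, c, d])) v
      \<le> ereal (1 + 22 * (growth C)\<^sup>2 + 2 * growth C) * Linf_norm (boundary_measure [a, b, c, d]) \<beta>"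
    if tz: "is_trapezoid a b c d h \<epsilon>1 \<epsilon>2" and hm: "h \<ge> max \<epsilon>1 \<epsilon>2"
      and v: "v \<in> VE_space [a, b, c, d]" and tr: "has_trace [a, b, c, d] v \<beta>"
    for a b c d :: "real^2" and h \<epsilon>1 \<epsilon>2 v \<beta>
  proof -
    obtain u n where un: "norm u = 1" "norm n = 1" "u \<bullet> n = 0"
      and eq: "b - a = \<epsilon>1 *\<^sub>R u" "c - d = \<epsilon>2 *\<^sub>R u" "(d - a) \<bullet> n = h"
      and pos: "h > 0" "\<epsilon>1 > 0" "\<epsilon>2 > 0"
      using tz by (auto simp: is_trapezoid_def)
    \<comment> \<open>The shear is the component of \<open>d - a\<close> along the bases, so that
      \<open>leg\<close> becomes \<open>d - a\<close>.\<close>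
    interpret trapezoid a u n h "(d - a) \<bullet> u" \<epsilon>1 \<epsilon>2
      by unfold_locales (use un pos in auto)
    have "d - a = leg" using frame_expansion[of "d - a"] eq(3) by (simp add: leg_def)
    then have "vb = b" "vc = c" "vd = d"
      by (simp_all add: vb_def vc_def vd_def pt_def eq(1,2)[symmetric] del: One_nat_def)
    then have verts: "[a, b, c, d] = verts" by (simp add: verts_def)
    show ?thesis
      using Linf_bound[OF _ C v[unfolded verts] tr[unfolded verts]] hm
      by (simp add: verts polygon_eq em_def)
  qed
  then show ?thesis by blast
qed

end
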